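(* (1) Let $K,F\subset\mathbb{R}^d$ be two dust-like self-similar sets with the same Hausdorff dimension $s$. If $F$ is homogeneous and there is a Lipschitz map $f: K\to F$ with $\mathcal{H}^s(f(K))>0$, then $K$ and $F$ are Lipschitz equivalent. (2) Without the homogeneity assumption, the existence of a Lipschitz surjection does not imply Lipschitz equivalence: there exist two dust-like self-similar sets $K,F\subset\mathbb{R}^d$ with the same Hausdorff dimension such that there is a Lipschitz map from $K$ onto $F$, but $K$ and $F$ are not Lipschitz equivalent.
   Context: Here $d\ge1$ is an integer. A self-similar set $K\subset\mathbb{R}^d$ is the attractor (the unique non-empty compact set with $K=\bigcup_{i=1}^n\varphi_i(K)$) of a finite iterated function system (IFS) $\Phi=\{\varphi_i\}_{i=1}^n$, where each $\varphi_i:\mathbb{R}^d\to\mathbb{R}^d$ is a contractive similitude (i.e. $|\varphi_i(x)-\varphi_i(y)|=r_i|x-y|$ for all $x,y$, with contraction ratio $r_i\in(0,1)$). It is called dust-like if $n\ge 2$ and the images $\varphi_1(K),\dots,\varphi_n(K)$ are pairwise disjoint (the strong separation condition, SSC). A dust-like self-similar set is homogeneous if all similitudes in the associated IFS share a common contraction ratio. $\mathcal{H}^s$ denotes the $s$-dimensional Hausdorff measure. Sets $A,B\subset\mathbb{R}^d$ are Lipschitz equivalent if there are a bijection $f:A\to B$ and a constant $c>0$ with $c^{-1}|x-y|\le|f(x)-f(y)|\le c|x-y|$ for all $x,y\in A$. *)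

theory Defs
  imports "HOL-Analysis.Analysis" "HOL-Analysis.Lipschitz" "HOL-Library.Disjoint_Sets"
begin

text \<open>The contribution of one covering set to the Hausdorff sum, with the usual conventions
  for the empty set and for exponent zero (in HOL \<open>0 powr 0 = 0\<close>, so the case \<open>s = 0\<close>
  is separate). The library \<open>diameter\<close> is meaningful for bounded sets only, hence the
  boundedness requirement on covers below.\<close>

definition diam_weight :: "real \<Rightarrow> 'a::metric_space set \<Rightarrow> ennreal" where
  "diam_weight s U =
     (if U = {} then 0 else if s = 0 then 1 else ennreal (diameter U powr s))"

text \<open>Countable covers are sequences of sets; finite covers are padded with empty sets.\<close>

definition hausdorff_premeasure :: "real \<Rightarrow> real \<Rightarrow> 'a::metric_space set \<Rightarrow> ennreal" where
  "hausdorff_premeasure \<delta> s A =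
     (INF U \<in> {U :: nat \<Rightarrow> 'a set. A \<subseteq> (\<Union>i. U i) \<and> (\<forall>i. bounded (U i) \<and> diameter (U i) \<le> \<delta>)}.
        (\<Sum>i. diam_weight s (U i)))"

text \<open>Unnormalised Hausdorff (outer) measure; only meant for \<open>s \<ge> 0\<close>.\<close>

definition hausdorff_measure :: "real \<Rightarrow> 'a::metric_space set \<Rightarrow> ennreal" where
  "hausdorff_measure s A = (SUP \<delta> \<in> {0<..}. hausdorff_premeasure \<delta> s A)"

definition hausdorff_dim :: "'a::metric_space set \<Rightarrow> ereal" where
  "hausdorff_dim A = Inf {ereal s | s. 0 \<le> s \<and> hausdorff_measure s A = 0}"

definition contractive_similitude :: "real \<Rightarrow> ('a::metric_space \<Rightarrow> 'a) \<Rightarrow> bool" where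
  "contractive_similitude r \<phi> \<longleftrightarrow> 0 < r \<and> r < 1 \<and> (\<forall>x y. dist (\<phi> x) (\<phi> y) = r * dist x y)"

text \<open>The IFS is \<open>\<phi> 0, \<dots>, \<phi> (n - 1)\<close>, with contraction ratios \<open>r 0, \<dots>, r (n - 1)\<close>. In a complete
  space a set \<open>K\<close> as in the last conjunct is unique, so \<open>K\<close> is the attractor.\<close>

definition self_similar_ifs ::
  "nat \<Rightarrow> (nat \<Rightarrow> real) \<Rightarrow> (nat \<Rightarrow> 'a::metric_space \<Rightarrow> 'a) \<Rightarrow> 'a set \<Rightarrow> bool" where
  "self_similar_ifs n r \<phi> K \<longleftrightarrow>
     (\<forall>i<n. contractive_similitude (r i) (\<phi> i)) \<and>
     (K \<noteq> {} \<and> compact K \<and> K = (\<Union>i<n. \<phi> i ` K))"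

definition dust_like_ifs ::
  "nat \<Rightarrow> (nat \<Rightarrow> real) \<Rightarrow> (nat \<Rightarrow> 'a::metric_space \<Rightarrow> 'a) \<Rightarrow> 'a set \<Rightarrow> bool" where
  "dust_like_ifs n r \<phi> K \<longleftrightarrow>
     self_similar_ifs n r \<phi> K \<and> 2 \<le> n \<and> disjoint_family_on (\<lambda>i. \<phi> i ` K) {..<n}"

definition dust_like :: "'a::metric_space set \<Rightarrow> bool" where
  "dust_like K \<longleftrightarrow> (\<exists>n r \<phi>. dust_like_ifs n r \<phi> K)"

definition homogeneous_dust_like :: "'a::metric_space set \<Rightarrow> bool" where
  "homogeneous_dust_like K \<longleftrightarrow>
     (\<exists>n r \<phi>. dust_like_ifs n r \<phi> K \<and> (\<exists>\<rho>. \<forall>i<n. r i = \<rho>))"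

definition lipschitz_map :: "'a::metric_space set \<Rightarrow> 'b::metric_space set \<Rightarrow> ('a \<Rightarrow> 'b) \<Rightarrow> bool" where
  "lipschitz_map A B f \<longleftrightarrow> f ` A \<subseteq> B \<and> (\<exists>L. L-lipschitz_on A f)"

definition lipschitz_equivalent :: "'a::metric_space set \<Rightarrow> 'b::metric_space set \<Rightarrow> bool" where
  "lipschitz_equivalent A B \<longleftrightarrow>
     (\<exists>f c. bij_betw f A B \<and> 0 < c \<and>
        (\<forall>x\<in>A. \<forall>y\<in>A. inverse c * dist x y \<le> dist (f x) (f y) \<and> dist (f x) (f y) \<le> c * dist x y))"

end

theory Submission
  imports Defs "HOL-Library.Stream" "HOL-Computational_Algebra.Fundamental_Theorem_Algebra"
begin

text \<open>Both parts are decided on symbolic models. The points of a dust-like set correspond to streams of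
letters, and strong separation makes the distance of two points comparable to the product of the contraction
ratios along the common prefix of their streams (\<open>dust_like_tree_coding\<close>). With
\<open>s\<close> the similarity exponent, which is the Hausdorff dimension
(\<open>hausdorff_dim_tree_coding\<close>), the numbers \<open>x i = r i powr s\<close> form a probability
vector; if \<open>F\<close> is homogeneous with \<open>m\<close> maps, all its letters have weight
\<open>1 / m\<close>.

\<^bold>\<open>A Lipschitz image of positive measure forces equivalence.\<close> In these coordinates the
map becomes a map \<open>g\<close> of streams that expands by at most some factor \<open>\<Lambda>\<close>
when distances are measured by the weights of common prefixes, and its image has positive content. Consider
the supremum \<open>M\<close> of content of the image divided by \<open>\<Lambda>\<close>, over all such
maps. If finitely many maps with constants \<open>\<Lambda> i\<close> together have a dense image, then
\<open>1 \<le> M * (\<Sum>i. \<Lambda> i)\<close>; call the family exact when equality holds. Magnifying a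
nearly optimal map near a typical place of its image yields families that are exact up to a small error
(\<open>near_exact_family\<close>), and by compactness there is a truly exact one
(\<open>exact_family_exists\<close>). Exactness is inherited: cut the domain into small pieces and sort them
by the cylinder of \<open>F\<close> that they hit. For each cylinder the inequality holds, the sum over all
cylinders is an equality, hence each of them is an equality (\<open>exact_pieces\<close>).

A second use of compactness gives a length \<open>L\<close> such that in every exact family each map meets
some word of length \<open>L\<close> that no other map meets (\<open>uniform_avoiding_length\<close>).
Applied at depth \<open>k\<close> to a piece whose address consists of \<open>r\<close> letters
\<open>i\<close>, this turns exactness into an equation \<open>c * x i ^ r * m ^ k = 1\<close> with a factor
\<open>c\<close> from a finite set that does not depend on \<open>k\<close>. Two depths with the same factor
give \<open>x i ^ d * m ^ e = 1\<close> (\<open>letter_weight_commensurable\<close>). As moreover the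
\<open>x i\<close> add up to 1, an argument on minimal polynomials shows that \<open>m = p ^ a\<close> and
\<open>x i = p ^ (- l i)\<close> for one integer \<open>p\<close> (\<open>common_integer_base\<close>). The
Kraft equality for the lengths \<open>l i\<close> provides a complete prefix code over \<open>p\<close>
letters; substituting code words for letters identifies \<open>K\<close> up to Lipschitz equivalence with
the uniform \<open>p\<close>-letter Cantor set of ratio \<open>p powr (- 1 / s)\<close>, and the same holds
for \<open>F\<close> (\<open>tree_coding_uniformly_coded\<close>).

\<^bold>\<open>Homogeneity cannot be dropped.\<close> Let \<open>u\<close> be the golden ratio conjugate, so
\<open>u + u ^ 2 = 1\<close> and \<open>4 * u ^ 3 + u ^ 6 = 1\<close>. Let \<open>K\<close> have two maps of
weights \<open>u\<close> and \<open>u ^ 2\<close>, and let \<open>F\<close> have four maps of weight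
\<open>u ^ 3\<close> and one of weight \<open>u ^ 6\<close>. Rewriting rules that replace a block of
\<open>K\<close>-letters by one \<open>F\<close>-letter and a remainder of the same total weight define a
Lipschitz map from \<open>K\<close> onto \<open>F\<close> (\<open>lipschitz_surjection_regroup\<close>). A
Lipschitz equivalence, however, would send cylinders of \<open>K\<close> to sets whose content, divided by
the weight of the cylinder, takes only finitely many values. Where this quotient is maximal it is constant
on all smaller cylinders, so the content \<open>\<alpha>\<close> of the image and
\<open>\<alpha> * u\<close> are both contents of clopen subsets of \<open>F\<close>, hence lie in
\<open>\<int>[\<surd>5]\<close> because \<open>u ^ 3 = \<surd>5 - 2\<close>. Since \<open>\<alpha>\<close>
times an element of \<open>\<int>[u]\<close> is a power of the unit \<open>u ^ 3\<close>, this would put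
\<open>u\<close> itself into \<open>\<int>[\<surd>5]\<close>, which is false
(\<open>no_bilipschitz_coding\<close>).\<close>

section \<open>Words, streams and their weights\<close>

abbreviation seqs :: "nat \<Rightarrow> nat stream set" where
  "seqs n \<equiv> streams {..<n}"

definition words :: "nat \<Rightarrow> nat \<Rightarrow> nat list set" where
  "words n k = {w. set w \<subseteq> {..<n} \<and> length w = k}"

definition weight :: "(nat \<Rightarrow> real) \<Rightarrow> nat list \<Rightarrow> real" where
  "weight x w = prod_list (map x w)"

lemma weight_simps [simp]:
  "weight x [] = 1" "weight x (i # w) = x i * weight x w" "weight x (v @ w) = weight x v * weight x w"
  by (simp_all add: weight_def)

lemma weight_replicate [simp]: "weight x (replicate k i) = x i ^ k"
  by (induction k) auto

lemma weight_const [simp]: "weight (\<lambda>_. c) w = c ^ length w"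
  by (induction w) auto

lemma finite_words [simp]: "finite (words n k)"
  unfolding words_def by (rule finite_lists_length_eq) simp

lemma words_0 [simp]: "words n 0 = {[]}"
  by (auto simp: words_def)

lemma words_Suc: "words n (Suc k) = (\<lambda>(i, w). i # w) ` ({..<n} \<times> words n k)"
  by (force simp: words_def length_Suc_conv image_iff)

lemma card_words: "card (words p k) = p ^ k"
  unfolding words_def by (subst card_lists_length_eq) auto

lemma sum_words_power: "(\<Sum>w\<in>words n k. weight x w) = (\<Sum>i<n. x i) ^ k"
proof (induction k)
  case (Suc k)
  have "(\<Sum>w\<in>words n (Suc k). weight x w) = (\<Sum>(i, w)\<in>{..<n} \<times> words n k. weight x (i # w))"
    unfolding words_Suc by (subst sum.reindex) (auto simp: inj_on_def case_prod_unfold)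
  also have "\<dots> = (\<Sum>i<n. x i * (\<Sum>w\<in>words n k. weight x w))"
    by (simp add: sum.cartesian_product[symmetric] sum_distrib_left)
  finally show ?case using Suc by (simp add: sum_distrib_right)
qed simp

lemma words_length: "w \<in> words n k \<Longrightarrow> length w = k"
  and words_set: "w \<in> words n k \<Longrightarrow> set w \<subseteq> {..<n}"
  by (auto simp: words_def)

lemma set_stake: "\<omega> \<in> seqs n \<Longrightarrow> set (stake k \<omega>) \<subseteq> {..<n}"
  by (auto simp: streams_iff_snth in_set_conv_nth)

lemma stake_in_words: "\<omega> \<in> seqs n \<Longrightarrow> stake k \<omega> \<in> words n k"
  by (simp add: words_def set_stake)

lemma shift_in_seqs_iff: "w @- \<omega> \<in> seqs n \<longleftrightarrow> set w \<subseteq> {..<n} \<and> \<omega> \<in> seqs n"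
  by (simp add: streams_iff_sset)

lemma sdrop_in_seqs: "\<omega> \<in> seqs n \<Longrightarrow> sdrop k \<omega> \<in> seqs n"
  by (auto simp: streams_iff_snth sdrop_snth)

lemma stake_shift_length [simp]: "stake (length w) (w @- \<omega>) = w"
  by (simp add: stake_shift)

lemma stake_eq_mono: "stake k \<omega> = stake k \<omega>' \<Longrightarrow> l \<le> k \<Longrightarrow> stake l \<omega> = stake l \<omega>'"
  by (metis min.absorb1 take_stake)

lemma stream_eq_iff_stake: "\<omega> = \<omega>' \<longleftrightarrow> (\<forall>k. stake k \<omega> = stake k \<omega>')"
proof
  assume eq: "\<forall>k. stake k \<omega> = stake k \<omega>'"
  have "\<omega> !! k = \<omega>' !! k" for k
    using stake_nth[of k "Suc k" \<omega>] stake_nth[of k "Suc k" \<omega>'] eq by simp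
  then show "\<omega> = \<omega>'" by (metis ext stream_smap_nats)
qed simp

lemma ex_first_difference:
  "stake j \<omega> \<noteq> stake j \<omega>' \<Longrightarrow> \<exists>k<j. stake k \<omega> = stake k \<omega>' \<and> \<omega> !! k \<noteq> \<omega>' !! k"
proof (induction j)
  case (Suc j)
  show ?case
  proof (cases "stake j \<omega> = stake j \<omega>'")
    case True
    then have "\<omega> !! j \<noteq> \<omega>' !! j" using Suc.prems by (simp add: stake_Suc del: stake.simps)
    then show ?thesis using True by blast
  next
    case False
    then show ?thesis using Suc.IH less_Suc_eq by blast
  qed
qed simp

section \<open>Content of a set of streams\<close>

text \<open>For the product measure given by a probability vector, \<open>stream_content x A\<close> is the measure
of the closure of \<open>A\<close>: the level sums measure the unions of the cylinders of a fixed depth that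
meet \<open>A\<close>.\<close>

definition level_sum :: "(nat \<Rightarrow> real) \<Rightarrow> nat stream set \<Rightarrow> nat \<Rightarrow> real" where
  "level_sum x A k = (\<Sum>w\<in>stake k ` A. weight x w)"

definition stream_content :: "(nat \<Rightarrow> real) \<Rightarrow> nat stream set \<Rightarrow> real" where
  "stream_content x A = (INF k. level_sum x A k)"

locale prob_vector =
  fixes n :: nat and x :: "nat \<Rightarrow> real"
  assumes pos: "i < n \<Longrightarrow> 0 < x i" and sum_1: "(\<Sum>i<n. x i) = 1"
begin

lemma n_pos: "0 < n"
  using sum_1 by (cases n) auto

lemma zeros_in_seqs: "sconst 0 \<in> seqs n"
  using n_pos by (auto intro: sconst_streams)

lemma weight_pos: "set w \<subseteq> {..<n} \<Longrightarrow> 0 < weight x w"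
  by (induction w) (auto intro!: mult_pos_pos pos)

lemma x_le_1: "i < n \<Longrightarrow> x i \<le> 1"
  using member_le_sum[of i "{..<n}" x] pos sum_1 by (auto intro: less_imp_le)

lemma sum_weight_snoc: "(\<Sum>i<n. weight x (w @ [i])) = weight x w"
  using sum_1 by (simp add: sum_distrib_left[symmetric])

lemma sum_words: "(\<Sum>w\<in>words n k. weight x w) = 1"
  using sum_1 by (simp add: sum_words_power)

lemma finite_prefixes: "A \<subseteq> seqs n \<Longrightarrow> finite (stake k ` A)"
  by (rule finite_subset[OF _ finite_words[of n k]]) (auto intro: stake_in_words)

lemma prefixes_nonneg: "A \<subseteq> seqs n \<Longrightarrow> w \<in> stake k ` A \<Longrightarrow> 0 \<le> weight x w"
  by (erule imageE) (simp add: less_imp_le set_stake subsetD weight_pos)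

lemma words_nonneg: "w \<in> words n k \<Longrightarrow> 0 \<le> weight x w"
  by (simp add: weight_pos words_def less_imp_le)

lemma level_sum_nonneg: "A \<subseteq> seqs n \<Longrightarrow> 0 \<le> level_sum x A k"
  unfolding level_sum_def by (rule sum_nonneg) (rule prefixes_nonneg)

lemma level_sum_mono: "A \<subseteq> B \<Longrightarrow> B \<subseteq> seqs n \<Longrightarrow> level_sum x A k \<le> level_sum x B k"
  unfolding level_sum_def
  by (rule sum_mono2; (elim DiffE)?; (rule finite_prefixes image_mono prefixes_nonneg; assumption))

lemma level_sum_le_1: assumes "A \<subseteq> seqs n" shows "level_sum x A k \<le> 1"
proof -
  have "level_sum x A k \<le> (\<Sum>w\<in>words n k. weight x w)"
    unfolding level_sum_def
    by (rule sum_mono2) (use assms in \<open>auto intro: stake_in_words words_nonneg\<close>)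
  then show ?thesis by (simp add: sum_words)
qed

text \<open>A word of length \<open>k + 1\<close> that meets \<open>A\<close> extends one of length
\<open>k\<close> that does, and the weights of all one-letter extensions of a word add up to its own weight.\<close>

lemma decseq_level_sum: assumes A: "A \<subseteq> seqs n" shows "decseq (level_sum x A)"
proof (rule decseq_SucI)
  fix k
  have "level_sum x A (Suc k) \<le> (\<Sum>w\<in>(\<lambda>(w, i). w @ [i]) ` (stake k ` A \<times> {..<n}). weight x w)"
    unfolding level_sum_def
  proof (rule sum_mono2)
    show "stake (Suc k) ` A \<subseteq> (\<lambda>(w, i). w @ [i]) ` (stake k ` A \<times> {..<n})"
    proof
      fix v assume "v \<in> stake (Suc k) ` A"
      then obtain \<omega> where \<omega>: "\<omega> \<in> A" "v = stake k \<omega> @ [\<omega> !! k]" by (auto simp only: stake_Suc)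
      then have "\<omega> !! k < n" using A by (auto simp: streams_iff_snth)
      then show "v \<in> (\<lambda>(w, i). w @ [i]) ` (stake k ` A \<times> {..<n})" using \<omega> by force
    qed
    show "0 \<le> weight x b" if "b \<in> (\<lambda>(w, i). w @ [i]) ` (stake k ` A \<times> {..<n}) - stake (Suc k) ` A" for b
    proof -
      from that have "b \<in> (\<lambda>(w, i). w @ [i]) ` (stake k ` A \<times> {..<n})" by (rule DiffD1)
      then obtain p where p: "p \<in> stake k ` A \<times> {..<n}" "b = (case p of (w, i) \<Rightarrow> w @ [i])"
        by (rule imageE)
      obtain w i where wi: "w \<in> stake k ` A" "i < n" "b = w @ [i]"
        using p by (cases p) force
      then show ?thesis
        using pos[OF wi(2)] prefixes_nonneg[OF A wi(1)] by simp
    qed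
    show "finite ((\<lambda>(w, i). w @ [i]) ` (stake k ` A \<times> {..<n}))"
      by (intro finite_imageI finite_cartesian_product finite_prefixes A finite_lessThan)
  qed
  also have "\<dots> = (\<Sum>(w, i)\<in>stake k ` A \<times> {..<n}. weight x (w @ [i]))"
    by (subst sum.reindex) (auto simp: inj_on_def case_prod_unfold)
  also have "\<dots> = (\<Sum>w\<in>stake k ` A. weight x w)"
    unfolding sum.cartesian_product[symmetric] sum_weight_snoc ..
  finally show "level_sum x A (Suc k) \<le> level_sum x A k" by (simp add: level_sum_def)
qed

lemma level_sum_tendsto: "A \<subseteq> seqs n \<Longrightarrow> level_sum x A \<longlonglongrightarrow> stream_content x A"
  unfolding stream_content_def
  by (intro LIMSEQ_decseq_INF decseq_level_sum bdd_belowI[of _ 0]) (auto simp: level_sum_nonneg)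

lemma stream_content_le_level_sum: "A \<subseteq> seqs n \<Longrightarrow> stream_content x A \<le> level_sum x A k"
  by (rule decseq_ge[OF decseq_level_sum level_sum_tendsto])

lemma stream_content_nonneg: "A \<subseteq> seqs n \<Longrightarrow> 0 \<le> stream_content x A"
  by (rule LIMSEQ_le_const[OF level_sum_tendsto]) (auto simp: level_sum_nonneg)

lemma stream_content_le_1: "A \<subseteq> seqs n \<Longrightarrow> stream_content x A \<le> 1"
  by (rule LIMSEQ_le_const2[OF level_sum_tendsto]) (auto simp: level_sum_le_1)

lemma stream_content_mono: "A \<subseteq> B \<Longrightarrow> B \<subseteq> seqs n \<Longrightarrow> stream_content x A \<le> stream_content x B"
  by (rule LIMSEQ_le[OF level_sum_tendsto level_sum_tendsto]) (auto simp: level_sum_mono)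

lemma stream_content_empty: "stream_content x {} = 0"
  by (simp add: stream_content_def level_sum_def)

lemma stream_content_UN_le:
  assumes "finite I" "\<And>i. i \<in> I \<Longrightarrow> A i \<subseteq> seqs n"
  shows "stream_content x (\<Union>i\<in>I. A i) \<le> (\<Sum>i\<in>I. stream_content x (A i))"
  using assms
proof (induction I)
  case (insert i I)
  let ?B = "\<Union>i\<in>I. A i"
  have sub: "A i \<subseteq> seqs n" "?B \<subseteq> seqs n" using insert.prems by auto
  have "level_sum x (A i \<union> ?B) k \<le> level_sum x (A i) k + level_sum x ?B k" for k
  proof -
    have "level_sum x (A i \<union> ?B) k + sum (weight x) (stake k ` A i \<inter> stake k ` ?B)
        = level_sum x (A i) k + level_sum x ?B k"
      unfolding level_sum_def image_Un by (rule sum.union_inter) (simp_all only: finite_prefixes sub)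
    moreover have "0 \<le> sum (weight x) (stake k ` A i \<inter> stake k ` ?B)"
      using prefixes_nonneg[OF sub(1)] by (intro sum_nonneg) blast
    ultimately show ?thesis by linarith
  qed
  then have "stream_content x (A i \<union> ?B) \<le> stream_content x (A i) + stream_content x ?B"
    using sub by (intro LIMSEQ_le[OF level_sum_tendsto tendsto_add[OF level_sum_tendsto level_sum_tendsto]]) auto
  then show ?case using insert by fastforce
qed (simp add: stream_content_empty)

lemma level_sum_shift:
  "level_sum x ((@-) v ` A) (length v + k) = weight x v * level_sum x A k"
proof -
  have "stake (length v + k) ` (@-) v ` A = (@) v ` stake k ` A"
    by (auto simp: image_image stake_shift)
  then show ?thesis
    unfolding level_sum_def by (simp add: sum.reindex inj_on_def sum_distrib_left)
qed

lemma stream_content_shift: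
  assumes A: "A \<subseteq> seqs n" and v: "set v \<subseteq> {..<n}"
  shows "stream_content x ((@-) v ` A) = weight x v * stream_content x A"
proof -
  have sub: "(@-) v ` A \<subseteq> seqs n" using A v by (auto simp: shift_in_seqs_iff)
  have "(\<lambda>k. level_sum x ((@-) v ` A) (length v + k)) \<longlonglongrightarrow> stream_content x ((@-) v ` A)"
    using LIMSEQ_ignore_initial_segment[OF level_sum_tendsto[OF sub], of "length v"] by (simp add: add.commute)
  moreover have "(\<lambda>k. level_sum x ((@-) v ` A) (length v + k)) \<longlonglongrightarrow> weight x v * stream_content x A"
    unfolding level_sum_shift by (intro tendsto_mult_left level_sum_tendsto A)
  ultimately show ?thesis by (rule LIMSEQ_unique)
qed

text \<open>The content of a set only sees its closure; in particular dense sets have full content.\<close>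

lemma stream_content_eq_1:
  assumes "A \<subseteq> seqs n" "\<And>k. words n k \<subseteq> stake k ` A"
  shows "stream_content x A = 1"
proof -
  have "stake k ` A = words n k" for k
    using assms by (auto intro: stake_in_words)
  then show ?thesis by (simp add: stream_content_def level_sum_def sum_words)
qed

end

section \<open>Weighted Lipschitz maps and their yield\<close>

lemma prob_vector_uniform: "2 \<le> m \<Longrightarrow> prob_vector m (\<lambda>_. 1 / real m)"
  by unfold_locales auto

text \<open>The domain is the space of streams over \<open>n\<close> letters with weights \<open>x\<close>, the
target the space of streams over \<open>m\<close> letters of equal weight. They model a dust-like set and a
homogeneous one.\<close>

locale tree_maps = prob_vector n x for n x +
  fixes m :: nat
  assumes n2: "2 \<le> n" and m2: "2 \<le> m"
begin

sublocale unif: prob_vector m "\<lambda>_. 1 / real m"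
  by (rule prob_vector_uniform[OF m2])

abbreviation nu :: "nat stream set \<Rightarrow> real" where
  "nu A \<equiv> stream_content (\<lambda>_. 1 / real m) A"

text \<open>Let the distance of two streams be the weight of their longest common prefix. Then
\<open>wlip \<Lambda> g\<close> says that \<open>g\<close> is Lipschitz with constant
\<open>\<Lambda>\<close>: a distance of the images below \<open>m ^ (- l)\<close> means agreement in at
least \<open>l + 1\<close> letters. For sets coded with ratios \<open>x i powr (1 / s)\<close> this is a
Lipschitz condition with constant \<open>\<Lambda> powr (1 / s)\<close>, up to a bounded factor.\<close>

definition wlip :: "real \<Rightarrow> (nat stream \<Rightarrow> nat stream) \<Rightarrow> bool" where
  "wlip \<Lambda> g \<longleftrightarrow> g \<in> seqs n \<rightarrow> seqs m \<and>
     (\<forall>\<omega>\<in>seqs n. \<forall>\<omega>'\<in>seqs n. \<forall>k l. stake k \<omega> = stake k \<omega>' \<longrightarrow>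
        \<Lambda> * weight x (stake k \<omega>) * real m ^ l < 1 \<longrightarrow> stake (Suc l) (g \<omega>) = stake (Suc l) (g \<omega>'))"

lemma wlipD:
  assumes "wlip \<Lambda> g" "\<omega> \<in> seqs n" "\<omega>' \<in> seqs n" "stake k \<omega> = stake k \<omega>'"
    and "\<Lambda> * weight x (stake k \<omega>) * real m ^ l < 1"
  shows "stake (Suc l) (g \<omega>) = stake (Suc l) (g \<omega>')"
  using assms unfolding wlip_def by blast

lemma wlip_seqs: "wlip \<Lambda> g \<Longrightarrow> \<omega> \<in> seqs n \<Longrightarrow> g \<omega> \<in> seqs m"
  by (auto simp: wlip_def)

lemma wlip_image: "wlip \<Lambda> g \<Longrightarrow> g ` seqs n \<subseteq> seqs m"
  by (auto simp: wlip_def)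

lemma wlip_restrict:
  assumes g: "wlip \<Lambda> g" and u: "set u \<subseteq> {..<n}"
  shows "wlip (\<Lambda> * weight x u) (\<lambda>\<omega>. g (u @- \<omega>))"
  unfolding wlip_def
proof (intro conjI ballI allI impI)
  show "(\<lambda>\<omega>. g (u @- \<omega>)) \<in> seqs n \<rightarrow> seqs m"
    using g u by (auto intro!: wlip_seqs[OF g] simp: shift_in_seqs_iff)
  fix \<omega> \<omega>' k l
  assume "\<omega> \<in> seqs n" "\<omega>' \<in> seqs n" and eq: "stake k \<omega> = stake k \<omega>'"
    and less: "\<Lambda> * weight x u * weight x (stake k \<omega>) * real m ^ l < 1"
  show "stake (Suc l) (g (u @- \<omega>)) = stake (Suc l) (g (u @- \<omega>'))"
  proof (rule wlipD[OF g])
    show "u @- \<omega> \<in> seqs n" "u @- \<omega>' \<in> seqs n"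
      using u \<open>\<omega> \<in> seqs n\<close> \<open>\<omega>' \<in> seqs n\<close> by (simp_all add: shift_in_seqs_iff)
    show "stake (length u + k) (u @- \<omega>) = stake (length u + k) (u @- \<omega>')"
      using eq by (simp add: stake_shift)
    show "\<Lambda> * weight x (stake (length u + k) (u @- \<omega>)) * real m ^ l < 1"
      using less by (simp add: stake_shift mult.assoc)
  qed
qed

lemma wlip_stake_eq:
  assumes g: "wlip \<Lambda> g" and less: "\<Lambda> * real m ^ k < m" and \<omega>: "\<omega> \<in> seqs n" "\<omega>' \<in> seqs n"
  shows "stake k (g \<omega>) = stake k (g \<omega>')"
proof (cases k)
  case (Suc l)
  have "\<Lambda> * real m ^ l < 1" using less m2 Suc by (simp add: field_simps)
  then show ?thesis
    unfolding Suc using \<omega> by (intro wlipD[OF g, where k = 0]) auto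
qed simp

lemma wlip_sdrop:
  assumes g: "wlip \<Lambda> g" shows "wlip (\<Lambda> * real m ^ k) (\<lambda>\<omega>. sdrop k (g \<omega>))"
  unfolding wlip_def
proof (intro conjI ballI allI impI)
  show "(\<lambda>\<omega>. sdrop k (g \<omega>)) \<in> seqs n \<rightarrow> seqs m"
    using wlip_seqs[OF g] by (auto intro: sdrop_in_seqs)
  fix \<omega> \<omega>' i l
  assume "\<omega> \<in> seqs n" "\<omega>' \<in> seqs n" and eq: "stake i \<omega> = stake i \<omega>'"
    and less: "\<Lambda> * real m ^ k * weight x (stake i \<omega>) * real m ^ l < 1"
  then have "stake (Suc (k + l)) (g \<omega>) = stake (Suc (k + l)) (g \<omega>')"
    by (intro wlipD[OF g, where k = i]) (simp_all add: power_add mult_ac)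
  then have "drop k (stake (Suc (k + l)) (g \<omega>)) = drop k (stake (Suc (k + l)) (g \<omega>'))"
    by simp
  moreover have "Suc (k + l) - k = Suc l" by simp
  ultimately show "stake (Suc l) (sdrop k (g \<omega>)) = stake (Suc l) (sdrop k (g \<omega>'))"
    by (simp only: drop_stake)
qed

text \<open>Restricting to the cylinder of \<open>u\<close> in the domain and magnifying by \<open>m ^ k\<close> in
the target scales the constant accordingly.\<close>

lemma wlip_piece:
  assumes "wlip \<Lambda> g" "set u \<subseteq> {..<n}"
  shows "wlip (\<Lambda> * weight x u * real m ^ k) (\<lambda>\<omega>. sdrop k (g (u @- \<omega>)))"
  using wlip_sdrop[OF wlip_restrict[OF assms]] .

text \<open>Choose the least \<open>k\<close> with \<open>1 \<le> \<Lambda> * m ^ k\<close>. The constant forces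
the whole image into a single cylinder of level \<open>k\<close>, whose content \<open>m ^ (- k)\<close> is
at most \<open>\<Lambda>\<close>.\<close>

lemma nu_image_le:
  assumes g: "wlip \<Lambda> g" and \<Lambda>: "0 < \<Lambda>"
  shows "nu (g ` seqs n) \<le> \<Lambda>"
proof (cases "1 \<le> \<Lambda>")
  case True
  then show ?thesis using unif.stream_content_le_1[OF wlip_image[OF g]] by linarith
next
  case False
  obtain k0 where "1 / \<Lambda> < real m ^ k0"
    using real_arch_pow[of "real m" "1 / \<Lambda>"] m2 by auto
  then have ex: "1 \<le> \<Lambda> * real m ^ k0" using \<Lambda> by (simp add: field_simps)
  define k where "k = (LEAST k. 1 \<le> \<Lambda> * real m ^ k)"
  have k: "1 \<le> \<Lambda> * real m ^ k" unfolding k_def by (rule LeastI[of _ k0]) (rule ex)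
  with False obtain l where l: "k = Suc l" by (cases k) auto
  have "\<not> 1 \<le> \<Lambda> * real m ^ l"
    using not_less_Least[of l "\<lambda>k. 1 \<le> \<Lambda> * real m ^ k"] l unfolding k_def by simp
  then have less: "\<Lambda> * real m ^ k < m" using m2 by (simp add: l field_simps)
  note z = zeros_in_seqs
  have "stake k (g \<omega>) = stake k (g (sconst 0))" if "\<omega> \<in> seqs n" for \<omega>
    using g less that z by (rule wlip_stake_eq)
  then have "stake k ` g ` seqs n = (\<lambda>_. stake k (g (sconst 0))) ` seqs n"
    unfolding image_image by (rule image_cong[OF refl])
  also have "\<dots> = {stake k (g (sconst 0))}"
    using z by (rule image_constant)
  finally have "stake k ` g ` seqs n = {stake k (g (sconst 0))}" .
  then have "level_sum (\<lambda>_. 1 / real m) (g ` seqs n) k = (1 / m) ^ k"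
    by (simp add: level_sum_def)
  also have "\<dots> \<le> \<Lambda>" using k m2 by (simp add: field_simps)
  finally show ?thesis
    using unif.stream_content_le_level_sum[OF wlip_image[OF g], of k] by linarith
qed

text \<open>The largest content of an image that can be bought per unit of Lipschitz constant; it is at most 1 by
the preceding bound.\<close>

definition max_yield :: real where
  "max_yield = Sup {nu (g ` seqs n) / \<Lambda> | g \<Lambda>. 0 < \<Lambda> \<and> wlip \<Lambda> g}"

lemma bdd_yield: "bdd_above {nu (g ` seqs n) / \<Lambda> | g \<Lambda>. 0 < \<Lambda> \<and> wlip \<Lambda> g}"
  using nu_image_le by (auto intro!: bdd_aboveI[of _ 1] simp: divide_le_eq)

lemma nu_le_max_yield:
  assumes "wlip \<Lambda> g" "0 < \<Lambda>"
  shows "nu (g ` seqs n) \<le> max_yield * \<Lambda>"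
proof -
  have "nu (g ` seqs n) / \<Lambda> \<le> max_yield"
    unfolding max_yield_def using assms by (intro cSup_upper bdd_yield) auto
  then show ?thesis using assms by (simp add: field_simps)
qed

section \<open>Cutting streams into pieces of comparable size\<close>

text \<open>The leaves of a finite tree of prefixes: every stream passes through one of the words, and the total
weight 1 expresses that it does so only once.\<close>

definition complete :: "nat list set \<Rightarrow> bool" where
  "complete D \<longleftrightarrow> finite D \<and> (\<forall>u\<in>D. set u \<subseteq> {..<n}) \<and> (\<Sum>u\<in>D. weight x u) = 1 \<and>
     (\<forall>\<omega>\<in>seqs n. \<exists>u\<in>D. \<exists>\<eta>\<in>seqs n. \<omega> = u @- \<eta>)"

lemma complete_words: "complete (words n q)"
  unfolding complete_def
proof (intro conjI ballI)
  fix \<omega> assume "\<omega> \<in> seqs n"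
  then show "\<exists>u\<in>words n q. \<exists>\<eta>\<in>seqs n. \<omega> = u @- \<eta>"
    by (metis sdrop_in_seqs stake_in_words stake_sdrop)
qed (auto simp: sum_words dest: words_set)

text \<open>Starting with a map of constant \<open>\<theta>\<close>, descend until the constant of the restricted
map drops below \<open>m\<close>. The first argument bounds the depth of the descent; if it is large enough
(\<open>stop_words_upper\<close>), then all the resulting constants lie between \<open>m * xmin\<close> and
\<open>m\<close>. If the constant is below \<open>m\<close> after magnification by \<open>m ^ k\<close>,
then the image of the piece lies in a single cylinder of level \<open>k\<close>
(\<open>wlip_stake_eq\<close>).\<close>

primrec stop_words :: "nat \<Rightarrow> real \<Rightarrow> nat list set" where
  "stop_words 0 \<theta> = {[]}"
| "stop_words (Suc q) \<theta> = (if \<theta> < m then {[]} else (\<Union>i<n. (#) i ` stop_words q (\<theta> * x i)))"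

definition "xmin = Min (x ` {..<n})"
definition "xmax = Max (x ` {..<n})"

lemma xmin_le: "i < n \<Longrightarrow> xmin \<le> x i" and xmax_ge: "i < n \<Longrightarrow> x i \<le> xmax"
  by (auto simp: xmin_def xmax_def)

lemma xmin_pos: "0 < xmin"
proof -
  have "Min (x ` {..<n}) \<in> x ` {..<n}" using n_pos by (intro Min_in) auto
  then show ?thesis using pos by (auto simp: xmin_def)
qed

lemma x_less_1: assumes "i < n" shows "x i < 1"
proof -
  obtain j where j: "j < n" "j \<noteq> i"
    using n2 by (intro that[of "if i = 0 then 1 else 0"]) auto
  have "x i + x j = (\<Sum>k\<in>{i, j}. x k)" using j by simp
  also have "\<dots> \<le> (\<Sum>k<n. x k)"
    using j assms pos by (intro sum_mono2) (auto intro: less_imp_le)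
  finally show ?thesis using pos[OF j(1)] sum_1 by linarith
qed

lemma xmax_less_1: "xmax < 1"
proof -
  have "Max (x ` {..<n}) \<in> x ` {..<n}" using n_pos by (intro Max_in) auto
  then show ?thesis using x_less_1 by (auto simp: xmax_def)
qed

lemma xmax_pos: "0 < xmax"
  using pos[OF n_pos] xmax_ge[OF n_pos] by linarith

lemma xmin_le_1: "xmin \<le> 1"
  using xmin_le[OF n_pos] x_le_1[OF n_pos] by linarith

lemma weight_le_xmax: "set w \<subseteq> {..<n} \<Longrightarrow> weight x w \<le> xmax ^ length w"
  by (induction w) (auto intro!: mult_mono xmax_ge less_imp_le[OF weight_pos] less_imp_le[OF xmax_pos])

lemma ex_xmax_power: assumes "0 < e" shows "\<exists>q. c * xmax ^ q < e"
proof -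
  have "(\<lambda>q. c * xmax ^ q) \<longlonglongrightarrow> c * 0"
    using xmax_pos xmax_less_1 by (intro tendsto_mult_left LIMSEQ_power_zero) auto
  then have "eventually (\<lambda>q. c * xmax ^ q < e) sequentially"
    using assms by (intro order_tendstoD) auto
  then show ?thesis by (auto simp: eventually_sequentially)
qed

lemma stop_words_set: "u \<in> stop_words q \<theta> \<Longrightarrow> set u \<subseteq> {..<n}"
proof (induction q arbitrary: \<theta> u)
  case (Suc q)
  show ?case
  proof (cases "\<theta> < m")
    case False
    then obtain i v where "i < n" "v \<in> stop_words q (\<theta> * x i)" "u = i # v" using Suc.prems by auto
    then show ?thesis using Suc.IH by simp
  qed (use Suc.prems in auto)
qed auto

lemma finite_stop_words: "finite (stop_words q \<theta>)"
  by (induction q arbitrary: \<theta>) auto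

lemma sum_stop_words: "(\<Sum>u\<in>stop_words q \<theta>. weight x u) = 1"
proof (induction q arbitrary: \<theta>)
  case (Suc q)
  show ?case
  proof (cases "\<theta> < m")
    case False
    have "(\<Sum>u\<in>stop_words (Suc q) \<theta>. weight x u) = (\<Sum>i<n. \<Sum>u\<in>(#) i ` stop_words q (\<theta> * x i). weight x u)"
      using False by (simp, subst sum.UNION_disjoint) (auto simp: finite_stop_words)
    also have "\<dots> = (\<Sum>i<n. x i)"
      by (simp add: sum.reindex Suc.IH flip: sum_distrib_left)
    finally show ?thesis using sum_1 by simp
  qed simp
qed simp

lemma stop_words_cover: "\<omega> \<in> seqs n \<Longrightarrow> \<exists>u\<in>stop_words q \<theta>. \<exists>\<eta>\<in>seqs n. \<omega> = u @- \<eta>"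
proof (induction q arbitrary: \<theta> \<omega>)
  case (Suc q)
  show ?case
  proof (cases "\<theta> < m")
    case False
    obtain i \<omega>' where \<omega>: "\<omega> = i ## \<omega>'" "i < n" "\<omega>' \<in> seqs n"
      using Suc.prems by (cases \<omega>) (auto simp: streams_Stream)
    with Suc.IH[OF \<omega>(3), of "\<theta> * x i"] obtain u \<eta> where
      "u \<in> stop_words q (\<theta> * x i)" "\<eta> \<in> seqs n" "\<omega>' = u @- \<eta>" by blast
    then have "i # u \<in> stop_words (Suc q) \<theta>" "\<omega> = (i # u) @- \<eta>" using False \<omega> by auto
    then show ?thesis using \<open>\<eta> \<in> seqs n\<close> by blast
  qed (use Suc.prems in auto)
qed auto

lemma complete_stop_words: "complete (stop_words q \<theta>)"
  unfolding complete_def by (auto simp: finite_stop_words sum_stop_words dest: stop_words_set intro: stop_words_cover)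

lemma stop_words_upper: "0 < \<theta> \<Longrightarrow> \<theta> * xmax ^ q < m \<Longrightarrow> u \<in> stop_words q \<theta> \<Longrightarrow> \<theta> * weight x u < m"
proof (induction q arbitrary: \<theta> u)
  case (Suc q)
  show ?case
  proof (cases "\<theta> < m")
    case False
    then obtain i v where v: "i < n" "v \<in> stop_words q (\<theta> * x i)" "u = i # v"
      using Suc.prems by auto
    have "\<theta> * x i * xmax ^ q \<le> \<theta> * xmax * xmax ^ q"
      using xmax_ge[OF v(1)] Suc.prems(1) xmax_pos by (intro mult_right_mono mult_left_mono) auto
    then have "\<theta> * x i * xmax ^ q < m" using Suc.prems(2) by (simp add: mult_ac)
    then show ?thesis
      using Suc.IH[OF _ _ v(2)] Suc.prems(1) pos[OF v(1)] v(3) by (simp add: mult_ac)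
  qed (use Suc.prems in auto)
qed auto

lemma stop_words_lower: "m * xmin \<le> \<theta> \<Longrightarrow> u \<in> stop_words q \<theta> \<Longrightarrow> m * xmin \<le> \<theta> * weight x u"
proof (induction q arbitrary: \<theta> u)
  case (Suc q)
  show ?case
  proof (cases "\<theta> < m")
    case False
    then obtain i v where v: "i < n" "v \<in> stop_words q (\<theta> * x i)" "u = i # v"
      using Suc.prems by auto
    have "m * xmin \<le> \<theta> * x i"
      using xmin_le[OF v(1)] False xmin_pos m2 by (intro mult_mono) auto
    then show ?thesis using Suc.IH[OF _ v(2)] v(3) by (simp add: mult_ac)
  qed (use Suc.prems in auto)
qed auto

lemma stop_words_replicate: "i < n \<Longrightarrow> \<exists>r. replicate r i \<in> stop_words q \<theta>"
proof (induction q arbitrary: \<theta>)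
  case 0
  then show ?case by (intro exI[of _ 0]) simp
next
  case (Suc q)
  then obtain r where "replicate r i \<in> stop_words q (\<theta> * x i)" by blast
  then have "replicate (Suc r) i \<in> stop_words (Suc q) \<theta>" if "\<not> \<theta> < m"
    using that Suc.prems by auto
  moreover have "replicate 0 i \<in> stop_words (Suc q) \<theta>" if "\<theta> < m" using that by simp
  ultimately show ?case by blast
qed

section \<open>Exact families\<close>

text \<open>A family with dense union of images has full content, so
\<open>1 \<le> max_yield * sum \<Lambda> I\<close> for all such families. The exact ones are those in which
nothing is wasted.\<close>

definition exact :: "'i set \<Rightarrow> ('i \<Rightarrow> real) \<Rightarrow> ('i \<Rightarrow> nat stream \<Rightarrow> nat stream) \<Rightarrow> bool" where
  "exact I \<Lambda> g \<longleftrightarrow> finite I \<and> (\<forall>i\<in>I. 0 < \<Lambda> i \<and> wlip (\<Lambda> i) (g i)) \<and> max_yield * sum \<Lambda> I = 1 \<and>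
     (\<forall>k. words m k \<subseteq> stake k ` (\<Union>i\<in>I. g i ` seqs n))"

lemma nu_family_le:
  assumes "finite I" "\<And>i. i \<in> I \<Longrightarrow> 0 < \<Lambda> i \<and> wlip (\<Lambda> i) (g i)"
  shows "nu (\<Union>i\<in>I. g i ` seqs n) \<le> max_yield * sum \<Lambda> I"
proof -
  have "nu (\<Union>i\<in>I. g i ` seqs n) \<le> (\<Sum>i\<in>I. nu (g i ` seqs n))"
    using assms by (intro unif.stream_content_UN_le wlip_image) auto
  also have "\<dots> \<le> (\<Sum>i\<in>I. max_yield * \<Lambda> i)"
    using assms by (intro sum_mono nu_le_max_yield) auto
  finally show ?thesis by (simp add: sum_distrib_left)
qed

text \<open>Exactness is inherited by the part of a family that lies over a cylinder \<open>J\<close> of level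
\<open>k\<close>. Each piece \<open>u\<close> is so small that its image lies over one cylinder. Over each
of the \<open>m ^ k\<close> cylinders the pieces have dense image, which gives
\<open>1 \<le> max_yield * sum L\<close>; the sum of the right-hand sides over all cylinders is
\<open>m ^ k * max_yield * sum \<Lambda> I = m ^ k\<close>, so none of the inequalities can be strict.\<close>

lemma exact_pieces:
  assumes ex: "exact I \<Lambda> g"
    and D: "\<And>i. i \<in> I \<Longrightarrow> complete (D i)"
    and small: "\<And>i u. i \<in> I \<Longrightarrow> u \<in> D i \<Longrightarrow> \<Lambda> i * weight x u * real m ^ k < m"
    and J: "J \<in> words m k"
  shows "exact {(i, u) \<in> Sigma I D. \<forall>\<omega>\<in>seqs n. stake k (g i (u @- \<omega>)) = J}
     (\<lambda>(i, u). \<Lambda> i * weight x u * real m ^ k) (\<lambda>(i, u) \<omega>. sdrop k (g i (u @- \<omega>)))"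
proof -
  (* the word of length k below which the image of a piece lies; any other base point would do *)
  define lab where "lab = (\<lambda>(i, u). stake k (g i (u @- sconst 0)))"
  define L where "L = (\<lambda>(i, u). \<Lambda> i * weight x u * real m ^ k)"
  define h where "h = (\<lambda>(i, u) \<omega>. sdrop k (g i (u @- \<omega>)))"
  define P where "P J = {p \<in> Sigma I D. lab p = J}" for J
  have I: "finite I" "\<And>i. i \<in> I \<Longrightarrow> 0 < \<Lambda> i" "\<And>i. i \<in> I \<Longrightarrow> wlip (\<Lambda> i) (g i)"
    and total: "max_yield * sum \<Lambda> I = 1"
    and dense: "\<And>k. words m k \<subseteq> stake k ` (\<Union>i\<in>I. g i ` seqs n)"
    using ex by (auto simp: exact_def)
  have Dw: "finite (D i)" "\<And>u. u \<in> D i \<Longrightarrow> set u \<subseteq> {..<n}" "(\<Sum>u\<in>D i. weight x u) = 1"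
    "\<And>\<omega>. \<omega> \<in> seqs n \<Longrightarrow> \<exists>u\<in>D i. \<exists>\<eta>\<in>seqs n. \<omega> = u @- \<eta>" if "i \<in> I" for i
    using D[OF that] by (auto simp: complete_def)
  note z = zeros_in_seqs
  have lab: "stake k (g i (u @- \<omega>)) = lab (i, u)" if "i \<in> I" "u \<in> D i" "\<omega> \<in> seqs n" for i u \<omega>
    unfolding lab_def prod.case
    using wlip_restrict[OF I(3)[OF that(1)] Dw(2)[OF that(1,2)]] small[OF that(1,2)] that(3) z
    by (rule wlip_stake_eq)
  have P_eq: "{(i, u) \<in> Sigma I D. \<forall>\<omega>\<in>seqs n. stake k (g i (u @- \<omega>)) = J} = P J" for J
    using z lab by (fastforce simp: P_def)
  have fin: "finite (Sigma I D)" using I Dw by auto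
  have finP: "finite (P J)" for J using fin by (simp add: P_def)
  have wl: "0 < L p \<and> wlip (L p) (h p)" if "p \<in> P J" for p J
  proof -
    obtain i u where p: "p = (i, u)" by (cases p)
    with that have p: "p = (i, u)" "i \<in> I" "u \<in> D i" by (simp_all add: P_def)
    have u: "set u \<subseteq> {..<n}" using p Dw(2) by blast
    have "0 < real m ^ k" using m2 by simp
    then show ?thesis
      using I(2,3)[OF p(2)] weight_pos[OF u] u by (simp add: p(1) L_def h_def wlip_piece)
  qed
  have lab_words: "lab ` Sigma I D \<subseteq> words m k"
  proof (clarsimp simp: lab_def)
    fix i u assume "i \<in> I" "u \<in> D i"
    then show "stake k (g i (u @- sconst 0)) \<in> words m k"
      using I(3) Dw(2) z by (intro stake_in_words wlip_seqs[of "\<Lambda> i"]) (simp_all add: shift_in_seqs_iff)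
  qed
  have densP: "words m l \<subseteq> stake l ` (\<Union>p\<in>P J. h p ` seqs n)" if J: "J \<in> words m k" for J l
  proof
    fix w assume "w \<in> words m l"
    then have "J @ w \<in> words m (k + l)" using J by (auto simp: words_def)
    then obtain i \<omega> where i: "i \<in> I" "\<omega> \<in> seqs n" "J @ w = stake (k + l) (g i \<omega>)"
      using dense[of "k + l"] by auto
    obtain u \<eta> where u: "u \<in> D i" "\<eta> \<in> seqs n" "\<omega> = u @- \<eta>" using Dw(4)[OF i(1,2)] by blast
    have "J = stake k (g i \<omega>)" "w = stake l (sdrop k (g i \<omega>))"
      using append_eq_append_conv[of J "stake k (g i \<omega>)" w "stake l (sdrop k (g i \<omega>))"]
        i(3) words_length[OF J] by simp_all
    then have "(i, u) \<in> P J" "w = stake l (h (i, u) \<eta>)"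
      using i(1) u lab by (auto simp: P_def h_def)
    then show "w \<in> stake l ` (\<Union>p\<in>P J. h p ` seqs n)" using u(2) by blast
  qed
  have ge: "1 \<le> max_yield * sum L (P J)" if J: "J \<in> words m k" for J
  proof -
    have "(\<Union>p\<in>P J. h p ` seqs n) \<subseteq> seqs m" using wl wlip_image by blast
    then have "nu (\<Union>p\<in>P J. h p ` seqs n) = 1"
      using densP[OF J] by (rule unif.stream_content_eq_1)
    moreover have "nu (\<Union>p\<in>P J. h p ` seqs n) \<le> max_yield * sum L (P J)"
      by (rule nu_family_le) (use finP wl in blast)+
    ultimately show ?thesis by simp
  qed
  have "(\<Sum>J\<in>words m k. max_yield * sum L (P J)) = max_yield * sum L (Sigma I D)"
    using sum.group[OF fin finite_words lab_words, of L]
    by (simp add: P_def flip: sum_distrib_left)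
  also have "sum L (Sigma I D) = (\<Sum>i\<in>I. \<Sum>u\<in>D i. \<Lambda> i * weight x u * real m ^ k)"
    unfolding L_def using I Dw by (subst sum.Sigma) auto
  also have "\<dots> = (\<Sum>i\<in>I. \<Lambda> i * (\<Sum>u\<in>D i. weight x u) * real m ^ k)"
    by (simp add: sum_distrib_left sum_distrib_right)
  also have "\<dots> = sum \<Lambda> I * real m ^ k"
    using Dw by (simp add: sum_distrib_right)
  finally have "(\<Sum>J\<in>words m k. max_yield * sum L (P J) - 1) = 0"
    using total by (simp add: sum_subtractf card_words mult.assoc[symmetric])
  then have eq: "\<forall>J\<in>words m k. max_yield * sum L (P J) - 1 = 0"
    using ge by (subst (asm) sum_nonneg_eq_0_iff) auto
  show ?thesis
    unfolding P_eq L_def[symmetric] h_def[symmetric] exact_def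
    using finP wl eq J densP by auto
qed

text \<open>The bounds that \<open>stop_words\<close> produces. They limit the number of members of an exact family
and make the members equicontinuous, which is what compactness needs.\<close>

definition family_bounds :: "'i set \<Rightarrow> ('i \<Rightarrow> real) \<Rightarrow> ('i \<Rightarrow> nat stream \<Rightarrow> nat stream) \<Rightarrow> bool" where
  "family_bounds I \<Lambda> g \<longleftrightarrow> finite I \<and> (\<forall>i\<in>I. real m * xmin \<le> \<Lambda> i \<and> \<Lambda> i \<le> real m \<and> wlip (\<Lambda> i) (g i))"

lemma lower_pos: "0 < real m * xmin"
  using xmin_pos m2 by simp

lemma family_boundsD:
  assumes "family_bounds I \<Lambda> g" "i \<in> I"
  shows "0 < \<Lambda> i" "real m * xmin \<le> \<Lambda> i" "\<Lambda> i \<le> real m" "wlip (\<Lambda> i) (g i)"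
  using assms lower_pos unfolding family_bounds_def by force+

lemma near_optimal:
  assumes f: "wlip \<Lambda>f f" "0 < \<Lambda>f" "0 < nu (f ` seqs n)" and e: "0 < e"
  shows "0 < max_yield \<and> (\<exists>g \<Lambda>. 0 < \<Lambda> \<and> wlip \<Lambda> g \<and> (1 - e) * max_yield * \<Lambda> < nu (g ` seqs n))"
proof
  have "0 < max_yield * \<Lambda>f" using nu_le_max_yield[OF f(1,2)] f(3) by linarith
  then show M: "0 < max_yield" using f(2) by (simp add: zero_less_mult_iff)
  then have "(1 - e) * max_yield < max_yield" using e by (simp add: algebra_simps)
  then obtain y where "y \<in> {nu (g ` seqs n) / \<Lambda> | g \<Lambda>. 0 < \<Lambda> \<and> wlip \<Lambda> g}" "(1 - e) * max_yield < y"
    using less_cSupD[of "{nu (g ` seqs n) / \<Lambda> | g \<Lambda>. 0 < \<Lambda> \<and> wlip \<Lambda> g}" "(1 - e) * max_yield"] f(1,2)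
    unfolding max_yield_def[symmetric] by blast
  then obtain g \<Lambda> where "0 < \<Lambda>" "wlip \<Lambda> g" "(1 - e) * max_yield < nu (g ` seqs n) / \<Lambda>" by blast
  then show "\<exists>g \<Lambda>. 0 < \<Lambda> \<and> wlip \<Lambda> g \<and> (1 - e) * max_yield * \<Lambda> < nu (g ` seqs n)"
    by (intro exI[of _ g] exI[of _ \<Lambda>]) (simp add: less_divide_eq)
qed

text \<open>Take a nearly optimal map and a level \<open>k\<close> so fine that the cylinders meeting its image
have hardly more content than the image. Cut the domain into pieces of constant about \<open>m\<close> after
magnification by \<open>m ^ k\<close>, and sort the pieces by these cylinders. Averaged over the cylinders,
both \<open>max_yield * sum L\<close> and the content of the pieces are close to 1, so some cylinder is
nearly exact.\<close>

lemma near_exact_family: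
  assumes f: "wlip \<Lambda>f f" "0 < \<Lambda>f" "0 < nu (f ` seqs n)" and eps: "0 < \<epsilon>"
  shows "\<exists>(I :: nat list set) \<Lambda> g. family_bounds I \<Lambda> g \<and> max_yield * sum \<Lambda> I \<le> 1 + \<epsilon> \<and>
     1 - \<epsilon> \<le> nu (\<Union>i\<in>I. g i ` seqs n)"
proof -
  (* e \<le> 1/2 gives 1 / (1 - e) \<le> 1 + 2 * e; with the error e of the level sum the
     total error is 3 * e, which is at most \<epsilon> *)
  define e where "e = min (1/2) (\<epsilon>/4)"
  have e: "0 < e" "e \<le> 1/2" "4 * e \<le> \<epsilon>" using eps by (auto simp: e_def)
  obtain g \<Lambda> where g: "0 < \<Lambda>" "wlip \<Lambda> g" "(1 - e) * max_yield * \<Lambda> < nu (g ` seqs n)"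
    and M: "0 < max_yield"
    using near_optimal[OF f e(1)] by blast
  define A where "A = g ` seqs n"
  have A: "A \<subseteq> seqs m" unfolding A_def using g(2) by (rule wlip_image)
  have "0 < (1 - e) * max_yield * \<Lambda>" using e M g(1) by simp
  then have nuA: "0 < nu A" using g(3) by (simp add: A_def)
  obtain k0 where k0: "m / \<Lambda> < real m ^ k0"
    using real_arch_pow[of "real m" "m / \<Lambda>"] m2 by auto
  have "eventually (\<lambda>k. real m \<le> \<Lambda> * real m ^ k) sequentially"
    using eventually_ge_at_top[of k0]
  proof eventually_elim
    case (elim k)
    then have "real m ^ k0 \<le> real m ^ k" using m2 by (intro power_increasing) auto
    then have "m / \<Lambda> \<le> real m ^ k" using k0 by linarith
    then show ?case using g(1) by (simp add: divide_le_eq mult.commute)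
  qed
  moreover have "eventually (\<lambda>k. level_sum (\<lambda>_. 1 / real m) A k < (1 + e) * nu A) sequentially"
    using nuA e by (intro order_tendstoD(2)[OF unif.level_sum_tendsto[OF A]]) simp
  ultimately have "eventually (\<lambda>k. real m \<le> \<Lambda> * real m ^ k \<and>
      level_sum (\<lambda>_. 1 / real m) A k < (1 + e) * nu A) sequentially"
    by (rule eventually_conj)
  then obtain k where k: "real m \<le> \<Lambda> * real m ^ k" "level_sum (\<lambda>_. 1 / real m) A k < (1 + e) * nu A"
    by (auto simp: eventually_sequentially)
  obtain q where q: "\<Lambda> * real m ^ k * xmax ^ q < real m"
    using ex_xmax_power[of "real m"] m2 by auto
  define \<theta> where "\<theta> = \<Lambda> * real m ^ k"
  have \<theta>: "0 < \<theta>" "real m * xmin \<le> \<theta>" "\<theta> * xmax ^ q < real m"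
  proof -
    have "real m * xmin \<le> real m" using mult_left_mono[OF xmin_le_1, of "real m"] by simp
    then show "real m * xmin \<le> \<theta>" using k(1) unfolding \<theta>_def by linarith
    show "0 < \<theta>" "\<theta> * xmax ^ q < real m" using g(1) m2 q by (simp_all add: \<theta>_def)
  qed
  define D where "D = stop_words q \<theta>"
  have D: "finite D" "\<And>u. u \<in> D \<Longrightarrow> set u \<subseteq> {..<n}" "(\<Sum>u\<in>D. weight x u) = 1"
    "\<And>\<omega>. \<omega> \<in> seqs n \<Longrightarrow> \<exists>u\<in>D. \<exists>\<eta>\<in>seqs n. \<omega> = u @- \<eta>"
    using complete_stop_words[of q \<theta>] by (auto simp: complete_def D_def)
  define L where "L u = \<Lambda> * weight x u * real m ^ k" for u
  define h where "h u \<omega> = sdrop k (g (u @- \<omega>))" for u \<omega>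
  have L: "real m * xmin \<le> L u" "L u < real m" if "u \<in> D" for u
    using stop_words_lower[OF \<theta>(2), of u q] stop_words_upper[OF \<theta>(1,3), of u] that
    by (simp_all add: L_def \<theta>_def D_def mult_ac)
  have wl: "wlip (L u) (h u)" if "u \<in> D" for u
    unfolding L_def h_def using g(2) D(2)[OF that] by (rule wlip_piece)
  note z = zeros_in_seqs
  define lab where "lab u = stake k (g (u @- sconst 0))" for u
  have lab: "stake k (g (u @- \<omega>)) = lab u" if "u \<in> D" "\<omega> \<in> seqs n" for u \<omega>
    unfolding lab_def
    using wlip_restrict[OF g(2) D(2)[OF that(1)]] L(2)[OF that(1), unfolded L_def] that(2) z
    by (rule wlip_stake_eq)
  define S where "S = stake k ` A"
  have finS: "finite S" unfolding S_def by (rule unif.finite_prefixes[OF A])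
  have labS: "lab ` D \<subseteq> S"
  proof
    fix J assume "J \<in> lab ` D"
    then obtain u where "u \<in> D" "J = stake k (g (u @- sconst 0))" by (auto simp: lab_def)
    then show "J \<in> S" unfolding S_def A_def using D(2) z by (auto simp: shift_in_seqs_iff)
  qed
  define P where "P J = {u \<in> D. lab u = J}" for J
  have finP: "finite (P J)" for J using D(1) by (simp add: P_def)
  define B where "B J = (\<Union>u\<in>P J. h u ` seqs n)" for J
  have Bsub: "B J \<subseteq> seqs m" for J
    unfolding B_def using wl wlip_image by (force simp: P_def)
  define N where "N = real (card S)"
  have level: "level_sum (\<lambda>_. 1 / real m) A k = N * (1 / real m) ^ k"
  proof -
    have "level_sum (\<lambda>_. 1 / real m) A k = (\<Sum>w\<in>S. (1 / real m) ^ k)"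
      unfolding level_sum_def S_def by (rule sum.cong) auto
    then show ?thesis by (simp add: N_def)
  qed
  have Acover: "A \<subseteq> (\<Union>J\<in>S. (@-) J ` B J)"
  proof
    fix y assume "y \<in> A"
    then obtain \<omega> where \<omega>: "\<omega> \<in> seqs n" "y = g \<omega>" by (auto simp: A_def)
    obtain u \<eta> where u: "u \<in> D" "\<eta> \<in> seqs n" "\<omega> = u @- \<eta>" using D(4)[OF \<omega>(1)] by blast
    have "stake k y = lab u" using lab[OF u(1,2)] \<omega> u by simp
    moreover have "sdrop k y \<in> B (lab u)"
      unfolding B_def P_def h_def using u \<omega> by auto
    ultimately have "y \<in> (@-) (lab u) ` B (lab u)" by (metis image_eqI stake_sdrop)
    then show "y \<in> (\<Union>J\<in>S. (@-) J ` B J)" using labS u(1) by blast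
  qed
  have Sw: "set J \<subseteq> {..<m} \<and> length J = k" if "J \<in> S" for J
  proof -
    from that obtain y where "y \<in> A" "J = stake k y" by (auto simp: S_def)
    then show ?thesis using set_stake[of y m k] A by auto
  qed
  have JB: "(@-) J ` B J \<subseteq> seqs m" if "J \<in> S" for J
    using Sw[OF that] Bsub[of J] by (force simp: shift_in_seqs_iff)
  have "(\<Union>J\<in>S. (@-) J ` B J) \<subseteq> seqs m" using JB by blast
  with Acover have "nu A \<le> nu (\<Union>J\<in>S. (@-) J ` B J)"
    by (rule unif.stream_content_mono)
  also have "\<dots> \<le> (\<Sum>J\<in>S. nu ((@-) J ` B J))"
    using finS JB by (rule unif.stream_content_UN_le)
  also have "\<dots> = (\<Sum>J\<in>S. (1 / real m) ^ k * nu (B J))"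
    using Sw by (intro sum.cong refl) (simp add: unif.stream_content_shift[OF Bsub])
  also have "\<dots> = (1 / real m) ^ k * (\<Sum>J\<in>S. nu (B J))" by (simp only: sum_distrib_left)
  finally have sumnu: "nu A * real m ^ k \<le> (\<Sum>J\<in>S. nu (B J))"
    using m2 by (simp add: field_simps)
  have "(\<Sum>J\<in>S. sum L (P J)) = sum L D"
    unfolding P_def by (rule sum.group[OF D(1) finS labS])
  also have "\<dots> = \<theta>"
    using D(3) by (simp add: L_def \<theta>_def sum_distrib_left[symmetric] sum_distrib_right[symmetric])
  finally have sumL: "(\<Sum>J\<in>S. max_yield * sum L (P J)) = max_yield * \<theta>"
    by (simp add: sum_distrib_left[symmetric])
  have mk: "0 < real m ^ k" using m2 by simp
  have "N < (1 + e) * (nu A * real m ^ k)"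
    using k(2) mk unfolding level by (simp add: field_simps)
  moreover have "nu A * real m ^ k \<le> N"
    using unif.stream_content_le_level_sum[OF A, of k] mk unfolding level by (simp add: field_simps)
  moreover have "(1 - e) * (max_yield * \<theta>) < nu A * real m ^ k"
    using g(3) mk by (simp add: \<theta>_def A_def mult.assoc[symmetric])
  (* the left-hand side bounds the sum over the N cylinders of the two nonnegative defects
     max_yield * sum L - content and 1 - content *)
  ultimately have key: "max_yield * \<theta> - 2 * (nu A * real m ^ k) + N \<le> \<epsilon> * N"
    and N: "0 < N"
  proof -
    define X where "X = nu A * real m ^ k"
    define Y where "Y = max_yield * \<theta>"
    have h: "N < (1 + e) * X" "X \<le> N" "(1 - e) * Y < X"
      using \<open>N < (1 + e) * (nu A * real m ^ k)\<close> \<open>nu A * real m ^ k \<le> N\<close>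
        \<open>(1 - e) * (max_yield * \<theta>) < nu A * real m ^ k\<close> by (simp_all add: X_def Y_def)
    have X: "0 < X" using nuA mk by (simp add: X_def)
    then show "0 < N" using h by linarith
    have "Y \<le> (1 + 2 * e) * X"
    proof -
      have "Y * 1 \<le> Y * ((1 - e) * (1 + 2 * e))"
        using e M \<theta>(1) by (intro mult_left_mono) (auto simp: Y_def algebra_simps power2_eq_square
            intro: order_trans[OF mult_right_mono[of e "1/2" e]])
      also have "\<dots> = (1 + 2 * e) * ((1 - e) * Y)" by simp
      also have "\<dots> \<le> (1 + 2 * e) * X" using h(3) e by (intro mult_left_mono) auto
      finally show ?thesis by simp
    qed
    then have "Y - 2 * X + N \<le> (3 * e) * X" using h(1) by (simp add: algebra_simps)
    also have "\<dots> \<le> \<epsilon> * N" using e h(2) X by (intro mult_mono) auto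
    finally show "max_yield * \<theta> - 2 * (nu A * real m ^ k) + N \<le> \<epsilon> * N"
      by (simp add: X_def Y_def)
  qed
  have "(\<Sum>J\<in>S. max_yield * sum L (P J) - 2 * nu (B J) + 1) =
      max_yield * \<theta> - 2 * (\<Sum>J\<in>S. nu (B J)) + N"
    unfolding N_def sumL[symmetric] by (simp add: sum.distrib sum_subtractf sum_distrib_left)
  also have "\<dots> \<le> \<epsilon> * N" using key sumnu by linarith
  also have "\<dots> = (\<Sum>J\<in>S. \<epsilon>)" by (simp add: N_def)
  finally have "\<exists>J\<in>S. max_yield * sum L (P J) - 2 * nu (B J) + 1 \<le> \<epsilon>"
  proof (rule contrapos_pp)
    assume "\<not> (\<exists>J\<in>S. max_yield * sum L (P J) - 2 * nu (B J) + 1 \<le> \<epsilon>)"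
    moreover have "S \<noteq> {}" using N by (auto simp: N_def)
    ultimately have "(\<Sum>J\<in>S. \<epsilon>) < (\<Sum>J\<in>S. max_yield * sum L (P J) - 2 * nu (B J) + 1)"
      using finS by (intro sum_strict_mono) (auto simp: not_le)
    then show "\<not> (\<Sum>J\<in>S. max_yield * sum L (P J) - 2 * nu (B J) + 1) \<le> (\<Sum>J\<in>S. \<epsilon>)" by simp
  qed
  then obtain J where J: "J \<in> S" "max_yield * sum L (P J) - 2 * nu (B J) + 1 \<le> \<epsilon>" by blast
  have PD: "P J \<subseteq> D" by (auto simp: P_def)
  have "0 < L u \<and> wlip (L u) (h u)" if "u \<in> P J" for u
    using that PD L(1)[of u] wl[of u] lower_pos by force
  then have le: "nu (B J) \<le> max_yield * sum L (P J)"
    unfolding B_def by (intro nu_family_le finP)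
  have "family_bounds (P J) L h"
    unfolding family_bounds_def using finP
  proof (intro conjI ballI)
    fix u assume "u \<in> P J"
    then have "u \<in> D" using PD by blast
    then show "real m * xmin \<le> L u" "L u \<le> real m" "wlip (L u) (h u)"
      using L[of u] wl by auto
  qed
  moreover have "max_yield * sum L (P J) \<le> 1 + \<epsilon>"
    using J(2) unif.stream_content_le_1[OF Bsub, of J] by linarith
  moreover have "1 - \<epsilon> \<le> nu (\<Union>u\<in>P J. h u ` seqs n)"
    using J(2) le by (simp add: B_def[symmetric])
  ultimately show ?thesis by blast
qed

end

section \<open>Compactness of bounded families\<close>

lemma eventually_const_of_tendsto:
  assumes "(\<lambda>t. real (c t)) \<longlonglongrightarrow> b"
  shows "\<exists>v. eventually (\<lambda>t. c t = v) sequentially"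
proof -
  obtain T where T: "\<And>t. t \<ge> T \<Longrightarrow> \<bar>real (c t) - b\<bar> < 1/2"
    using LIMSEQ_D[OF assms, of "1/2"] by auto
  have "c t = c T" if "t \<ge> T" for t
    using T[OF that] T[OF order_refl] by linarith
  then show ?thesis unfolding eventually_sequentially by blast
qed

lemma compact_box: "compact (PiE UNIV (\<lambda>_. {0..b}) :: ('c \<Rightarrow> real) set)"
proof -
  have "compactin (product_topology (\<lambda>_. euclidean) UNIV) (PiE UNIV (\<lambda>_. {0..b}) :: ('c \<Rightarrow> real) set)"
    by (subst compactin_PiE) simp
  then show ?thesis by (simp add: euclidean_product_topology)
qed

text \<open>Tychonoff's theorem; a countable product of intervals is metrizable, hence sequentially compact.\<close>

lemma bounded_functions_subsequence:
  fixes a :: "nat \<Rightarrow> 'c::countable \<Rightarrow> real"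
  assumes "\<And>t c. 0 \<le> a t c \<and> a t c \<le> b"
  shows "\<exists>h l. strict_mono (h :: nat \<Rightarrow> nat) \<and> (\<forall>c. (\<lambda>t. a (h t) c) \<longlonglongrightarrow> l c)"
proof -
  have "seq_compact (PiE UNIV (\<lambda>_. {0..b}) :: ('c \<Rightarrow> real) set)"
    using compact_box by (rule compact_imp_seq_compact)
  moreover have "\<forall>t. a t \<in> PiE UNIV (\<lambda>_. {0..b})" using assms by auto
  ultimately obtain l h where h: "strict_mono (h :: nat \<Rightarrow> nat)" "(a \<circ> h) \<longlonglongrightarrow> l"
    unfolding seq_compact_def by blast
  have "(\<lambda>t. a (h t) c) \<longlonglongrightarrow> l c" for c
  proof -
    have "isCont (\<lambda>f :: 'c \<Rightarrow> real. f c) l"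
      using continuous_on_eq_continuous_at[OF open_UNIV, THEN iffD1, OF continuous_on_product_coordinates]
      by blast
    from isCont_tendsto_compose[OF this h(2)] show ?thesis by (simp add: o_def)
  qed
  then show ?thesis using h(1) by blast
qed

lemma snth_siterate_Suc: "siterate Suc 0 !! j = j"
proof -
  have "(Suc ^^ j) 0 = j" by (induction j) auto
  then show ?thesis by simp
qed

lemma stake_eqI: "(\<And>j. j < k \<Longrightarrow> \<omega> !! j = \<omega>' !! j) \<Longrightarrow> stake k \<omega> = stake k \<omega>'"
  by (rule nth_equalityI) simp_all

lemma stake_eqD: "stake k \<omega> = stake k \<omega>' \<Longrightarrow> j < k \<Longrightarrow> \<omega> !! j = \<omega>' !! j"
  by (metis stake_nth)

context tree_maps begin

text \<open>The constants and the letters of the values at the eventually zero streams are countably many bounded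
numbers, so they converge along a subsequence, and the letters become constant. By equicontinuity the first
\<open>k\<close> letters of a value depend only on a prefix of bounded length of the argument, so on every
level the maps themselves are eventually constant, uniformly in the argument.\<close>

lemma family_compactness:
  assumes fam: "\<And>t. family_bounds {..<N :: nat} (\<Lambda>s t) (gs t)"
  shows "\<exists>h \<Lambda> g. strict_mono (h :: nat \<Rightarrow> nat) \<and> family_bounds {..<N} \<Lambda> g \<and>
    (\<forall>i<N. (\<lambda>t. \<Lambda>s (h t) i) \<longlonglongrightarrow> \<Lambda> i) \<and>
    (\<forall>k. eventually (\<lambda>t. \<forall>i<N. \<forall>\<omega>\<in>seqs n. stake k (gs (h t) i \<omega>) = stake k (g i \<omega>)) sequentially)"
proof -
  note fb = family_boundsD[OF fam, simplified]
  (* all data in one countably indexed family: Inl i is a constant, Inr (i, u, j) a letter of a value *)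
  define a :: "nat \<Rightarrow> (nat + nat \<times> nat list \<times> nat) \<Rightarrow> real" where
    "a t c = (case c of Inl i \<Rightarrow> if i < N then \<Lambda>s t i else 0
      | Inr (i, u, j) \<Rightarrow> if i < N \<and> set u \<subseteq> {..<n} then real (gs t i (u @- sconst 0) !! j) else 0)" for t c
  have "0 \<le> a t c \<and> a t c \<le> real m" for t c
  proof (cases c)
    case (Inl i)
    then show ?thesis using fb(1,3)[of i t] by (auto simp: a_def)
  next
    case (Inr b)
    obtain i u j where b: "b = (i, u, j)" by (cases b)
    have "gs t i (u @- sconst 0) !! j < m" if "i < N" "set u \<subseteq> {..<n}"
    proof -
      have "gs t i (u @- sconst 0) \<in> seqs m"
        using fb(4)[OF that(1)] that(2) zeros_in_seqs by (intro wlip_seqs) (auto simp: shift_in_seqs_iff)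
      then show ?thesis by (auto simp: streams_iff_snth)
    qed
    then show ?thesis by (simp add: Inr b a_def less_imp_le)
  qed
  then obtain h l where h: "strict_mono (h :: nat \<Rightarrow> nat)" "\<And>c. (\<lambda>t. a (h t) c) \<longlonglongrightarrow> l c"
    using bounded_functions_subsequence[of a "real m"] by blast
  define \<Lambda> where "\<Lambda> i = l (Inl i)" for i
  have lim: "(\<lambda>t. \<Lambda>s (h t) i) \<longlonglongrightarrow> \<Lambda> i" if "i < N" for i
    using h(2)[of "Inl i"] that by (simp add: a_def \<Lambda>_def)
  have "\<exists>v. eventually (\<lambda>t. gs (h t) i (u @- sconst 0) !! j = v) sequentially"
    if "i < N" "set u \<subseteq> {..<n}" for i u j
    using h(2)[of "Inr (i, u, j)"] that by (intro eventually_const_of_tendsto) (simp add: a_def)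
  then obtain V where V: "\<And>i u j. i < N \<Longrightarrow> set u \<subseteq> {..<n} \<Longrightarrow>
      eventually (\<lambda>t. gs (h t) i (u @- sconst 0) !! j = V i u j) sequentially"
    by metis
  have "\<exists>T. \<forall>t\<ge>T. \<forall>i<N. \<forall>\<omega>\<in>seqs n. stake k (gs (h t) i \<omega>) = stake k (gs (h T) i \<omega>)" for k
  proof -
    obtain q where q: "real m ^ Suc k * xmax ^ q < 1"
      using ex_xmax_power[of 1 "real m ^ Suc k"] by auto
    have agree: "stake k (gs t i \<omega>) = stake k (gs t i (stake q \<omega> @- sconst 0))"
      if "i < N" "\<omega> \<in> seqs n" for t i \<omega>
    proof -
      have "\<Lambda>s t i * weight x (stake q \<omega>) * real m ^ k \<le> real m * xmax ^ q * real m ^ k"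
        using fb(3)[OF that(1), of t] weight_le_xmax[OF set_stake[OF that(2)], of q]
          less_imp_le[OF weight_pos[OF set_stake[OF that(2)]], of q]
        by (intro mult_mono) auto
      also have "\<dots> < 1" using q by (simp add: mult_ac)
      finally have less: "\<Lambda>s t i * weight x (stake q \<omega>) * real m ^ k < 1" .
      have "stake q \<omega> @- sconst 0 \<in> seqs n"
        using set_stake[OF that(2)] zeros_in_seqs by (simp add: shift_in_seqs_iff)
      from wlipD[OF fb(4)[OF that(1)] that(2) this _ less]
      have "stake (Suc k) (gs t i \<omega>) = stake (Suc k) (gs t i (stake q \<omega> @- sconst 0))"
        by (simp add: stake_shift)
      then show ?thesis by (rule stake_eq_mono) simp
    qed
    have "eventually (\<lambda>t. \<forall>i\<in>{..<N}. \<forall>u\<in>words n q. \<forall>j\<in>{..<k}.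
        gs (h t) i (u @- sconst 0) !! j = V i u j) sequentially"
      using V by (intro eventually_ball_finite ballI) (auto dest: words_set)
    then obtain T where T': "\<forall>t\<ge>T. \<forall>i\<in>{..<N}. \<forall>u\<in>words n q. \<forall>j\<in>{..<k}.
        gs (h t) i (u @- sconst 0) !! j = V i u j"
      unfolding eventually_sequentially ..
    have T: "gs (h t) i (u @- sconst 0) !! j = V i u j"
      if "t \<ge> T" "i < N" "u \<in> words n q" "j < k" for t i u j
      using T' that by simp
    have "stake k (gs (h t) i \<omega>) = stake k (gs (h T) i \<omega>)"
      if "t \<ge> T" "i < N" "\<omega> \<in> seqs n" for t i \<omega>
    proof -
      have "stake k (gs (h t) i (stake q \<omega> @- sconst 0)) = stake k (gs (h T) i (stake q \<omega> @- sconst 0))"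
        using T[OF that(1,2) stake_in_words[OF that(3)]] T[OF order_refl that(2) stake_in_words[OF that(3)]]
        by (intro stake_eqI) simp
      then show ?thesis using agree[OF that(2,3)] by simp
    qed
    then show ?thesis by blast
  qed
  then obtain T where T: "\<And>k t i \<omega>. t \<ge> T k \<Longrightarrow> i < N \<Longrightarrow> \<omega> \<in> seqs n \<Longrightarrow>
      stake k (gs (h t) i \<omega>) = stake k (gs (h (T k)) i \<omega>)"
    by metis
  define g where "g i \<omega> = smap (\<lambda>j. gs (h (T (Suc j))) i \<omega> !! j) (siterate Suc 0)" for i \<omega>
  have g_nth: "g i \<omega> !! j = gs (h (T (Suc j))) i \<omega> !! j" for i \<omega> j
    by (simp add: g_def snth_siterate_Suc del: snth_siterate)
  have ev: "eventually (\<lambda>t. \<forall>i<N. \<forall>\<omega>\<in>seqs n. stake k (gs (h t) i \<omega>) = stake k (g i \<omega>)) sequentially" for k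
  proof -
    have "eventually (\<lambda>t. \<forall>j\<in>{..<k}. T (Suc j) \<le> t) sequentially"
      by (intro eventually_ball_finite ballI eventually_ge_at_top) simp
    then show ?thesis
    proof eventually_elim
      case (elim t)
      show ?case
      proof (intro allI impI ballI stake_eqI)
        fix i \<omega> j assume "i < N" "\<omega> \<in> seqs n" "j < k"
        then have "stake (Suc j) (gs (h t) i \<omega>) = stake (Suc j) (gs (h (T (Suc j))) i \<omega>)"
          using elim by (intro T) auto
        then show "gs (h t) i \<omega> !! j = g i \<omega> !! j"
          unfolding g_nth by (rule stake_eqD) simp
      qed
    qed
  qed
  have "wlip (\<Lambda> i) (g i)" if i: "i < N" for i
    unfolding wlip_def
  proof (intro conjI ballI allI impI)
    show "g i \<in> seqs n \<rightarrow> seqs m"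
      using wlip_seqs[OF fb(4)[OF i]] by (auto simp: streams_iff_snth g_nth)
    fix \<omega> \<omega>' k l
    assume \<omega>: "\<omega> \<in> seqs n" "\<omega>' \<in> seqs n" "stake k \<omega> = stake k \<omega>'"
      and less: "\<Lambda> i * weight x (stake k \<omega>) * real m ^ l < 1"
    have "(\<lambda>t. \<Lambda>s (h t) i * weight x (stake k \<omega>) * real m ^ l) \<longlonglongrightarrow> \<Lambda> i * weight x (stake k \<omega>) * real m ^ l"
      by (intro tendsto_mult_right lim i)
    then have "eventually (\<lambda>t. \<Lambda>s (h t) i * weight x (stake k \<omega>) * real m ^ l < 1) sequentially"
      using less by (rule order_tendstoD(2))
    then have "eventually (\<lambda>t. stake (Suc l) (g i \<omega>) = stake (Suc l) (g i \<omega>')) sequentially"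
      using ev[of "Suc l"]
    proof eventually_elim
      case (elim t)
      then show ?case using wlipD[OF fb(4)[OF i] \<omega> elim(1)] i \<omega>(1,2) by metis
    qed
    then show "stake (Suc l) (g i \<omega>) = stake (Suc l) (g i \<omega>')" by simp
  qed
  moreover have "real m * xmin \<le> \<Lambda> i \<and> \<Lambda> i \<le> real m" if "i < N" for i
    using LIMSEQ_le_const[OF lim[OF that]] LIMSEQ_le_const2[OF lim[OF that]] fb(2,3)[OF that] by blast
  ultimately have "family_bounds {..<N} \<Lambda> g" by (simp add: family_bounds_def)
  then show ?thesis using h(1) lim ev by blast
qed

text \<open>At a fixed level the limit meets the same words as the families of high index. Those have content close
to 1, so eventually they meet all words, and the images of the limit are dense. The constants pass to the
limit.\<close>

lemma exact_limit:
  assumes fb: "family_bounds {..<N :: nat} \<Lambda> g" and fam: "\<And>t. family_bounds {..<N} (\<Lambda>s t) (gs t)"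
    and lim: "\<And>i. i < N \<Longrightarrow> (\<lambda>t. \<Lambda>s t i) \<longlonglongrightarrow> \<Lambda> i"
    and ev: "\<And>k. eventually (\<lambda>t. \<forall>i<N. \<forall>\<omega>\<in>seqs n. stake k (gs t i \<omega>) = stake k (g i \<omega>)) sequentially"
    and e: "e \<longlonglongrightarrow> 0" "\<And>t. max_yield * sum (\<Lambda>s t) {..<N} \<le> 1 + e t"
      "\<And>t. 1 - e t \<le> nu (\<Union>i<N. gs t i ` seqs n)"
  shows "exact {..<N} \<Lambda> g"
proof -
  have sub: "(\<Union>i<N. g i ` seqs n) \<subseteq> seqs m" "(\<Union>i<N. gs t i ` seqs n) \<subseteq> seqs m" for t
    using wlip_image[OF family_boundsD(4)[OF fb]] wlip_image[OF family_boundsD(4)[OF fam]] by blast+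
  have dense: "words m k \<subseteq> stake k ` (\<Union>i<N. g i ` seqs n)" for k
  proof -
    let ?S = "stake k ` (\<Union>i<N. g i ` seqs n)"
    have "eventually (\<lambda>t. 1 - e t \<le> level_sum (\<lambda>_. 1 / real m) (\<Union>i<N. g i ` seqs n) k) sequentially"
      using ev[of k]
    proof eventually_elim
      case (elim t)
      then have "stake k ` (\<Union>i<N. gs t i ` seqs n) = ?S"
        by (simp add: image_UN image_image)
      then have "level_sum (\<lambda>_. 1 / real m) (\<Union>i<N. gs t i ` seqs n) k =
          level_sum (\<lambda>_. 1 / real m) (\<Union>i<N. g i ` seqs n) k"
        by (simp add: level_sum_def)
      then show ?case
        using e(3)[of t] unif.stream_content_le_level_sum[OF sub(2), of t k] by linarith
    qed
    moreover have "(\<lambda>t. 1 - e t) \<longlonglongrightarrow> 1" using tendsto_diff[OF tendsto_const e(1), of 1] by simp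
    ultimately have "1 \<le> level_sum (\<lambda>_. 1 / real m) (\<Union>i<N. g i ` seqs n) k"
      by (intro tendsto_upperbound[where F = sequentially]) auto
    also have "\<dots> = (\<Sum>w\<in>?S. (1 / real m) ^ k)"
      unfolding level_sum_def by (rule sum.cong) auto
    finally have "real m ^ k \<le> real (card ?S)" using m2 by (simp add: field_simps)
    then have le: "card (words m k) \<le> card ?S" unfolding card_words by (simp flip: of_nat_le_iff)
    have "?S \<subseteq> words m k" using sub(1) by (auto intro!: stake_in_words)
    from card_seteq[OF finite_words this le] show ?thesis by simp
  qed
  have "nu (\<Union>i<N. g i ` seqs n) = 1" using sub(1) dense by (rule unif.stream_content_eq_1)
  then have "1 \<le> max_yield * sum \<Lambda> {..<N}"
    using nu_family_le[of "{..<N}" \<Lambda> g] family_boundsD(1,4)[OF fb] by simp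
  moreover have "max_yield * sum \<Lambda> {..<N} \<le> 1"
  proof -
    have "(\<lambda>t. 1 + e t) \<longlonglongrightarrow> 1" using tendsto_add[OF tendsto_const e(1), of 1] by simp
    moreover have "(\<lambda>t. max_yield * sum (\<Lambda>s t) {..<N}) \<longlonglongrightarrow> max_yield * sum \<Lambda> {..<N}"
      using lim by (intro tendsto_mult_left tendsto_sum) auto
    ultimately show ?thesis using e(2) by (intro LIMSEQ_le) auto
  qed
  ultimately show ?thesis
    unfolding exact_def using dense family_boundsD(1,4)[OF fb] by auto
qed

lemma family_card_le:
  assumes "family_bounds I \<Lambda> g" "0 < max_yield" "max_yield * sum \<Lambda> I \<le> 2"
  shows "card I \<le> nat \<lceil>2 / (max_yield * (real m * xmin))\<rceil>"
proof -
  have "real (card I) * (real m * xmin) \<le> sum \<Lambda> I"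
    using sum_bounded_below[of I "real m * xmin" \<Lambda>] family_boundsD(2)[OF assms(1)] by simp
  then have "max_yield * (real (card I) * (real m * xmin)) \<le> max_yield * sum \<Lambda> I"
    using assms(2) by (intro mult_left_mono) auto
  then have "real (card I) * (max_yield * (real m * xmin)) \<le> 2"
    using assms(3) by (simp add: mult.left_commute)
  then have "real (card I) \<le> 2 / (max_yield * (real m * xmin))"
    using assms(2) lower_pos by (subst pos_le_divide_eq) auto
  then show ?thesis by linarith
qed

lemma family_reindex:
  assumes b: "bij_betw b J I"
  shows "family_bounds I \<Lambda> g \<longleftrightarrow> family_bounds J (\<Lambda> \<circ> b) (g \<circ> b)"
    and "sum (\<Lambda> \<circ> b) J = sum \<Lambda> I"
    and "(\<Union>j\<in>J. (g \<circ> b) j ` A) = (\<Union>i\<in>I. g i ` A)"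
    and "exact I \<Lambda> g \<longleftrightarrow> exact J (\<Lambda> \<circ> b) (g \<circ> b)"
proof -
  have I: "I = b ` J" using b by (simp add: bij_betw_def)
  have fin: "finite I \<longleftrightarrow> finite J" using b by (rule bij_betw_finite[symmetric])
  show s: "sum (\<Lambda> \<circ> b) J = sum \<Lambda> I" using sum.reindex_bij_betw[OF b, of \<Lambda>] by simp
  show u: "(\<Union>j\<in>J. (g \<circ> b) j ` A) = (\<Union>i\<in>I. g i ` A)" for A by (simp add: I)
  show "family_bounds I \<Lambda> g \<longleftrightarrow> family_bounds J (\<Lambda> \<circ> b) (g \<circ> b)"
    unfolding family_bounds_def fin by (simp add: I)
  show "exact I \<Lambda> g \<longleftrightarrow> exact J (\<Lambda> \<circ> b) (g \<circ> b)"
    unfolding exact_def fin s u by (simp add: I)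
qed

lemma constant_on_subsequence:
  assumes "finite S" "\<And>t :: nat. c t \<in> S"
  shows "\<exists>v r. strict_mono (r :: nat \<Rightarrow> nat) \<and> (\<forall>t. c (r t) = v)"
proof -
  have "finite (range c)" using assms by (auto intro: finite_subset)
  then obtain t0 where inf: "infinite {t \<in> UNIV. c t = c t0}"
    using pigeonhole_infinite[of UNIV c] by auto
  then obtain r where "strict_mono (r :: nat \<Rightarrow> nat)" "\<And>t. r t \<in> {t \<in> UNIV. c t = c t0}"
    using infinite_enumerate[OF inf] by blast
  then show ?thesis by blast
qed

text \<open>Families that are exact up to \<open>1 / (t + 1)\<close> have boundedly many members, so infinitely
many of them have the same number of members, and a subsequence of these converges.\<close>

lemma exact_family_exists:
  assumes f: "wlip \<Lambda>f f" "0 < \<Lambda>f" "0 < nu (f ` seqs n)"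
  shows "\<exists>N \<Lambda> g. family_bounds {..<N::nat} \<Lambda> g \<and> exact {..<N} \<Lambda> g"
proof -
  have M: "0 < max_yield" using near_optimal[OF f, of 1] by simp
  have "\<exists>N \<Lambda> g. family_bounds {..<N::nat} \<Lambda> g \<and> max_yield * sum \<Lambda> {..<N} \<le> 1 + 1 / real (Suc t) \<and>
     1 - 1 / real (Suc t) \<le> nu (\<Union>i<N. g i ` seqs n)" for t
  proof -
    obtain I :: "nat list set" and \<Lambda> g where *: "family_bounds I \<Lambda> g"
      "max_yield * sum \<Lambda> I \<le> 1 + 1 / real (Suc t)" "1 - 1 / real (Suc t) \<le> nu (\<Union>i\<in>I. g i ` seqs n)"
      using near_exact_family[OF f, of "1 / real (Suc t)"] by auto
    have "finite I" using * by (simp add: family_bounds_def)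
    then obtain b where b: "bij_betw b {..<card I} I"
      using ex_bij_betw_nat_finite atLeast0LessThan by metis
    have "family_bounds {..<card I} (\<Lambda> \<circ> b) (g \<circ> b)" using *(1) family_reindex(1)[OF b, of \<Lambda> g] by blast
    moreover have "max_yield * sum (\<Lambda> \<circ> b) {..<card I} \<le> 1 + 1 / real (Suc t)"
      using *(2) unfolding family_reindex(2)[OF b] .
    moreover have "1 - 1 / real (Suc t) \<le> nu (\<Union>i<card I. (g \<circ> b) i ` seqs n)"
      using *(3) unfolding family_reindex(3)[OF b] .
    ultimately show ?thesis by blast
  qed
  then obtain N \<Lambda>s gs where s: "\<And>t. family_bounds {..<N t :: nat} (\<Lambda>s t) (gs t)"
    "\<And>t. max_yield * sum (\<Lambda>s t) {..<N t} \<le> 1 + 1 / real (Suc t)"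
    "\<And>t. 1 - 1 / real (Suc t) \<le> nu (\<Union>i<N t. gs t i ` seqs n)"
    by metis
  have "N t \<le> nat \<lceil>2 / (max_yield * (real m * xmin))\<rceil>" for t
  proof -
    have "1 / real (Suc t) \<le> 1" by simp
    then have "max_yield * sum (\<Lambda>s t) {..<N t} \<le> 2" using s(2)[of t] by linarith
    from family_card_le[OF s(1) M this] show ?thesis by simp
  qed
  then obtain N0 r where r: "strict_mono (r :: nat \<Rightarrow> nat)" "\<And>t. N (r t) = N0"
    using constant_on_subsequence[of "{..nat \<lceil>2 / (max_yield * (real m * xmin))\<rceil>}" N] by auto
  have fam: "family_bounds {..<N0} (\<Lambda>s (r t)) (gs (r t))" for t
    using s(1)[of "r t"] r(2) by simp
  from family_compactness[of N0 "\<lambda>t. \<Lambda>s (r t)" "\<lambda>t. gs (r t)", OF fam]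
  obtain h \<Lambda> g where h: "strict_mono (h :: nat \<Rightarrow> nat)" "family_bounds {..<N0} \<Lambda> g"
    "\<forall>i<N0. (\<lambda>t. \<Lambda>s (r (h t)) i) \<longlonglongrightarrow> \<Lambda> i"
    "\<forall>k. eventually (\<lambda>t. \<forall>i<N0. \<forall>\<omega>\<in>seqs n. stake k (gs (r (h t)) i \<omega>) = stake k (g i \<omega>)) sequentially"
    by blast
  have "(\<lambda>t. 1 / real (Suc ((r \<circ> h) t))) \<longlonglongrightarrow> 0"
    using LIMSEQ_subseq_LIMSEQ[OF LIMSEQ_inverse_real_of_nat strict_mono_o[OF r(1) h(1)]]
    by (simp add: o_def inverse_eq_divide)
  then have "exact {..<N0} \<Lambda> g"
    using exact_limit[OF h(2) fam h(3)[rule_format] h(4)[rule_format], of "\<lambda>t. 1 / real (Suc ((r \<circ> h) t))"]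
      s(2,3)[of "r (h _)"] r(2) by simp
  then show ?thesis using h(2) by blast
qed

section \<open>Commensurability of the letter weights\<close>

text \<open>A word that only one member of an exact family meets isolates this member: over the cylinder of the
word the family reduces to pieces of it. The length is required to work for all exact families at once.\<close>

definition isolating_length :: "nat \<Rightarrow> bool" where
  "isolating_length L \<longleftrightarrow> (\<forall>N \<Lambda> g i. family_bounds {..<N :: nat} \<Lambda> g \<longrightarrow> exact {..<N} \<Lambda> g \<longrightarrow> i < N \<longrightarrow>
    (\<exists>J\<in>words m L. J \<notin> stake L ` (\<Union>j\<in>{..<N} - {i}. g j ` seqs n)))"

text \<open>Without the member \<open>i\<close> the family has total constant less than
\<open>1 / max_yield\<close>, so its image cannot be dense.\<close>

lemma exact_word_avoiding_others:
  assumes fb: "family_bounds {..<N :: nat} \<Lambda> g" and ex: "exact {..<N} \<Lambda> g" and i: "i < N" and M: "0 < max_yield"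
  shows "\<exists>k. \<exists>J\<in>words m k. J \<notin> stake k ` (\<Union>j\<in>{..<N} - {i}. g j ` seqs n)"
proof (rule ccontr)
  assume *: "\<not> (\<exists>k. \<exists>J\<in>words m k. J \<notin> stake k ` (\<Union>j\<in>{..<N} - {i}. g j ` seqs n))"
  have "words m k \<subseteq> stake k ` (\<Union>j\<in>{..<N} - {i}. g j ` seqs n)" for k
  proof (rule subsetI, rule ccontr)
    fix J assume "J \<in> words m k" "J \<notin> stake k ` (\<Union>j\<in>{..<N} - {i}. g j ` seqs n)"
    then have "\<exists>k. \<exists>J\<in>words m k. J \<notin> stake k ` (\<Union>j\<in>{..<N} - {i}. g j ` seqs n)"
      by (intro exI[of _ k] bexI[of _ J])
    with * show False by (rule notE)
  qed
  moreover have "(\<Union>j\<in>{..<N} - {i}. g j ` seqs n) \<subseteq> seqs m"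
    using wlip_image[OF family_boundsD(4)[OF fb]] by blast
  ultimately have "nu (\<Union>j\<in>{..<N} - {i}. g j ` seqs n) = 1" by (intro unif.stream_content_eq_1)
  then have "1 \<le> max_yield * sum \<Lambda> ({..<N} - {i})"
    using nu_family_le[of "{..<N} - {i}" \<Lambda> g] family_boundsD(1,4)[OF fb] by simp
  also have "sum \<Lambda> ({..<N} - {i}) = sum \<Lambda> {..<N} - \<Lambda> i" using i by (simp add: sum_diff1)
  also have "max_yield * (sum \<Lambda> {..<N} - \<Lambda> i) < 1"
    using ex family_boundsD(1)[OF fb] i M by (simp add: exact_def right_diff_distrib)
  finally show False by simp
qed

text \<open>If no length works, choose a bad exact family for each length and pass to a limit. The limit is exact,
so some word is met by no member other than \<open>i\<close>. The words are stable in the limit, so late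
families of the sequence avoid it too, together with all its extensions, and one of these has the supposedly
bad length.\<close>

lemma uniform_avoiding_length:
  assumes M: "0 < max_yield"
  shows "\<exists>L. isolating_length L"
proof (rule ccontr)
  assume *: "\<not> ?thesis"
  have "\<exists>N \<Lambda> g i. family_bounds {..<N :: nat} \<Lambda> g \<and> exact {..<N} \<Lambda> g \<and> i < N \<and>
    words m L \<subseteq> stake L ` (\<Union>j\<in>{..<N} - {i}. g j ` seqs n)" for L
  proof -
    from * obtain N \<Lambda> g i where "family_bounds {..<N :: nat} \<Lambda> g" "exact {..<N} \<Lambda> g" "i < N"
      and no: "\<not> (\<exists>J\<in>words m L. J \<notin> stake L ` (\<Union>j\<in>{..<N} - {i}. g j ` seqs n))"
      unfolding isolating_length_def not_ex not_all not_imp by (elim allE[of _ L] exE conjE)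
    moreover have "words m L \<subseteq> stake L ` (\<Union>j\<in>{..<N} - {i}. g j ` seqs n)"
    proof (rule subsetI, rule ccontr)
      fix J assume "J \<in> words m L" "J \<notin> stake L ` (\<Union>j\<in>{..<N} - {i}. g j ` seqs n)"
      then have "\<exists>J\<in>words m L. J \<notin> stake L ` (\<Union>j\<in>{..<N} - {i}. g j ` seqs n)"
        by (intro bexI[of _ J])
      with no show False by (rule notE)
    qed
    ultimately show ?thesis by blast
  qed
  then obtain N \<Lambda>s gs i where s: "\<And>L. family_bounds {..<N L :: nat} (\<Lambda>s L) (gs L)"
    "\<And>L. exact {..<N L} (\<Lambda>s L) (gs L)" "\<And>L. i L < N L"
    "\<And>L. words m L \<subseteq> stake L ` (\<Union>j\<in>{..<N L} - {i L}. gs L j ` seqs n)"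
    by metis
  have "N t \<le> nat \<lceil>2 / (max_yield * (real m * xmin))\<rceil>" for t
    using family_card_le[OF s(1) M, of t] s(2)[of t] by (simp add: exact_def)
  then have "(N t, i t) \<in> {..nat \<lceil>2 / (max_yield * (real m * xmin))\<rceil>} \<times> {..nat \<lceil>2 / (max_yield * (real m * xmin))\<rceil>}" for t
    using s(3)[of t] by (auto intro: less_imp_le less_le_trans)
  then obtain v r where r: "strict_mono (r :: nat \<Rightarrow> nat)" "\<And>t. (N (r t), i (r t)) = v"
    using constant_on_subsequence[of "{..nat \<lceil>2 / (max_yield * (real m * xmin))\<rceil>} \<times> {..nat \<lceil>2 / (max_yield * (real m * xmin))\<rceil>}"
        "\<lambda>t. (N t, i t)"] by blast
  define N0 i0 where "N0 = fst v" and "i0 = snd v"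
  have r2: "N (r t) = N0" "i (r t) = i0" for t using r(2)[of t] by (auto simp: N0_def i0_def)
  have fam: "family_bounds {..<N0} (\<Lambda>s (r t)) (gs (r t))" and ext: "exact {..<N0} (\<Lambda>s (r t)) (gs (r t))" for t
    using s(1,2)[of "r t"] r2 by simp_all
  from family_compactness[of N0 "\<lambda>t. \<Lambda>s (r t)" "\<lambda>t. gs (r t)", OF fam]
  obtain h \<Lambda> g where h: "strict_mono (h :: nat \<Rightarrow> nat)" "family_bounds {..<N0} \<Lambda> g"
    "\<forall>i<N0. (\<lambda>t. \<Lambda>s (r (h t)) i) \<longlonglongrightarrow> \<Lambda> i"
    "\<forall>k. eventually (\<lambda>t. \<forall>i<N0. \<forall>\<omega>\<in>seqs n. stake k (gs (r (h t)) i \<omega>) = stake k (g i \<omega>)) sequentially"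
    by blast
  have "nu (\<Union>i<N0. gs (r t) i ` seqs n) = 1" for t
    using ext[of t] wlip_image[OF family_boundsD(4)[OF fam]]
    by (intro unif.stream_content_eq_1) (auto simp: exact_def)
  then have "exact {..<N0} \<Lambda> g"
    using exact_limit[OF h(2) fam h(3)[rule_format] h(4)[rule_format], of "\<lambda>_. 0"] ext by (simp add: exact_def)
  moreover have i0: "i0 < N0" using s(3)[of "r 0"] r2 by simp
  ultimately obtain k J where J: "J \<in> words m k" "J \<notin> stake k ` (\<Union>j\<in>{..<N0} - {i0}. g j ` seqs n)"
    using exact_word_avoiding_others[OF h(2) _ _ M] by blast
  have "eventually (\<lambda>t. k \<le> r (h t)) sequentially"
    using filterlim_subseq[OF strict_mono_o[OF r(1) h(1)]] by (simp add: filterlim_at_top o_def)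
  then have "eventually (\<lambda>t. False) sequentially"
    using h(4)[rule_format, of k]
  proof eventually_elim
    case (elim t)
    define L where "L = r (h t)"
    (* padding J to length L; the letter 0 is arbitrary *)
    have "J @ replicate (L - k) 0 \<in> words m L"
      using J(1) elim(1) m2 by (auto simp: words_def L_def)
    then have "J @ replicate (L - k) 0 \<in> stake L ` (\<Union>j\<in>{..<N0} - {i0}. gs L j ` seqs n)"
      using s(4)[of L] r2 by (auto simp: L_def)
    then obtain j \<omega> where j: "j < N0" "j \<noteq> i0" "\<omega> \<in> seqs n"
      "J @ replicate (L - k) 0 = stake L (gs L j \<omega>)" by auto
    have "take k (J @ replicate (L - k) 0) = J" using words_length[OF J(1)] by simp
    then have "J = stake k (gs L j \<omega>)"
      using arg_cong[OF j(4), of "take k"] elim(1) by (simp only: take_stake L_def min.absorb1)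
    also have "\<dots> = stake k (g j \<omega>)" using elim(2) j by (simp add: L_def)
    finally show False using J(2) j by blast
  qed
  then show False by simp
qed

lemma avoiding_word_reindex:
  assumes L: "isolating_length L"
    and fb: "family_bounds I \<Lambda> g" "exact I \<Lambda> g" "i \<in> I"
  shows "\<exists>J\<in>words m L. J \<notin> stake L ` (\<Union>j\<in>I - {i}. g j ` seqs n)"
proof -
  have "finite I" using fb by (simp add: family_bounds_def)
  then obtain b where b: "bij_betw b {..<card I} I"
    using ex_bij_betw_nat_finite atLeast0LessThan by metis
  then obtain i' where i': "i' < card I" "i = b i'" using fb(3) by (auto simp: bij_betw_def)
  have "b ` ({..<card I} - {i'}) = I - {i}"
    using b i' by (auto simp: bij_betw_def inj_on_def)
  moreover have "(\<Union>j\<in>{..<card I} - {i'}. (g \<circ> b) j ` seqs n) =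
      (\<Union>j\<in>b ` ({..<card I} - {i'}). g j ` seqs n)" by simp
  ultimately have "(\<Union>j\<in>{..<card I} - {i'}. (g \<circ> b) j ` seqs n) = (\<Union>j\<in>I - {i}. g j ` seqs n)"
    by simp
  moreover have "family_bounds {..<card I} (\<Lambda> \<circ> b) (g \<circ> b)" "exact {..<card I} (\<Lambda> \<circ> b) (g \<circ> b)"
    using fb(1,2) family_reindex(1,4)[OF b, of \<Lambda> g] by blast+
  ultimately show ?thesis
    using L[unfolded isolating_length_def, rule_format, of "card I" "\<Lambda> \<circ> b" "g \<circ> b" i'] i'(1) by simp
qed

text \<open>Pass to the pieces over the \<open>k\<close>-cylinder hit by the piece of map 0 whose address consists
of \<open>r\<close> letters \<open>i\<close>. This exact family has a word \<open>J'\<close> of length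
\<open>L\<close> met by that piece only. Passing on to the cylinder of \<open>J'\<close>, only parts of the
one piece remain, and they are indexed by words of length \<open>q\<close>. Exactness of this family is the
equation.\<close>

lemma isolated_piece_equation:
  assumes M: "0 < max_yield" and fb: "family_bounds {..<N::nat} \<Lambda> g" and ex: "exact {..<N} \<Lambda> g"
    and N: "0 < N" and i: "i < n"
    and L: "isolating_length L"
    and q: "real m * xmax ^ q * real m ^ L < real m"
  shows "\<exists>r W. W \<subseteq> words n q \<and>
    max_yield * \<Lambda> 0 * real m ^ L * (\<Sum>w\<in>W. weight x w) * (x i ^ r * real m ^ k) = 1"
proof -
  have mk: "1 \<le> real m ^ k" using m2 by (intro one_le_power) auto
  obtain s where s: "real m * real m ^ k * xmax ^ s < real m"
    using ex_xmax_power[of "real m" "real m * real m ^ k"] m2 by auto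
  define D where "D j = stop_words s (\<Lambda> j * real m ^ k)" for j
  have D: "real m * xmin \<le> \<Lambda> j * weight x u * real m ^ k"
    "\<Lambda> j * weight x u * real m ^ k < real m" "set u \<subseteq> {..<n}" if "j < N" "u \<in> D j" for j u
  proof -
    note b = family_boundsD[OF fb, of j, simplified, OF that(1)]
    have "real m * xmin \<le> \<Lambda> j * real m ^ k"
      using mult_mono[OF b(2) mk] b(1) by simp
    from stop_words_lower[OF this that(2)[unfolded D_def]]
    show "real m * xmin \<le> \<Lambda> j * weight x u * real m ^ k" by (simp add: mult_ac)
    have "\<Lambda> j * real m ^ k * xmax ^ s \<le> real m * real m ^ k * xmax ^ s"
      using b(3) xmax_pos by (intro mult_right_mono) auto
    then have "\<Lambda> j * real m ^ k * xmax ^ s < real m" using s by linarith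
    from stop_words_upper[OF _ this that(2)[unfolded D_def]]
    show "\<Lambda> j * weight x u * real m ^ k < real m" using b(1) m2 by (simp add: mult_ac)
    show "set u \<subseteq> {..<n}" using that(2) unfolding D_def by (rule stop_words_set)
  qed
  obtain r where r: "replicate r i \<in> D 0" using stop_words_replicate[OF i] by (auto simp: D_def)
  define J where "J = stake k (g 0 (replicate r i @- sconst 0))"
  define P where "P = {(j, u) \<in> Sigma {..<N} D. \<forall>\<omega>\<in>seqs n. stake k (g j (u @- \<omega>)) = J}"
  define L1 where "L1 = (\<lambda>(j, u). \<Lambda> j * weight x u * real m ^ k)"
  define g1 where "g1 = (\<lambda>(j, u) \<omega>. sdrop k (g j (u @- \<omega>)))"
  (* the piece to be isolated *)
  define p where "p = (0 :: nat, replicate r i)"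
  note g = family_boundsD(4)[OF fb, simplified]
  have J: "J \<in> words m k"
    unfolding J_def using g[OF N] D(3)[OF N r] zeros_in_seqs
    by (intro stake_in_words wlip_seqs[of "\<Lambda> 0"]) (simp_all add: shift_in_seqs_iff)
  have exP: "exact P L1 g1"
    unfolding P_def L1_def g1_def
    by (rule exact_pieces[OF ex _ _ J]) (use D in \<open>auto simp: D_def complete_stop_words\<close>)
  have PD: "j < N \<and> u \<in> D j" if "(j, u) \<in> P" for j u using that by (auto simp: P_def)
  have fbP: "family_bounds P L1 g1"
    unfolding family_bounds_def
  proof (intro conjI ballI)
    show "finite P" using exP by (simp add: exact_def)
    fix a assume a: "a \<in> P"
    obtain j u where ju: "a = (j, u)" by (cases a)
    with a PD have "j < N" "u \<in> D j" by blast+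
    from D(1,2)[OF this] show "real m * xmin \<le> L1 a" "L1 a \<le> real m" by (simp_all add: L1_def ju)
    show "wlip (L1 a) (g1 a)" using exP a by (simp add: exact_def)
  qed
  have "stake k (g 0 (replicate r i @- \<omega>)) = J" if "\<omega> \<in> seqs n" for \<omega>
    unfolding J_def
    using wlip_restrict[OF g[OF N] D(3)[OF N r]] D(2)[OF N r] that zeros_in_seqs by (rule wlip_stake_eq)
  then have p: "p \<in> P" using r N by (simp add: P_def p_def)
  obtain J' where J': "J' \<in> words m L" "J' \<notin> stake L ` (\<Union>a\<in>P - {p}. g1 a ` seqs n)"
    using avoiding_word_reindex[OF L fbP exP p] by blast
  define Q where "Q = {(a, w) \<in> Sigma P (\<lambda>_. words n q). \<forall>\<omega>\<in>seqs n. stake L (g1 a (w @- \<omega>)) = J'}"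
  have exQ: "exact Q (\<lambda>(a, w). L1 a * weight x w * real m ^ L) (\<lambda>(a, w) \<omega>. sdrop L (g1 a (w @- \<omega>)))"
    unfolding Q_def
  proof (rule exact_pieces[OF exP complete_words _ J'(1)])
    fix a u assume a: "a \<in> P" and u: "u \<in> words n q"
    have "L1 a * weight x u * real m ^ L \<le> real m * xmax ^ q * real m ^ L"
      using family_boundsD(1,3)[OF fbP a] weight_le_xmax[OF words_set[OF u]] words_nonneg[OF u]
      by (intro mult_right_mono mult_mono) (auto simp: words_length[OF u])
    then show "L1 a * weight x u * real m ^ L < real m" using q by linarith
  qed
  define W where "W = {w. (p, w) \<in> Q}"
  have W: "W \<subseteq> words n q" by (auto simp: W_def Q_def)
  have "Q = {p} \<times> W"
  proof -
    have "a = p" if "(a, w) \<in> Q" for a w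
    proof (rule ccontr)
      assume "a \<noteq> p"
      moreover have "a \<in> P" "w \<in> words n q" "J' = stake L (g1 a (w @- sconst 0))"
        using that zeros_in_seqs by (auto simp: Q_def)
      moreover have "w @- sconst 0 \<in> seqs n"
        using words_set[OF \<open>w \<in> words n q\<close>] zeros_in_seqs by (simp add: shift_in_seqs_iff)
      ultimately show False using J'(2) by blast
    qed
    then show ?thesis by (auto simp: W_def)
  qed
  then have "(\<Sum>(a, w)\<in>Q. L1 a * weight x w * real m ^ L) = (\<Sum>w\<in>W. L1 p * weight x w * real m ^ L)"
    by (simp add: sum.cartesian_product[symmetric])
  also have "\<dots> = L1 p * (\<Sum>w\<in>W. weight x w) * real m ^ L"
    by (simp add: sum_distrib_left sum_distrib_right)
  finally have "max_yield * (L1 p * (\<Sum>w\<in>W. weight x w) * real m ^ L) = 1"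
    using exQ by (simp add: exact_def)
  then show ?thesis using W
    by (intro exI[of _ r] exI[of _ W]) (simp add: L1_def p_def mult_ac)
qed

text \<open>In the equation of an isolated piece the index set \<open>W\<close> is a subset of a fixed finite set,
while the depth \<open>k\<close> is arbitrary. Two depths with the same \<open>W\<close> have the same
constant factor, so the remaining factors \<open>x i ^ r * m ^ k\<close> coincide.\<close>

theorem letter_weight_commensurable:
  assumes f: "wlip \<Lambda>f f" "0 < \<Lambda>f" "0 < nu (f ` seqs n)" and i: "i < n"
  shows "\<exists>d>0. \<exists>e. x i ^ d * real m ^ e = 1"
proof -
  have M: "0 < max_yield" using near_optimal[OF f, of 1] by simp
  obtain N \<Lambda> g where g: "family_bounds {..<N::nat} \<Lambda> g" "exact {..<N} \<Lambda> g"
    using exact_family_exists[OF f] by blast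
  have N: "0 < N" using g(2) by (cases N) (auto simp: exact_def)
  obtain L where L: "isolating_length L"
    using uniform_avoiding_length[OF M] by blast
  obtain q where "real m * real m ^ L * xmax ^ q < real m"
    using ex_xmax_power[of "real m" "real m * real m ^ L"] m2 by auto
  then have q: "real m * xmax ^ q * real m ^ L < real m" by (simp add: mult_ac)
  obtain r W where rW: "\<And>k. W k \<subseteq> words n q"
    "\<And>k. max_yield * \<Lambda> 0 * real m ^ L * (\<Sum>w\<in>W k. weight x w) * (x i ^ r k * real m ^ k) = 1"
    using isolated_piece_equation[OF M g N i L q] by metis
  have "W k \<in> Pow (words n q)" for k using rW(1) by blast
  then obtain W0 s where s: "strict_mono (s :: nat \<Rightarrow> nat)" "\<And>t. W (s t) = W0"
    using constant_on_subsequence[of "Pow (words n q)" W] by auto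
  define k k' where "k = s 0" and "k' = s 1"
  have kk: "k < k'" using s(1) by (simp add: k_def k'_def strict_mono_less)
  define c where "c = max_yield * \<Lambda> 0 * real m ^ L * (\<Sum>w\<in>W0. weight x w)"
  have c: "c * (x i ^ r k * real m ^ k) = 1" "c * (x i ^ r k' * real m ^ k') = 1"
    using rW(2)[of k] rW(2)[of k'] s(2) by (simp_all add: c_def k_def k'_def)
  then have "c \<noteq> 0" by auto
  with c have "x i ^ r k * real m ^ k = x i ^ r k' * real m ^ k'"
    by (metis mult_left_cancel)
  also have "real m ^ k' = real m ^ k * real m ^ (k' - k)" using kk by (simp add: power_add[symmetric])
  finally have eq: "x i ^ r k = x i ^ r k' * real m ^ (k' - k)" using m2 by simp
  have xi: "0 < x i" "x i < 1" using pos[OF i] x_less_1[OF i] by auto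
  have "1 < real m ^ (k' - k)" using kk m2 by (intro one_less_power) auto
  then have "x i ^ r k' * 1 < x i ^ r k' * real m ^ (k' - k)"
    using xi by (intro mult_strict_left_mono) auto
  then have "x i ^ r k' < x i ^ r k" using eq by simp
  (* the exponents differ in the right direction since 0 < x i < 1 < m *)
  then have rr: "r k < r k'"
    using xi power_decreasing[of "r k'" "r k" "x i"] by (metis leD less_imp_le linorder_not_less)
  then have "x i ^ r k' = x i ^ r k * x i ^ (r k' - r k)" by (simp add: power_add[symmetric])
  then have "x i ^ (r k' - r k) * real m ^ (k' - k) = 1"
    using eq xi by (simp add: field_simps)
  then show ?thesis using rr by (intro exI[of _ "r k' - r k"]) auto
qed

end

section \<open>A common integer base for the weights\<close>

definition rational_poly :: "complex poly \<Rightarrow> bool" where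
  "rational_poly P \<longleftrightarrow> (\<forall>i. coeff P i \<in> \<rat>)"

text \<open>Division with remainder, one leading term at a time, with all coefficients staying rational.\<close>

lemma minimal_rational_poly_dvd:
  assumes P: "rational_poly P" "P \<noteq> 0" "poly P z = 0"
    and min: "\<And>G. rational_poly G \<Longrightarrow> G \<noteq> 0 \<Longrightarrow> poly G z = 0 \<Longrightarrow> degree P \<le> degree G"
    and F: "rational_poly F" "poly F z = 0"
  shows "P dvd F"
  using F
proof (induction "degree F" arbitrary: F rule: less_induct)
  case less
  show ?case
  proof (cases "F = 0")
    case False
    then have deg: "degree P \<le> degree F" using min less.prems by blast
    define a where "a = lead_coeff F / lead_coeff P"
    define S where "S = monom a (degree F - degree P) * P"
    define G where "G = F - S"
    have a: "a \<in> \<rat>" using P(1) less.prems(1) by (auto simp: a_def rational_poly_def)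
    then have ratS: "coeff S i \<in> \<rat>" for i
      using P(1) by (auto simp: S_def coeff_monom_mult rational_poly_def)
    then have ratG: "rational_poly G"
      using less.prems(1) by (auto simp: G_def rational_poly_def)
    have rootG: "poly G z = 0" using less.prems(2) P(3) by (simp add: G_def S_def)
    have "P dvd G"
    proof (cases "G = 0")
      case False
      have "degree S \<le> degree F"
        using degree_mult_le[of "monom a (degree F - degree P)" P] degree_monom_le[of a "degree F - degree P"] deg
        unfolding S_def by linarith
      then have "degree G \<le> degree F" unfolding G_def by (intro degree_diff_le) auto
      moreover have "coeff G (degree F) = 0"
        using P(2) deg by (simp add: G_def S_def coeff_monom_mult a_def)
      ultimately have "degree G < degree F" using False by (rule degree_less_if_less_eqI)
      then show ?thesis using less.hyps ratG rootG by blast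
    qed simp
    moreover have "P dvd S" by (simp add: S_def)
    ultimately have "P dvd G + S" by (rule dvd_add)
    then show ?thesis by (simp add: G_def)
  qed simp
qed

text \<open>Up to sign, the constant coefficient is the leading coefficient times the product of the roots.\<close>

lemma poly_at_0_norm:
  assumes "P \<noteq> 0" and roots: "\<And>z. poly P z = 0 \<Longrightarrow> cmod z = t"
  shows "cmod (poly P 0) = cmod (lead_coeff P) * t ^ degree P"
proof -
  obtain A where A: "size A = degree P" "P = smult (lead_coeff P) (\<Prod>x\<in>#A. [:-x, 1:])"
    using alg_closed_imp_factorization[OF assms(1)] by blast
  have root: "cmod x = t" if "x \<in># A" for x
  proof (rule roots)
    have "poly (\<Prod>x\<in>#A. [:-x, 1:]) x = 0"
      using that by (auto simp: poly_prod_mset image_iff)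
    then show "poly P x = 0" by (subst A(2)) simp
  qed
  have "cmod (\<Prod>x\<in>#A. - x) = t ^ size A"
    using root
  proof (induction A)
    case (add x A)
    then show ?case by (simp add: norm_mult)
  qed simp
  moreover have "poly P 0 = lead_coeff P * (\<Prod>x\<in>#A. - x)"
    by (subst A(2)) (simp add: poly_prod_mset image_mset.compositionality o_def)
  ultimately show ?thesis using A(1) by (simp add: norm_mult)
qed

lemma Rats_cmod: "z \<in> \<rat> \<Longrightarrow> cmod z \<in> \<rat>"
  by (elim Rats_cases') (simp add: norm_divide Rats_divide)

lemma Rats_of_real: "t \<in> \<rat> \<Longrightarrow> (of_real t :: complex) \<in> \<rat>"
  by (elim Rats_cases') (simp add: Rats_divide)

text \<open>A minimal polynomial of \<open>\<theta>\<close> over the rationals divides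
\<open>X ^ b - \<theta> ^ b\<close>, whose roots all have modulus \<open>\<theta>\<close>. The modulus of
its constant coefficient is therefore \<open>\<theta> ^ degree\<close> times a rational number. So
\<open>\<theta> ^ degree\<close> is rational, and the degree is at least \<open>b\<close>.\<close>

lemma radical_not_root:
  fixes \<theta> :: real
  assumes \<theta>: "0 < \<theta>" and b: "\<theta> ^ b \<in> \<rat>" and least: "\<And>c. 0 < c \<Longrightarrow> c < b \<Longrightarrow> \<theta> ^ c \<notin> \<rat>"
    and h: "rational_poly h" "h \<noteq> 0" "degree h < b"
  shows "poly h (of_real \<theta>) \<noteq> 0"
proof
  assume root: "poly h (of_real \<theta>) = 0"
  define Q where "Q P \<longleftrightarrow> rational_poly P \<and> P \<noteq> 0 \<and> poly P (of_real \<theta>) = 0" for P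
  define P where "P = (ARG_MIN degree P. Q P)"
  have "Q h" using h root by (simp add: Q_def)
  then have P: "Q P" "\<And>G. Q G \<Longrightarrow> degree P \<le> degree G"
    unfolding P_def by (auto intro: arg_min_natI arg_min_nat_le)
  have degP: "degree P < b" using P(2)[OF \<open>Q h\<close>] h(3) by simp
  have degP0: "0 < degree P"
  proof (rule ccontr)
    assume "\<not> 0 < degree P"
    then obtain c where "P = [:c:]" by (metis degree_eq_zeroE gr0I)
    then show False using P(1) by (simp add: Q_def)
  qed
  define F :: "complex poly" where "F = monom 1 b - [:of_real (\<theta> ^ b):]"
  have "of_real (\<theta> ^ b) \<in> (\<rat> :: complex set)"
    using b by (rule Rats_of_real)
  then have "rational_poly F"
    by (auto simp: F_def rational_poly_def coeff_pCons split: nat.split)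
  moreover have "poly F (of_real \<theta>) = 0" by (simp add: F_def poly_monom)
  ultimately have "P dvd F"
    using P by (intro minimal_rational_poly_dvd[of P "of_real \<theta>"]) (auto simp: Q_def)
  have "cmod z = \<theta>" if "poly P z = 0" for z
  proof -
    have "poly F z = 0" using \<open>P dvd F\<close> that by (auto elim!: dvdE)
    then have "z ^ b = of_real (\<theta> ^ b)" by (simp add: F_def poly_monom)
    then have "cmod z ^ b = \<theta> ^ b"
      using \<theta> by (metis norm_of_real norm_power abs_of_nonneg less_imp_le zero_le_power)
    moreover have "0 < b" using degP by simp
    ultimately show ?thesis using \<theta> power_eq_imp_eq_base[of "cmod z" b \<theta>] by simp
  qed
  then have "cmod (poly P 0) = cmod (lead_coeff P) * \<theta> ^ degree P"
    using P(1) by (intro poly_at_0_norm) (auto simp: Q_def)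
  then have "\<theta> ^ degree P = cmod (poly P 0) / cmod (lead_coeff P)"
    using P(1) by (simp add: Q_def)
  also have "\<dots> \<in> \<rat>"
    using P(1) by (intro Rats_divide Rats_cmod) (auto simp: Q_def rational_poly_def poly_0_coeff_0)
  finally show False using least[OF degP0 degP] by simp
qed

text \<open>The rational root theorem for \<open>X ^ a - m\<close>.\<close>

lemma rational_power_nat:
  fixes \<zeta> :: real
  assumes "\<zeta> \<in> \<rat>" "0 < \<zeta>" "0 < a" "\<zeta> ^ a = real m"
  shows "\<exists>p. \<zeta> = real p"
proof -
  obtain u v :: nat where uv: "v \<noteq> 0" "\<bar>\<zeta>\<bar> = real u / real v" "coprime u v"
    using assms(1) by (rule Rats_abs_nat_div_natE)
  have "\<zeta> = real u / real v" using uv(2) assms(2) by simp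
  then have "(real u / real v) ^ a = real m" using assms(4) by simp
  then have "real u ^ a = real m * real v ^ a" using uv(1) by (simp add: power_divide divide_eq_eq)
  then have "real (u ^ a) = real (m * v ^ a)" by simp
  then have "u ^ a = m * v ^ a" by (simp only: of_nat_eq_iff)
  then have "v ^ a dvd u ^ a" by simp
  then have "v dvd u" using assms(3) by (simp add: pow_divides_pow_iff)
  then have "v = 1" using uv(3) by (metis coprime_absorb_left coprime_commute is_unit_gcd nat_dvd_1_iff_1)
  then show ?thesis using uv(2) assms(2) by auto
qed

text \<open>All \<open>x i\<close> are powers \<open>\<theta> ^ (- E i)\<close> of a single root
\<open>\<theta>\<close> of \<open>m\<close>. Let \<open>b\<close> be the least positive exponent for which
\<open>\<theta> ^ b\<close> is rational. Reducing exponents modulo \<open>b\<close> turns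
\<open>(\<Sum>i. x i) = 1\<close> into a polynomial equation for \<open>\<theta>\<close> of degree less than
\<open>b\<close> with rational coefficients. An exponent \<open>E i\<close> not divisible by
\<open>b\<close> would contribute a positive coefficient in positive degree, and nothing can cancel it
because all contributions are positive. Hence \<open>b\<close> divides every \<open>E i\<close>, and
\<open>p = \<theta> ^ b\<close> is an integer because \<open>p ^ a = m\<close>.\<close>

theorem (in prob_vector) common_integer_base:
  assumes less1: "\<And>i. i < n \<Longrightarrow> x i < 1" and m: "2 \<le> m"
    and comm: "\<And>i. i < n \<Longrightarrow> \<exists>d>0. \<exists>e. x i ^ d * real m ^ e = 1"
  shows "\<exists>p l a. 2 \<le> p \<and> (\<forall>i<n. 0 < l i \<and> x i = (1 / real p) ^ l i) \<and> 0 < a \<and> m = p ^ a"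
proof -
  obtain d e where de: "\<And>i. i < n \<Longrightarrow> 0 < d i \<and> x i ^ d i * real m ^ e i = 1"
    using comm by metis
  define D where "D = (\<Prod>i<n. d i)"
  have D: "0 < D" using de by (simp add: D_def prod_pos)
  define \<theta> where "\<theta> = root D (real m)"
  have \<theta>D: "\<theta> ^ D = real m" using D by (simp add: \<theta>_def real_root_pow_pos2)
  have \<theta>1: "1 < \<theta>" using D m by (simp add: \<theta>_def)
  define E where "E i = e i * (D div d i)" for i
  have xE: "x i * \<theta> ^ E i = 1" if i: "i < n" for i
  proof -
    have "d i dvd D" using i by (auto simp: D_def intro: dvd_prodI)
    then have D': "D = d i * (D div d i)" by simp
    have "(x i * \<theta> ^ E i) ^ D = x i ^ D * (\<theta> ^ D) ^ E i"
      by (simp add: power_mult_distrib power_mult[symmetric] mult.commute)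
    also have "\<dots> = (x i ^ d i * real m ^ e i) ^ (D div d i)"
      by (subst (1) D') (simp add: \<theta>D E_def power_mult_distrib power_mult[symmetric])
    also have "\<dots> = 1" using de[OF i] by simp
    finally have "(x i * \<theta> ^ E i) ^ D = 1 ^ D" by simp
    moreover have "0 \<le> x i * \<theta> ^ E i" using pos[OF i] \<theta>1 by simp
    ultimately show ?thesis using zero_le_one D by (rule power_eq_imp_eq_base)
  qed
  define b where "b = (LEAST b. 0 < b \<and> \<theta> ^ b \<in> \<rat>)"
  have "0 < b \<and> \<theta> ^ b \<in> \<rat>"
    unfolding b_def by (rule LeastI[of _ D]) (simp add: D \<theta>D)
  then have b: "0 < b" "\<theta> ^ b \<in> \<rat>" by auto
  have least: "\<theta> ^ c \<notin> \<rat>" if "0 < c" "c < b" for c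
    using not_less_Least[of c "\<lambda>b. 0 < b \<and> \<theta> ^ b \<in> \<rat>"] that by (auto simp: b_def[symmetric])
  define \<zeta> where "\<zeta> = \<theta> ^ b"
  have \<zeta>: "\<zeta> \<in> \<rat>" "1 < \<zeta>" using b \<theta>1 by (simp_all add: \<zeta>_def one_less_power)
  define B where "B = (\<Sum>i<n. E i)"
  (* shifting by b * B makes the exponents nonnegative: x i * \<zeta> ^ B = \<theta> ^ k i *)
  define k where "k i = b * B - E i" for i
  have E_le: "E i \<le> b * B" if "i < n" for i
  proof -
    have "E i \<le> B" unfolding B_def using that by (intro member_le_sum) auto
    also have "B \<le> b * B" using b(1) by simp
    finally show ?thesis .
  qed
  have xk: "x i * \<zeta> ^ B = \<zeta> ^ (k i div b) * \<theta> ^ (k i mod b)" if "i < n" for i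
  proof -
    have "\<zeta> ^ B = \<theta> ^ (E i + k i)"
      using E_le[OF that] by (simp add: \<zeta>_def k_def power_mult[symmetric])
    then have "x i * \<zeta> ^ B = \<theta> ^ k i"
      using xE[OF that] by (simp add: power_add mult.assoc[symmetric])
    also have "\<dots> = \<theta> ^ (b * (k i div b) + k i mod b)" by simp
    also have "\<dots> = \<zeta> ^ (k i div b) * \<theta> ^ (k i mod b)"
      by (simp only: power_add power_mult \<zeta>_def)
    finally show ?thesis .
  qed
  have dvd: "b dvd E i" if i: "i < n" for i
  proof (rule ccontr)
    assume nd: "\<not> b dvd E i"
    have ki: "0 < k i mod b"
    proof (rule ccontr)
      assume "\<not> 0 < k i mod b"
      then have "b dvd k i" by (simp add: dvd_eq_mod_eq_0)
      moreover have "E i = b * B - k i" using E_le[OF i] by (simp add: k_def)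
      ultimately show False using nd by (metis dvd_diff_nat dvd_triv_left)
    qed
    (* the equation sum x j * \<zeta> ^ B = \<zeta> ^ B, with each \<theta> ^ k j written as a rational multiple of a
       power of \<theta> below b *)
    define h :: "complex poly" where
      "h = (\<Sum>j<n. monom (of_real (\<zeta> ^ (k j div b))) (k j mod b)) - [:of_real (\<zeta> ^ B):]"
    have ofr: "of_real (\<zeta> ^ q) \<in> (\<rat> :: complex set)" for q
      using \<zeta>(1) by (intro Rats_of_real Rats_power)
    have "rational_poly h"
    proof -
      have sum_rat: "(\<Sum>j\<in>J. if P j then of_real (\<zeta> ^ q j) else 0) \<in> (\<rat> :: complex set)"
        for J :: "nat set" and P q
        using ofr by (induction J rule: infinite_finite_induct) auto
      have "coeff [:of_real (\<zeta> ^ B):] q \<in> (\<rat> :: complex set)" for q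
        using ofr[of B] by (cases q) (simp_all only: coeff_pCons_0 coeff_pCons_Suc coeff_0 Rats_0)
      then show ?thesis
        unfolding rational_poly_def h_def using sum_rat
        by (simp only: coeff_diff coeff_sum coeff_monom Rats_diff simp_thms)
    qed
    moreover have "coeff h (k i mod b) \<noteq> 0"
    proof -
      obtain q where q: "k i mod b = Suc q" using ki by (cases "k i mod b") auto
      have "coeff h (k i mod b) = (\<Sum>j<n. of_real (if k j mod b = k i mod b then \<zeta> ^ (k j div b) else 0))"
        unfolding h_def q coeff_diff coeff_pCons_Suc coeff_sum coeff_monom
        by (simp only: coeff_0 diff_0_right) (intro sum.cong refl, simp)
      then have "coeff h (k i mod b) = of_real (\<Sum>j<n. if k j mod b = k i mod b then \<zeta> ^ (k j div b) else 0)"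
        by (simp only: of_real_sum)
      moreover have "0 < (\<Sum>j<n. if k j mod b = k i mod b then \<zeta> ^ (k j div b) else 0)"
        using i \<zeta>(2) by (intro sum_pos2[of _ i]) auto
      ultimately show ?thesis by (simp only: of_real_eq_0_iff)
    qed
    then have "h \<noteq> 0" by auto
    moreover have "degree h < b"
      unfolding h_def using b(1)
      by (intro degree_diff_less degree_sum_less le_less_trans[OF degree_monom_le]) auto
    ultimately have "poly h (of_real \<theta>) \<noteq> 0"
      using \<theta>1 b(2) least by (intro radical_not_root) auto
    moreover have "poly h (of_real \<theta>) = of_real ((\<Sum>j<n. x j * \<zeta> ^ B) - \<zeta> ^ B)"
      by (simp add: h_def poly_sum poly_monom xk)
    moreover have "(\<Sum>j<n. x j * \<zeta> ^ B) = \<zeta> ^ B"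
      using sum_1 by (simp add: sum_distrib_right[symmetric])
    ultimately show False by simp
  qed
  have "D mod b = 0"
  proof (rule ccontr)
    assume "D mod b \<noteq> 0"
    then have "\<theta> ^ (D mod b) \<notin> \<rat>" using b(1) by (intro least) auto
    moreover have "\<theta> ^ (D mod b) = real m / \<zeta> ^ (D div b)"
    proof -
      have "real m = \<theta> ^ (b * (D div b) + D mod b)" using \<theta>D by simp
      also have "\<dots> = \<zeta> ^ (D div b) * \<theta> ^ (D mod b)" by (simp only: power_add power_mult \<zeta>_def)
      finally show ?thesis using \<zeta>(2) by simp
    qed
    ultimately show False using \<zeta>(1) by (simp add: Rats_divide)
  qed
  then obtain a where a: "D = b * a" by auto
  then have a0: "0 < a" using D by (cases a) auto
  have \<zeta>a: "\<zeta> ^ a = real m" using \<theta>D by (simp add: a \<zeta>_def power_mult)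
  obtain p where p: "\<zeta> = real p" using rational_power_nat[OF \<zeta>(1) _ a0 \<zeta>a] \<zeta>(2) by auto
  have "2 \<le> p" using \<zeta>(2) p by simp
  moreover have "m = p ^ a" using \<zeta>a by (simp add: p)
  moreover have "0 < E i div b \<and> x i = (1 / real p) ^ (E i div b)" if i: "i < n" for i
  proof -
    have "\<theta> ^ E i = real p ^ (E i div b)"
      using dvd[OF i] by (auto simp: p[symmetric] \<zeta>_def power_mult[symmetric])
    then have "x i * real p ^ (E i div b) = 1" using xE[OF i] by simp
    then have xi: "x i = (1 / real p) ^ (E i div b)"
      using \<open>2 \<le> p\<close> by (simp add: field_simps)
    moreover have "0 < E i div b"
      using xi less1[OF i] by (cases "E i div b") auto
    ultimately show ?thesis by blast
  qed
  ultimately show ?thesis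
    using a0 by (intro exI[of _ p] exI[of _ "\<lambda>i. E i div b"] exI[of _ a]) auto
qed

section \<open>Complete prefix codes and substitution\<close>

lemma words_with_prefix:
  assumes "c \<in> words p k" "k \<le> L"
  shows "{w \<in> words p L. take k w = c} = (@) c ` words p (L - k)"
proof (intro equalityI subsetI)
  fix w assume w: "w \<in> {w \<in> words p L. take k w = c}"
  then have "w = c @ drop k w" by (metis (mono_tags, lifting) append_take_drop_id mem_Collect_eq)
  moreover have "drop k w \<in> words p (L - k)"
    using w set_drop_subset[of k w] by (auto simp: words_def)
  ultimately show "w \<in> (@) c ` words p (L - k)" by blast
next
  fix w assume "w \<in> (@) c ` words p (L - k)"
  then show "w \<in> {w \<in> words p L. take k w = c}" using assms by (auto simp: words_def)
qed

lemma card_words_with_prefix: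
  assumes "c \<in> words p k" "k \<le> L"
  shows "card {w \<in> words p L. take k w = c} = p ^ (L - k)"
  unfolding words_with_prefix[OF assms] by (simp add: card_image inj_on_def card_words)

lemma power_diff_eq:
  assumes "0 < p" "k \<le> L"
  shows "real (p ^ (L - k)) = real p ^ L * (1 / real p) ^ k"
proof -
  have "real (p ^ (L - k)) = real p ^ L / real p ^ k" using assms by (simp only: of_nat_power) (simp add: power_diff)
  then show ?thesis by (simp add: power_one_over)
qed

text \<open>Kraft's inequality. Code words are assigned in the order of increasing length. At length
\<open>l x\<close> the earlier code words block \<open>(\<Sum>i\<in>S. p ^ (l x - l i))\<close> words, which
is less than \<open>p ^ l x\<close>.\<close>

lemma prefix_code_exists:
  assumes "finite I" "0 < p" "(\<Sum>i\<in>I. (1 / real p) ^ l i) \<le> 1"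
  shows "\<exists>c. (\<forall>i\<in>I. c i \<in> words p (l i)) \<and>
    (\<forall>i\<in>I. \<forall>j\<in>I. i \<noteq> j \<longrightarrow> l i \<le> l j \<longrightarrow> take (l i) (c j) \<noteq> c i)"
  using assms(1,3)
proof (induction I rule: finite_ranking_induct[where f = l])
  case (insert x S)
  show ?case
  proof (cases "x \<in> S")
    case True
    then show ?thesis using insert by (simp add: insert_absorb)
  next
    case False
    have sum: "(1 / real p) ^ l x + (\<Sum>i\<in>S. (1 / real p) ^ l i) \<le> 1"
      using insert.prems insert.hyps(1) False by simp
    then have "(\<Sum>i\<in>S. (1 / real p) ^ l i) \<le> 1"
      using assms(2) by (smt (verit) zero_le_power zero_le_divide_1_iff of_nat_0_le_iff)
    from insert.IH[OF this] obtain c where c: "\<forall>i\<in>S. c i \<in> words p (l i)"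
      "\<forall>i\<in>S. \<forall>j\<in>S. i \<noteq> j \<longrightarrow> l i \<le> l j \<longrightarrow> take (l i) (c j) \<noteq> c i"
      by (elim exE conjE)
    define blocked where "blocked = (\<Union>i\<in>S. {w \<in> words p (l x). take (l i) w = c i})"
    have "card blocked \<le> (\<Sum>i\<in>S. card {w \<in> words p (l x). take (l i) w = c i})"
      unfolding blocked_def using insert.hyps(1) by (rule card_UN_le)
    also have "\<dots> = (\<Sum>i\<in>S. p ^ (l x - l i))"
      using c(1) insert.hyps(2) by (intro sum.cong card_words_with_prefix) auto
    finally have "real (card blocked) \<le> (\<Sum>i\<in>S. real (p ^ (l x - l i)))"
      by (metis of_nat_le_iff of_nat_sum)
    also have "\<dots> = (\<Sum>i\<in>S. real p ^ l x * (1 / real p) ^ l i)"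
      using insert.hyps(2) assms(2) by (intro sum.cong power_diff_eq) auto
    also have "\<dots> = real p ^ l x * (\<Sum>i\<in>S. (1 / real p) ^ l i)" by (simp only: sum_distrib_left)
    also have "\<dots> \<le> real p ^ l x * (1 - (1 / real p) ^ l x)"
      using sum by (intro mult_left_mono) auto
    also have "\<dots> < real p ^ l x * 1"
      using assms(2) by (intro mult_strict_left_mono) auto
    finally have "card blocked < card (words p (l x))" by (simp add: card_words)
    then have "\<not> words p (l x) \<subseteq> blocked"
      using card_mono[of blocked "words p (l x)"] insert.hyps(1) by (auto simp: blocked_def)
    then obtain w where w: "w \<in> words p (l x)" "w \<notin> blocked" by blast
    then have nb: "take (l i) w \<noteq> c i" if "i \<in> S" for i using that by (auto simp: blocked_def)
    have wc: "take (l x) (c i) \<noteq> w" if "i \<in> S" "l x \<le> l i" for i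
    proof
      assume eq: "take (l x) (c i) = w"
      have "l i = l x" using insert.hyps(2)[OF that(1)] that(2) by simp
      moreover have "length (c i) = l i" using c(1) that(1) by (auto simp: words_def)
      ultimately have "c i = w" using eq by simp
      then show False using nb[OF that(1)] \<open>l i = l x\<close> words_length[OF w(1)] by simp
    qed
    show ?thesis
      by (rule exI[of _ "c(x := w)"]) (use c w(1) nb wc False in auto)
  qed
qed simp

text \<open>If Kraft's inequality is an equality, then counting words of the maximal length \<open>L\<close> shows
that each of them has a code word as a prefix.\<close>

lemma complete_prefix_code_exists:
  assumes I: "finite I" and p: "0 < p" and sum: "(\<Sum>i\<in>I. (1 / real p) ^ l i) = 1"
  shows "\<exists>c. (\<forall>i\<in>I. c i \<in> words p (l i)) \<and>
    (\<forall>i\<in>I. \<forall>j\<in>I. \<forall>y. stake (l i) y = c i \<longrightarrow> stake (l j) y = c j \<longrightarrow> i = j) \<and>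
    (\<forall>y\<in>seqs p. \<exists>i\<in>I. stake (l i) y = c i)"
proof -
  obtain c where c: "\<And>i. i \<in> I \<Longrightarrow> c i \<in> words p (l i)"
    "\<And>i j. i \<in> I \<Longrightarrow> j \<in> I \<Longrightarrow> i \<noteq> j \<Longrightarrow> l i \<le> l j \<Longrightarrow> take (l i) (c j) \<noteq> c i"
    using prefix_code_exists[OF I p, of l] sum by auto
  have le: "i = j" if "i \<in> I" "j \<in> I" "l i \<le> l j" "stake (l i) y = c i" "stake (l j) y = c j" for i j y
  proof (rule ccontr)
    assume "i \<noteq> j"
    have "take (l i) (c j) = take (l i) (stake (l j) y)" using that(5) by simp
    also have "\<dots> = c i" using that(3,4) by (simp add: take_stake min_absorb1)
    finally show False using c(2)[OF that(1,2) \<open>i \<noteq> j\<close> that(3)] by simp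
  qed
  have uniq: "i = j" if "i \<in> I" "j \<in> I" "stake (l i) y = c i" "stake (l j) y = c j" for i j y
    using le[of i j y] le[of j i y] that by (metis nat_le_linear)
  define L where "L = Max (l ` I)"
  have L: "l i \<le> L" if "i \<in> I" for i using I that by (simp add: L_def)
  define block where "block i = {w \<in> words p L. take (l i) w = c i}" for i
  have fin: "finite (block i)" for i by (simp add: block_def)
  have disj: "block i \<inter> block j = {}" if "i \<in> I" "j \<in> I" "i \<noteq> j" for i j
  proof (rule ccontr)
    assume "block i \<inter> block j \<noteq> {}"
    then obtain w where w: "length w = L" "take (l i) w = c i" "take (l j) w = c j"
      by (auto simp: block_def words_def)
    have "stake (l i) (w @- sconst 0) = c i" "stake (l j) (w @- sconst 0) = c j"
      using w L that by (simp_all add: stake_shift)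
    then show False using uniq that by blast
  qed
  have "card (\<Union>i\<in>I. block i) = (\<Sum>i\<in>I. card (block i))"
    using I fin disj by (intro card_UN_disjoint) auto
  also have "\<dots> = (\<Sum>i\<in>I. p ^ (L - l i))"
    unfolding block_def using c(1) L by (intro sum.cong card_words_with_prefix) auto
  finally have "real (card (\<Union>i\<in>I. block i)) = (\<Sum>i\<in>I. real (p ^ (L - l i)))" by simp
  also have "\<dots> = (\<Sum>i\<in>I. real p ^ L * (1 / real p) ^ l i)"
    using L p by (intro sum.cong power_diff_eq) auto
  also have "\<dots> = real p ^ L" by (simp only: sum_distrib_left[symmetric] sum mult_1_right)
  finally have "card (words p L) \<le> card (\<Union>i\<in>I. block i)"
    by (simp add: card_words of_nat_power[symmetric] del: of_nat_power)
  moreover have "(\<Union>i\<in>I. block i) \<subseteq> words p L" by (auto simp: block_def)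
  ultimately have all: "(\<Union>i\<in>I. block i) = words p L" by (intro card_seteq) auto
  have "\<exists>i\<in>I. stake (l i) y = c i" if "y \<in> seqs p" for y
  proof -
    have "stake L y \<in> (\<Union>i\<in>I. block i)" unfolding all using that by (rule stake_in_words)
    then obtain i where i: "i \<in> I" "take (l i) (stake L y) = c i" by (auto simp: block_def)
    then show ?thesis using L[OF i(1)] by (auto simp: take_stake min_absorb1)
  qed
  then show ?thesis using c(1) uniq by blast
qed

lemma first_difference:
  assumes "\<omega> \<noteq> \<omega>'" "\<omega> \<in> seqs n" "\<omega>' \<in> seqs n"
  shows "\<exists>u i j \<eta> \<eta>'. set u \<subseteq> {..<n} \<and> i < n \<and> j < n \<and> i \<noteq> j \<and> \<eta> \<in> seqs n \<and> \<eta>' \<in> seqs n \<and>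
    \<omega> = u @- i ## \<eta> \<and> \<omega>' = u @- j ## \<eta>'"
proof -
  obtain j where "stake j \<omega> \<noteq> stake j \<omega>'"
    using assms(1) stream_eq_iff_stake[of \<omega> \<omega>'] by blast
  from ex_first_difference[OF this] obtain k
    where eq: "stake k \<omega> = stake k \<omega>'" and ne: "\<omega> !! k \<noteq> \<omega>' !! k" by blast
  have "\<omega> = stake k \<omega> @- \<omega> !! k ## sdrop (Suc k) \<omega>" by (rule id_stake_snth_sdrop)
  moreover have "\<omega>' = stake k \<omega> @- \<omega>' !! k ## sdrop (Suc k) \<omega>'"
    unfolding eq by (rule id_stake_snth_sdrop)
  moreover have "\<omega> !! k < n" "\<omega>' !! k < n" using assms by (auto simp: streams_iff_snth)
  ultimately show ?thesis
    using ne set_stake[OF assms(2), of k] sdrop_in_seqs[OF assms(2), of "Suc k"] sdrop_in_seqs[OF assms(3), of "Suc k"]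
    by (intro exI[of _ "stake k \<omega>"] exI[of _ "\<omega> !! k"] exI[of _ "\<omega>' !! k"]
        exI[of _ "sdrop (Suc k) \<omega>"] exI[of _ "sdrop (Suc k) \<omega>'"] conjI)
qed

lemma flat_smap_Cons:
  assumes "c i \<noteq> []" shows "flat (smap c (i ## \<omega>)) = c i @- flat (smap c \<omega>)"
  using assms by (subst flat_unfold) auto

lemma flat_smap_shift:
  assumes "\<And>i. i \<in> set u \<Longrightarrow> c i \<noteq> []"
  shows "flat (smap c (u @- \<omega>)) = concat (map c u) @- flat (smap c \<omega>)"
  using assms by (induction u) (simp_all add: flat_smap_Cons[simplified])

text \<open>Every stream over \<open>p\<close> letters starts with exactly one code word, so it decomposes uniquely
into code words (\<open>bij_betw_encode\<close>).\<close>

locale prefix_code =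
  fixes n p :: nat and l :: "nat \<Rightarrow> nat" and c :: "nat \<Rightarrow> nat list"
  assumes l_pos: "i < n \<Longrightarrow> 0 < l i" and c_words: "i < n \<Longrightarrow> c i \<in> words p (l i)"
    and unique: "i < n \<Longrightarrow> j < n \<Longrightarrow> stake (l i) y = c i \<Longrightarrow> stake (l j) y = c j \<Longrightarrow> i = j"
    and covers: "y \<in> seqs p \<Longrightarrow> \<exists>i<n. stake (l i) y = c i"
begin

definition encode :: "nat stream \<Rightarrow> nat stream" where
  "encode \<omega> = flat (smap c \<omega>)"

lemma length_c: "i < n \<Longrightarrow> length (c i) = l i"
  using c_words by (simp add: words_def)

lemma c_not_Nil: "i < n \<Longrightarrow> c i \<noteq> []"
  using l_pos length_c by fastforce

lemma encode_Cons: "i < n \<Longrightarrow> encode (i ## \<omega>) = c i @- encode \<omega>"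
  unfolding encode_def by (rule flat_smap_Cons) (rule c_not_Nil)

lemma encode_shift: "set u \<subseteq> {..<n} \<Longrightarrow> encode (u @- \<omega>) = concat (map c u) @- encode \<omega>"
  unfolding encode_def using c_not_Nil by (intro flat_smap_shift) auto

lemma length_concat_code: "set u \<subseteq> {..<n} \<Longrightarrow> length (concat (map c u)) = sum_list (map l u)"
  by (induction u) (auto simp: length_c)

lemma encode_in_seqs: assumes "\<omega> \<in> seqs n" shows "encode \<omega> \<in> seqs p"
proof -
  have lt: "\<forall>w \<in> sset (smap c \<omega>). w \<noteq> []" "\<forall>w \<in> sset (smap c \<omega>). set w \<subseteq> {..<p}"
    using assms c_not_Nil c_words by (auto simp: streams_iff_sset stream.set_map words_def)
  have "sset (encode \<omega>) = (\<Union>w\<in>sset (smap c \<omega>). set w)"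
    unfolding encode_def using lt(1) by (rule sset_flat)
  then show ?thesis using lt(2) by (auto simp: streams_iff_sset)
qed

text \<open>Streams that differ right after \<open>u\<close> have codes that differ at most \<open>M\<close> places
after the code of \<open>u\<close>, because there two different code words begin. So \<open>encode\<close>
changes the position of the first difference by a bounded amount only.\<close>

lemma encode_separates:
  assumes u: "set u \<subseteq> {..<n}" and ij: "i < n" "j < n" "i \<noteq> j" and lmax: "l i \<le> M" "l j \<le> M"
  shows "stake (sum_list (map l u) + M) (encode (u @- i ## \<omega>)) \<noteq>
    stake (sum_list (map l u) + M) (encode (u @- j ## \<omega>'))"
proof
  assume eq: "stake (sum_list (map l u) + M) (encode (u @- i ## \<omega>)) =
    stake (sum_list (map l u) + M) (encode (u @- j ## \<omega>'))"
  have "stake M (encode (i ## \<omega>)) = stake M (encode (j ## \<omega>'))"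
    using arg_cong[OF eq, of "drop (sum_list (map l u))"] u
    by (simp add: encode_shift drop_stake sdrop_shift length_concat_code)
  then have "stake (l j) (encode (i ## \<omega>)) = stake (l j) (encode (j ## \<omega>'))"
    using lmax(2) by (rule stake_eq_mono)
  also have "\<dots> = c j" using ij(2) by (simp add: encode_Cons stake_shift length_c)
  finally have "stake (l j) (encode (i ## \<omega>)) = c j" .
  moreover have "stake (l i) (encode (i ## \<omega>)) = c i"
    using ij(1) by (simp add: encode_Cons stake_shift length_c)
  ultimately show False using unique[OF ij(1,2)] ij(3) by blast
qed

lemma inj_on_encode: "inj_on encode (seqs n)"
proof (rule inj_onI, rule ccontr)
  fix \<omega> \<omega>' assume \<omega>: "\<omega> \<in> seqs n" "\<omega>' \<in> seqs n" "encode \<omega> = encode \<omega>'" "\<omega> \<noteq> \<omega>'"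
  from first_difference[OF \<omega>(4,1,2)]
  obtain u i j \<eta> \<eta>' where *: "set u \<subseteq> {..<n}" "i < n" "j < n" "i \<noteq> j"
    "\<omega> = u @- i ## \<eta>" "\<omega>' = u @- j ## \<eta>'"
    by (elim exE conjE)
  show False
    using encode_separates[OF *(1-4), of "l i + l j" \<eta> \<eta>'] \<omega>(3) *(5,6) by simp
qed

text \<open>Decoding strips off one code word at a time.\<close>

lemma encode_surj: assumes "y \<in> seqs p" shows "\<exists>\<omega>\<in>seqs n. encode \<omega> = y"
proof -
  define idx where "idx y = (SOME i. i < n \<and> stake (l i) y = c i)" for y
  define nxt where "nxt y = sdrop (l (idx y)) y" for y
  have idx: "idx y < n \<and> stake (l (idx y)) y = c (idx y)" if "y \<in> seqs p" for y
    unfolding idx_def using covers[OF that] by (rule someI_ex)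
  have nxt: "nxt y \<in> seqs p" if "y \<in> seqs p" for y
    unfolding nxt_def using that by (rule sdrop_in_seqs)
  define dec where "dec y = smap idx (siterate nxt y)" for y
  have dec: "dec y = idx y ## dec (nxt y)" for y
    unfolding dec_def by (subst siterate.code) simp
  have iter: "(nxt ^^ k) y \<in> seqs p" if "y \<in> seqs p" for k y
    using that nxt by (induction k) auto
  have dec_seqs: "dec y \<in> seqs n" if "y \<in> seqs p" for y
    using idx iter[OF that] by (auto simp: dec_def streams_iff_snth)
  have "stake k (encode (dec y)) = stake k y" if "y \<in> seqs p" for k y
    using that
  proof (induction k arbitrary: y rule: less_induct)
    case (less k)
    let ?i = "idx y"
    note i = idx[OF less.prems]
    have e: "encode (dec y) = c ?i @- encode (dec (nxt y))"
      using i dec[of y] encode_Cons[of ?i "dec (nxt y)"] by simp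
    have y: "y = c ?i @- nxt y" using i by (metis nxt_def stake_sdrop)
    have "stake (k - l ?i) (encode (dec (nxt y))) = stake (k - l ?i) (nxt y)"
    proof (cases "k = 0")
      case False
      then show ?thesis using less.IH[of "k - l ?i"] l_pos i nxt less.prems by simp
    qed simp
    then have "stake k (c ?i @- encode (dec (nxt y))) = stake k (c ?i @- nxt y)"
      using i length_c by (simp add: stake_shift)
    then show ?case using e y by simp
  qed
  then have "encode (dec y) = y" using assms stream_eq_iff_stake by blast
  then show ?thesis using dec_seqs[OF assms] by blast
qed

lemma bij_betw_encode: "bij_betw encode (seqs n) (seqs p)"
proof -
  have "encode ` seqs n = seqs p"
  proof (intro equalityI subsetI)
    fix y assume "y \<in> seqs p"
    from encode_surj[OF this] obtain \<omega> where "\<omega> \<in> seqs n" "encode \<omega> = y" ..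
    then show "y \<in> encode ` seqs n" by (intro image_eqI) simp_all
  next
    fix y assume "y \<in> encode ` seqs n"
    then show "y \<in> seqs p" by (elim imageE) (simp add: encode_in_seqs)
  qed
  then show ?thesis using inj_on_encode by (simp add: bij_betw_def)
qed

end

lemma prefix_code_of_weights:
  assumes "0 < p" "\<And>i. i < n \<Longrightarrow> 0 < l i" "(\<Sum>i<n. (1 / real p) ^ l i) = 1"
  shows "\<exists>c. prefix_code n p l c"
proof -
  from complete_prefix_code_exists[OF finite_lessThan assms(1,3)]
  obtain c where c: "\<forall>i\<in>{..<n}. c i \<in> words p (l i)"
    "\<forall>i\<in>{..<n}. \<forall>j\<in>{..<n}. \<forall>y. stake (l i) y = c i \<longrightarrow> stake (l j) y = c j \<longrightarrow> i = j"
    "\<forall>y\<in>seqs p. \<exists>i\<in>{..<n}. stake (l i) y = c i"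
    by (elim exE conjE)
  have "prefix_code n p l c"
  proof
    show "0 < l i" if "i < n" for i using assms(2)[OF that] .
    show "c i \<in> words p (l i)" if "i < n" for i using c(1) that by simp
    show "i = j" if "i < n" "j < n" "stake (l i) y = c i" "stake (l j) y = c j" for i j y
      using c(2)[rule_format, of i j y] that by simp
    fix y assume "y \<in> seqs p"
    from c(3)[rule_format, OF this] obtain i where "i \<in> {..<n}" "stake (l i) y = c i" by (elim bexE)
    then show "\<exists>i<n. stake (l i) y = c i" by (intro exI[of _ i]) simp
  qed
  then show "\<exists>c. prefix_code n p l c" by (intro exI[of _ c])
qed

section \<open>Coding dust-like sets by streams\<close>

text \<open>The metric properties of the coding map of a self-similar set with the strong separation condition: up
to the constants \<open>D\<close> and \<open>\<delta>\<close> the distance of two points is the product of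
the ratios along the common prefix of their addresses.\<close>

definition tree_coding ::
  "nat \<Rightarrow> (nat \<Rightarrow> real) \<Rightarrow> (nat stream \<Rightarrow> 'a::metric_space) \<Rightarrow> 'a set \<Rightarrow> real \<Rightarrow> real \<Rightarrow> bool" where
  "tree_coding n r \<pi> K D \<delta> \<longleftrightarrow>
     2 \<le> n \<and> (\<forall>i<n. 0 < r i \<and> r i < 1) \<and> compact K \<and> bij_betw \<pi> (seqs n) K \<and> 0 < D \<and> 0 < \<delta> \<and>
     (\<forall>\<omega>\<in>seqs n. \<forall>\<omega>'\<in>seqs n. \<forall>k. stake k \<omega> = stake k \<omega>' \<longrightarrow>
        dist (\<pi> \<omega>) (\<pi> \<omega>') \<le> D * weight r (stake k \<omega>)) \<and>
     (\<forall>\<omega>\<in>seqs n. \<forall>\<omega>'\<in>seqs n. \<forall>k. stake k \<omega> = stake k \<omega>' \<longrightarrow> \<omega> !! k \<noteq> \<omega>' !! k \<longrightarrow>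
        \<delta> * weight r (stake k \<omega>) \<le> dist (\<pi> \<omega>) (\<pi> \<omega>'))"

primrec word_map :: "(nat \<Rightarrow> 'a \<Rightarrow> 'a) \<Rightarrow> nat list \<Rightarrow> 'a \<Rightarrow> 'a" where
  "word_map \<phi> [] y = y"
| "word_map \<phi> (i # w) y = \<phi> i (word_map \<phi> w y)"

lemma word_map_append: "word_map \<phi> (v @ w) y = word_map \<phi> v (word_map \<phi> w y)"
  by (induction v) auto

lemma weight_pos_le_power:
  assumes "\<And>i. i < n \<Longrightarrow> 0 < r i \<and> r i \<le> c" "set w \<subseteq> {..<n}"
  shows "0 < weight r w \<and> weight r w \<le> c ^ length w"
  using assms(2)
proof (induction w)
  case (Cons i w)
  then have i: "0 < r i" "r i \<le> c" and w: "0 < weight r w" "weight r w \<le> c ^ length w"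
    using assms(1)[of i] by auto
  then have "r i * weight r w \<le> c * c ^ length w" by (intro mult_mono) auto
  then show ?case using i w by simp
qed simp

lemma ex_max_ratio:
  fixes r :: "nat \<Rightarrow> real"
  assumes "0 < n" "\<And>i. i < n \<Longrightarrow> 0 < r i \<and> r i < 1"
  shows "\<exists>c. 0 < c \<and> c < 1 \<and> (\<forall>i<n. r i \<le> c)"
proof -
  have "Max (r ` {..<n}) \<in> r ` {..<n}" using assms(1) by (intro Max_in) auto
  then have "0 < Max (r ` {..<n}) \<and> Max (r ` {..<n}) < 1" using assms(2) by auto
  moreover have "\<forall>i<n. r i \<le> Max (r ` {..<n})" by simp
  ultimately show ?thesis by blast
qed

lemma weight_stake_tendsto_0:
  fixes r :: "nat \<Rightarrow> real"
  assumes "0 < n" "\<And>i. i < n \<Longrightarrow> 0 < r i \<and> r i < 1" "\<omega> \<in> seqs n"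
  shows "(\<lambda>k. weight r (stake k \<omega>)) \<longlonglongrightarrow> 0"
proof -
  obtain c where c: "0 < c" "c < 1" "\<forall>i<n. r i \<le> c" using ex_max_ratio[of n r] assms(1,2) by blast
  have w: "0 < weight r (stake k \<omega>) \<and> weight r (stake k \<omega>) \<le> c ^ k" for k
    using weight_pos_le_power[of n r c "stake k \<omega>"] assms(2) c(3) set_stake[OF assms(3), of k] by auto
  show ?thesis
  proof (rule tendsto_sandwich[of "\<lambda>_. 0"])
    show "(\<lambda>k. c ^ k) \<longlonglongrightarrow> 0" using c by (intro LIMSEQ_power_zero) auto
  qed (use w in \<open>auto intro: always_eventually less_imp_le\<close>)
qed

text \<open>The point with address \<open>\<omega>\<close> is the intersection of the nested compact sets
\<open>\<phi> (\<omega> 0) (... (\<phi> (\<omega> k) K))\<close>. \<open>D\<close> bounds the diameter of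
\<open>K\<close>, and \<open>\<delta>\<close> is the least distance between two of the finitely many
disjoint compact sets \<open>\<phi> i ` K\<close>; both scale with the ratio of the common prefix.\<close>

theorem dust_like_tree_coding:
  fixes K :: "'a::heine_borel set"
  assumes dl: "dust_like_ifs n r \<phi> K"
  shows "\<exists>\<pi> D \<delta>. tree_coding n r \<pi> K D \<delta>"
proof -
  have n2: "2 \<le> n" and sim: "\<And>i. i < n \<Longrightarrow> contractive_similitude (r i) (\<phi> i)"
    and K: "K \<noteq> {}" "compact K" and Keq: "K = (\<Union>i<n. \<phi> i ` K)"
    and disj: "disjoint_family_on (\<lambda>i. \<phi> i ` K) {..<n}"
    using dl unfolding dust_like_ifs_def self_similar_ifs_def by blast+
  have r: "0 < r i \<and> r i < 1" if "i < n" for i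
    using sim[OF that] by (simp add: contractive_similitude_def)
  have dist_\<phi>: "dist (\<phi> i x) (\<phi> i y) = r i * dist x y" if "i < n" for i x y
    using sim[OF that] by (simp add: contractive_similitude_def)
  have \<phi>K: "\<phi> i y \<in> K" if "i < n" "y \<in> K" for i y
    using that by (subst Keq) blast
  have dist_word: "dist (word_map \<phi> w x) (word_map \<phi> w y) = weight r w * dist x y"
    if "set w \<subseteq> {..<n}" for w x y
    using that by (induction w) (simp_all add: dist_\<phi>)
  have wpos: "0 < weight r (stake k \<omega>)" if "\<omega> \<in> seqs n" for k \<omega>
    using weight_pos_le_power[of n r 1 "stake k \<omega>"] r set_stake[OF that, of k] less_imp_le by blast
  have wordK: "word_map \<phi> w y \<in> K" if "set w \<subseteq> {..<n}" "y \<in> K" for w y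
    using that by (induction w) (simp_all add: \<phi>K)
  obtain e where e: "\<forall>x\<in>K. \<forall>y\<in>K. dist x y \<le> e"
    using compact_imp_bounded[OF K(2)] by (auto simp: bounded_two_points)
  define D where "D = max e 1"
  have D: "0 < D" "\<And>x y. x \<in> K \<Longrightarrow> y \<in> K \<Longrightarrow> dist x y \<le> D"
    using e by (force simp: D_def)+
  have cont: "continuous_on K (\<phi> i)" if "i < n" for i
  proof (rule lipschitz_on_continuous_on)
    show "(r i)-lipschitz_on K (\<phi> i)"
      using r[OF that] dist_\<phi>[OF that] by (intro lipschitz_onI) auto
  qed
  have cK: "compact (\<phi> i ` K)" if "i < n" for i
    using compact_continuous_image[OF cont[OF that] K(2)] .
  have "\<exists>d>0. \<forall>x\<in>\<phi> i ` K. \<forall>y\<in>\<phi> j ` K. d \<le> dist x y" if "i < n" "j < n" "i \<noteq> j" for i j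
  proof -
    have "\<phi> i ` K \<inter> \<phi> j ` K = {}" using disj that by (auto simp: disjoint_family_on_def)
    then show ?thesis
      using separate_compact_closed[OF cK[OF that(1)] compact_imp_closed[OF cK[OF that(2)]]] by blast
  qed
  then obtain d where d: "\<And>i j. i < n \<Longrightarrow> j < n \<Longrightarrow> i \<noteq> j \<Longrightarrow>
      0 < d i j \<and> (\<forall>x\<in>\<phi> i ` K. \<forall>y\<in>\<phi> j ` K. d i j \<le> dist x y)"
    by metis
  define S where "S = {(i, j). i < n \<and> j < n \<and> i \<noteq> j}"
  have S: "finite S" "(0, 1) \<in> S"
    using n2 by (auto simp: S_def intro: finite_subset[of _ "{..<n} \<times> {..<n}"])
  define \<delta> where "\<delta> = Min ((\<lambda>(i, j). d i j) ` S)"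
  have "\<delta> \<in> (\<lambda>(i, j). d i j) ` S" unfolding \<delta>_def using S by (intro Min_in) auto
  then have \<delta>0: "0 < \<delta>" using d by (auto simp: S_def)
  have \<delta>: "\<delta> \<le> dist (\<phi> i x) (\<phi> j y)" if "i < n" "j < n" "i \<noteq> j" "x \<in> K" "y \<in> K" for i j x y
  proof -
    have "\<delta> \<le> d i j" unfolding \<delta>_def using S that(1-3) by (intro Min_le) (auto simp: S_def image_iff)
    also have "\<dots> \<le> dist (\<phi> i x) (\<phi> j y)" using d[OF that(1-3)] that(4,5) by blast
    finally show ?thesis .
  qed
  have ex: "\<exists>y. \<forall>k. y \<in> word_map \<phi> (stake k \<omega>) ` K" if \<omega>: "\<omega> \<in> seqs n" for \<omega>
  proof -
    have "\<Inter>(range (\<lambda>k. word_map \<phi> (stake k \<omega>) ` K)) \<noteq> {}"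
    proof (rule compact_nest)
      fix k
      have "continuous_on K (word_map \<phi> (stake k \<omega>))"
      proof (rule lipschitz_on_continuous_on)
        have "0 < weight r (stake k \<omega>)"
          by (rule wpos[OF \<omega>])
        then show "(weight r (stake k \<omega>))-lipschitz_on K (word_map \<phi> (stake k \<omega>))"
          using dist_word[OF set_stake[OF \<omega>]] by (intro lipschitz_onI) auto
      qed
      then show "compact (word_map \<phi> (stake k \<omega>) ` K)" using K(2) by (rule compact_continuous_image)
      show "word_map \<phi> (stake k \<omega>) ` K \<noteq> {}" using K(1) by simp
      fix l assume "k \<le> (l :: nat)"
      then have "stake l \<omega> = stake k \<omega> @ stake (l - k) (sdrop k \<omega>)" by simp
      then show "word_map \<phi> (stake l \<omega>) ` K \<subseteq> word_map \<phi> (stake k \<omega>) ` K"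
        using wordK[OF set_stake[OF sdrop_in_seqs[OF \<omega>]]] by (auto simp only: word_map_append)
    qed
    then show ?thesis by auto
  qed
  define \<pi> where "\<pi> \<omega> = (SOME y. \<forall>k. y \<in> word_map \<phi> (stake k \<omega>) ` K)" for \<omega>
  have \<pi>: "\<pi> \<omega> \<in> word_map \<phi> (stake k \<omega>) ` K" if "\<omega> \<in> seqs n" for \<omega> k
    unfolding \<pi>_def using someI_ex[OF ex[OF that]] by blast
  have \<pi>K: "\<pi> \<omega> \<in> K" if "\<omega> \<in> seqs n" for \<omega>
    using \<pi>[OF that, of 0] by simp
  have uniq: "y = \<pi> \<omega>" if \<omega>: "\<omega> \<in> seqs n" and y: "\<And>k. y \<in> word_map \<phi> (stake k \<omega>) ` K" for y \<omega>
  proof -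
    have "dist y (\<pi> \<omega>) \<le> weight r (stake k \<omega>) * D" for k
    proof -
      obtain a b where ab: "a \<in> K" "b \<in> K" "y = word_map \<phi> (stake k \<omega>) a" "\<pi> \<omega> = word_map \<phi> (stake k \<omega>) b"
        using y[of k] \<pi>[OF \<omega>, of k] by blast
      have "0 < weight r (stake k \<omega>)"
        by (rule wpos[OF \<omega>])
      then show ?thesis
        using D(2)[OF ab(1,2)] by (simp add: ab(3,4) dist_word set_stake[OF \<omega>])
    qed
    moreover have "(\<lambda>k. weight r (stake k \<omega>) * D) \<longlonglongrightarrow> 0"
      using tendsto_mult_right[OF weight_stake_tendsto_0[of n r \<omega>], of D] n2 r \<omega> by simp
    ultimately have "dist y (\<pi> \<omega>) \<le> 0" by (intro LIMSEQ_le_const) auto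
    then show ?thesis by simp
  qed
  have \<pi>_Cons: "\<pi> (i ## \<omega>) = \<phi> i (\<pi> \<omega>)" if "i < n" "\<omega> \<in> seqs n" for i \<omega>
  proof (rule uniq[symmetric])
    show "i ## \<omega> \<in> seqs n" using that by (simp add: streams_Stream)
    fix k
    show "\<phi> i (\<pi> \<omega>) \<in> word_map \<phi> (stake k (i ## \<omega>)) ` K"
      using \<phi>K[OF that(1) \<pi>K[OF that(2)]] \<pi>[OF that(2), of "k - 1"] by (cases k) auto
  qed
  have \<pi>_shift: "\<pi> (u @- \<omega>) = word_map \<phi> u (\<pi> \<omega>)" if "set u \<subseteq> {..<n}" "\<omega> \<in> seqs n" for u \<omega>
    using that by (induction u) (simp_all add: \<pi>_Cons shift_in_seqs_iff)
  have \<pi>_split: "\<pi> \<omega> = word_map \<phi> (stake k \<omega>) (\<pi> (sdrop k \<omega>))" if "\<omega> \<in> seqs n" for \<omega> k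
    using \<pi>_shift[OF set_stake[OF that] sdrop_in_seqs[OF that], of k k] by (simp add: stake_sdrop)
  have upper: "dist (\<pi> \<omega>) (\<pi> \<omega>') \<le> D * weight r (stake k \<omega>)"
    if "\<omega> \<in> seqs n" "\<omega>' \<in> seqs n" "stake k \<omega> = stake k \<omega>'" for \<omega> \<omega>' k
  proof -
    have "0 < weight r (stake k \<omega>)"
      by (rule wpos[OF that(1)])
    moreover have "dist (\<pi> \<omega>) (\<pi> \<omega>') = weight r (stake k \<omega>) * dist (\<pi> (sdrop k \<omega>)) (\<pi> (sdrop k \<omega>'))"
      unfolding \<pi>_split[OF that(1), of k] \<pi>_split[OF that(2), of k] that(3)[symmetric]
      by (rule dist_word[OF set_stake[OF that(1)]])
    ultimately show ?thesis
      using D(2)[OF \<pi>K \<pi>K, OF sdrop_in_seqs[OF that(1)] sdrop_in_seqs[OF that(2)], of k k]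
      by (simp add: mult.commute)
  qed
  have lower: "\<delta> * weight r (stake k \<omega>) \<le> dist (\<pi> \<omega>) (\<pi> \<omega>')"
    if "\<omega> \<in> seqs n" "\<omega>' \<in> seqs n" "stake k \<omega> = stake k \<omega>'" "\<omega> !! k \<noteq> \<omega>' !! k" for \<omega> \<omega>' k
  proof -
    have dec: "\<pi> (sdrop k \<eta>) = \<phi> (\<eta> !! k) (\<pi> (sdrop (Suc k) \<eta>)) \<and> \<eta> !! k < n \<and> \<pi> (sdrop (Suc k) \<eta>) \<in> K"
      if "\<eta> \<in> seqs n" for \<eta>
    proof -
      have "sdrop k \<eta> = \<eta> !! k ## sdrop (Suc k) \<eta>"
        using stream.collapse[of "sdrop k \<eta>"] by (simp only: sdrop_simps)
      moreover have lt: "\<eta> !! k < n" using that by (auto simp: streams_iff_snth)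
      moreover note \<pi>_Cons[OF lt sdrop_in_seqs[OF that], of "Suc k"] \<pi>K[OF sdrop_in_seqs[OF that], of "Suc k"]
      ultimately show ?thesis by (simp only: simp_thms)
    qed
    have "0 < weight r (stake k \<omega>)"
      by (rule wpos[OF that(1)])
    moreover have "dist (\<pi> \<omega>) (\<pi> \<omega>') = weight r (stake k \<omega>) * dist (\<pi> (sdrop k \<omega>)) (\<pi> (sdrop k \<omega>'))"
      unfolding \<pi>_split[OF that(1), of k] \<pi>_split[OF that(2), of k] that(3)[symmetric]
      by (rule dist_word[OF set_stake[OF that(1)]])
    moreover have "\<delta> \<le> dist (\<pi> (sdrop k \<omega>)) (\<pi> (sdrop k \<omega>'))"
      using dec[OF that(1)] dec[OF that(2)] \<delta> that(4) by simp
    ultimately show ?thesis by (simp add: mult.commute)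
  qed
  have inj: "inj_on \<pi> (seqs n)"
  proof (rule inj_onI, rule ccontr)
    fix \<omega> \<omega>' assume \<omega>: "\<omega> \<in> seqs n" "\<omega>' \<in> seqs n" "\<pi> \<omega> = \<pi> \<omega>'" "\<omega> \<noteq> \<omega>'"
    obtain l where "stake l \<omega> \<noteq> stake l \<omega>'" using \<omega>(4) stream_eq_iff_stake[of \<omega> \<omega>'] by blast
    from ex_first_difference[OF this] obtain k
      where k: "stake k \<omega> = stake k \<omega>'" "\<omega> !! k \<noteq> \<omega>' !! k" by blast
    from lower[OF \<omega>(1,2) k] have "\<delta> * weight r (stake k \<omega>) \<le> 0" using \<omega>(3) by simp
    moreover have "0 < weight r (stake k \<omega>)"
      by (rule wpos[OF \<omega>(1)])
    ultimately show False using \<delta>0 by (simp add: mult_le_0_iff)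
  qed
  have surj: "\<exists>\<omega>\<in>seqs n. \<pi> \<omega> = y" if "y \<in> K" for y
  proof -
    have "\<exists>i z. i < n \<and> z \<in> K \<and> y = \<phi> i z" if "y \<in> K" for y using that by (subst (asm) Keq) blast
    then obtain idx nxt where step: "\<And>y. y \<in> K \<Longrightarrow> idx y < n \<and> nxt y \<in> K \<and> y = \<phi> (idx y) (nxt y)" by metis
    have iter: "(nxt ^^ k) y \<in> K" for k using that step by (induction k) auto
    define \<omega> where "\<omega> = smap idx (siterate nxt y)"
    have \<omega>: "\<omega> \<in> seqs n" using step[OF iter] by (auto simp: \<omega>_def streams_iff_snth)
    have "y = word_map \<phi> (stake k \<omega>) ((nxt ^^ k) y)" for k
    proof (induction k)
      case (Suc k)
      have "(nxt ^^ k) y = \<phi> (\<omega> !! k) ((nxt ^^ Suc k) y)" using step[OF iter[of k]] by (simp add: \<omega>_def)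
      then show ?case using Suc by (simp add: stake_Suc word_map_append del: stake.simps)
    qed simp
    then have "y \<in> word_map \<phi> (stake k \<omega>) ` K" for k using iter by blast
    then show ?thesis using uniq[OF \<omega>] \<omega> by blast
  qed
  have "bij_betw \<pi> (seqs n) K"
    unfolding bij_betw_def using inj \<pi>K surj by blast
  then have "tree_coding n r \<pi> K D \<delta>"
    unfolding tree_coding_def using n2 r K(2) D(1) \<delta>0 upper lower by blast
  then show ?thesis by blast
qed

section \<open>Hausdorff measure and dimension of coded sets\<close>

lemma diameter_le_of_dist:
  fixes S :: "'a::metric_space set"
  assumes "0 \<le> d" "\<And>x y. x \<in> S \<Longrightarrow> y \<in> S \<Longrightarrow> dist x y \<le> d"
  shows "bounded S" "diameter S \<le> d"
proof -
  show "bounded S" using assms(2) by (auto simp: bounded_two_points)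
  show "diameter S \<le> d"
  proof (cases "S = {}")
    case False
    then show ?thesis unfolding diameter_def using assms(2) by (auto intro!: cSUP_least)
  qed (use assms(1) in simp)
qed

lemma premeasure_finite_cover:
  fixes A :: "'a::metric_space set"
  assumes "finite W" "\<And>w. w \<in> W \<Longrightarrow> bounded (V w) \<and> diameter (V w) \<le> \<epsilon>"
    and "A \<subseteq> (\<Union>w\<in>W. V w)" "0 \<le> \<epsilon>"
  shows "hausdorff_premeasure \<epsilon> s A \<le> (\<Sum>w\<in>W. diam_weight s (V w))"
proof -
  obtain b where b: "bij_betw b {..<card W} W"
    using ex_bij_betw_nat_finite[OF assms(1)] atLeast0LessThan by metis
  define U where "U i = (if i < card W then V (b i) else {})" for i
  have bW: "b i \<in> W" if "i < card W" for i using bij_betwE[OF b] that by auto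
  have "A \<subseteq> (\<Union>i. U i)"
  proof
    fix y assume "y \<in> A"
    then obtain w where w: "w \<in> W" "y \<in> V w" using assms(3) by blast
    then obtain i where "i < card W" "w = b i" using b by (auto simp: bij_betw_def)
    then have "y \<in> U i" using w by (simp add: U_def)
    then show "y \<in> (\<Union>i. U i)" by blast
  qed
  moreover have "\<forall>i. bounded (U i) \<and> diameter (U i) \<le> \<epsilon>"
    using assms(2,4) bW by (auto simp: U_def)
  ultimately have "hausdorff_premeasure \<epsilon> s A \<le> (\<Sum>i. diam_weight s (U i))"
    unfolding hausdorff_premeasure_def by (intro INF_lower) simp
  also have "\<dots> = (\<Sum>i<card W. diam_weight s (U i))"
    by (intro suminf_finite) (auto simp: U_def diam_weight_def)
  also have "\<dots> = (\<Sum>i<card W. diam_weight s (V (b i)))" by (simp add: U_def)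
  also have "\<dots> = (\<Sum>w\<in>W. diam_weight s (V w))" by (rule sum.reindex_bij_betw[OF b])
  finally show ?thesis .
qed

lemma weight_powr:
  assumes "\<And>i. i < n \<Longrightarrow> 0 < r i" "set w \<subseteq> {..<n}"
  shows "weight (\<lambda>i. r i powr s) w = weight r w powr s"
  using assms(2)
proof (induction w)
  case (Cons i w)
  have "0 \<le> weight r w" if "set w \<subseteq> {..<n}" for w
    using that by (induction w) (auto intro!: mult_nonneg_nonneg less_imp_le[OF assms(1)])
  then show ?case using Cons assms(1)[of i] by (simp add: powr_mult)
qed simp

lemma tree_codingD:
  assumes "tree_coding n r \<pi> K D \<delta>"
  shows "2 \<le> n" "\<And>i. i < n \<Longrightarrow> 0 < r i \<and> r i < 1" "compact K" "bij_betw \<pi> (seqs n) K" "0 < D" "0 < \<delta>"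
    "\<And>\<omega> \<omega>' k. \<omega> \<in> seqs n \<Longrightarrow> \<omega>' \<in> seqs n \<Longrightarrow> stake k \<omega> = stake k \<omega>' \<Longrightarrow>
        dist (\<pi> \<omega>) (\<pi> \<omega>') \<le> D * weight r (stake k \<omega>)"
    "\<And>\<omega> \<omega>' k. \<omega> \<in> seqs n \<Longrightarrow> \<omega>' \<in> seqs n \<Longrightarrow> stake k \<omega> = stake k \<omega>' \<Longrightarrow> \<omega> !! k \<noteq> \<omega>' !! k \<Longrightarrow>
        \<delta> * weight r (stake k \<omega>) \<le> dist (\<pi> \<omega>) (\<pi> \<omega>')"
proof -
  note c1 = assms[unfolded tree_coding_def]
  note c2 = c1[THEN conjunct2] note c3 = c2[THEN conjunct2] note c4 = c3[THEN conjunct2]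
  note c5 = c4[THEN conjunct2] note c6 = c5[THEN conjunct2] note c7 = c6[THEN conjunct2]
  note up = c7[THEN conjunct1] and lo = c7[THEN conjunct2]
  show "2 \<le> n" by (rule c1[THEN conjunct1])
  show "\<And>i. i < n \<Longrightarrow> 0 < r i \<and> r i < 1" by (rule c2[THEN conjunct1, rule_format])
  show "compact K" by (rule c3[THEN conjunct1])
  show "bij_betw \<pi> (seqs n) K" by (rule c4[THEN conjunct1])
  show "0 < D" by (rule c5[THEN conjunct1])
  show "0 < \<delta>" by (rule c6[THEN conjunct1])
  show "dist (\<pi> \<omega>) (\<pi> \<omega>') \<le> D * weight r (stake k \<omega>)"
    if "\<omega> \<in> seqs n" "\<omega>' \<in> seqs n" "stake k \<omega> = stake k \<omega>'" for \<omega> \<omega>' k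
    using up[rule_format, OF that] .
  show "\<delta> * weight r (stake k \<omega>) \<le> dist (\<pi> \<omega>) (\<pi> \<omega>')"
    if "\<omega> \<in> seqs n" "\<omega>' \<in> seqs n" "stake k \<omega> = stake k \<omega>'" "\<omega> !! k \<noteq> \<omega>' !! k" for \<omega> \<omega>' k
    using lo[rule_format, OF that] .
qed

lemma tree_coding_weight:
  assumes "tree_coding n r \<pi> K D \<delta>" "set w \<subseteq> {..<n}"
  shows "0 < weight r w" "weight r w \<le> 1"
proof -
  have "0 < r i \<and> r i \<le> 1" if "i < n" for i using tree_codingD(2)[OF assms(1) that] by simp
  from weight_pos_le_power[of n r 1 w, OF this assms(2)]
  show "0 < weight r w" "weight r w \<le> 1" by auto
qed

text \<open>The images of the cylinders of level \<open>k\<close> that meet \<open>B\<close> are admissible covers.\<close>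

lemma hausdorff_measure_eq_0:
  assumes tc: "tree_coding n r \<pi> K D \<delta>" and B: "B \<subseteq> seqs n" and t: "0 < t"
    and small: "(\<lambda>k. \<Sum>w\<in>stake k ` B. weight r w powr t) \<longlonglongrightarrow> 0"
  shows "hausdorff_measure t (\<pi> ` B) = 0"
proof -
  note T = tree_codingD[OF tc]
  obtain c where c: "0 < c" "c < 1" "\<forall>i<n. r i \<le> c" using ex_max_ratio[of n r] T(1,2) by auto
  have finB: "finite (stake k ` B)" for k
    by (rule finite_subset[OF _ finite_words[of n k]]) (use B in \<open>auto intro: stake_in_words\<close>)
  have bound: "hausdorff_premeasure \<epsilon> t (\<pi> ` B) \<le> 0 + ennreal e" if "0 < \<epsilon>" "0 < e" for \<epsilon> e
  proof -
    have "(\<lambda>k. D * c ^ k) \<longlonglongrightarrow> D * 0" using c by (intro tendsto_mult_left LIMSEQ_power_zero) auto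
    then have "eventually (\<lambda>k. D * c ^ k < \<epsilon>) sequentially" using that by (intro order_tendstoD) auto
    moreover have "eventually (\<lambda>k. (\<Sum>w\<in>stake k ` B. weight r w powr t) < e / D powr t) sequentially"
      using that(2) T(5) by (intro order_tendstoD(2)[OF small]) simp
    ultimately have "eventually (\<lambda>k. D * c ^ k < \<epsilon> \<and> (\<Sum>w\<in>stake k ` B. weight r w powr t) < e / D powr t) sequentially"
      by (rule eventually_conj)
    then obtain k where k: "D * c ^ k < \<epsilon>" "(\<Sum>w\<in>stake k ` B. weight r w powr t) < e / D powr t"
      by (auto simp: eventually_sequentially)
    define V where "V w = \<pi> ` {\<omega>\<in>B. stake k \<omega> = w}" for w
    have wB: "set w \<subseteq> {..<n} \<and> length w = k" if "w \<in> stake k ` B" for w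
    proof -
      from that obtain \<omega> where "\<omega> \<in> B" "w = stake k \<omega>" by blast
      then show ?thesis using B set_stake[of \<omega> n k] by auto
    qed
    have V: "bounded (V w) \<and> diameter (V w) \<le> D * weight r w" if w: "w \<in> stake k ` B" for w
    proof -
      have "0 \<le> D * weight r w" using tree_coding_weight(1)[OF tc, of w] wB[OF w] T(5) by simp
      moreover have "dist x y \<le> D * weight r w" if "x \<in> V w" "y \<in> V w" for x y
      proof -
        from that obtain \<omega> \<omega>' where "\<omega> \<in> B" "\<omega>' \<in> B" "stake k \<omega> = w" "stake k \<omega>' = w" "x = \<pi> \<omega>" "y = \<pi> \<omega>'"
          by (auto simp: V_def)
        then show ?thesis using T(7)[of \<omega> \<omega>' k] B by auto
      qed
      ultimately show ?thesis using diameter_le_of_dist[of "D * weight r w" "V w"] by blast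
    qed
    have small_diam: "D * weight r w \<le> \<epsilon>" if "w \<in> stake k ` B" for w
    proof -
      have "weight r w \<le> c ^ k"
        using weight_pos_le_power[of n r c w] c(3) T(2) wB[OF that] by auto
      then have "D * weight r w \<le> D * c ^ k" using T(5) by simp
      then show ?thesis using k(1) by linarith
    qed
    have "hausdorff_premeasure \<epsilon> t (\<pi> ` B) \<le> (\<Sum>w\<in>stake k ` B. diam_weight t (V w))"
    proof (rule premeasure_finite_cover[OF finB])
      show "bounded (V w) \<and> diameter (V w) \<le> \<epsilon>" if "w \<in> stake k ` B" for w
        using V[OF that] small_diam[OF that] by linarith
      show "\<pi> ` B \<subseteq> (\<Union>w\<in>stake k ` B. V w)" by (auto simp: V_def)
    qed (use that in simp)
    also have "\<dots> \<le> (\<Sum>w\<in>stake k ` B. ennreal ((D * weight r w) powr t))"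
    proof (rule sum_mono)
      fix w assume w: "w \<in> stake k ` B"
      have "diameter (V w) powr t \<le> (D * weight r w) powr t"
        using V[OF w] t by (intro powr_mono2 diameter_ge_0) auto
      then show "diam_weight t (V w) \<le> ennreal ((D * weight r w) powr t)"
        using t by (auto simp: diam_weight_def intro: ennreal_leI)
    qed
    also have "\<dots> = ennreal (\<Sum>w\<in>stake k ` B. (D * weight r w) powr t)" by (rule sum_ennreal) simp
    also have "(\<Sum>w\<in>stake k ` B. (D * weight r w) powr t) = D powr t * (\<Sum>w\<in>stake k ` B. weight r w powr t)"
      unfolding sum_distrib_left
    proof (rule sum.cong[OF refl])
      fix w assume "w \<in> stake k ` B"
      then have "0 < weight r w" using tree_coding_weight(1)[OF tc, of w] wB by blast
      then show "(D * weight r w) powr t = D powr t * weight r w powr t" using T(5) by (simp add: powr_mult)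
    qed
    also have "\<dots> \<le> e" using k(2) T(5) by (simp add: field_simps)
    finally show ?thesis by (simp add: ennreal_leI)
  qed
  have "hausdorff_premeasure \<epsilon> t (\<pi> ` B) \<le> 0" if "0 < \<epsilon>" for \<epsilon>
    by (rule ennreal_le_epsilon, rule bound[OF that])
  then have "hausdorff_measure t (\<pi> ` B) \<le> 0"
    unfolding hausdorff_measure_def by (intro SUP_least) simp
  then show ?thesis by simp
qed

text \<open>The content is subadditive and the whole space has content 1.\<close>

lemma finite_cylinder_cover_weight:
  assumes "prob_vector n x" "finite W" "\<And>w. w \<in> W \<Longrightarrow> set w \<subseteq> {..<n}"
    and cover: "\<And>\<omega>. \<omega> \<in> seqs n \<Longrightarrow> \<exists>w\<in>W. stake (length w) \<omega> = w"
  shows "1 \<le> (\<Sum>w\<in>W. weight x w)"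
proof -
  interpret prob_vector n x by fact
  have all: "stream_content x (seqs n) = 1"
  proof (rule stream_content_eq_1)
    show "words n k \<subseteq> stake k ` seqs n" for k
    proof
      fix w assume w: "w \<in> words n k"
      then have "w @- sconst 0 \<in> seqs n"
        using zeros_in_seqs by (auto simp: shift_in_seqs_iff words_def)
      moreover have "stake k (w @- sconst 0) = w" using w by (simp add: stake_shift words_def)
      ultimately show "w \<in> stake k ` seqs n" by (metis image_eqI)
    qed
  qed simp
  have "seqs n \<subseteq> (\<Union>w\<in>W. (@-) w ` seqs n)"
  proof
    fix \<omega> assume \<omega>: "\<omega> \<in> seqs n"
    then obtain w where w: "w \<in> W" "stake (length w) \<omega> = w" using cover by blast
    then have "\<omega> = w @- sdrop (length w) \<omega>" by (metis stake_sdrop)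
    then show "\<omega> \<in> (\<Union>w\<in>W. (@-) w ` seqs n)" using w(1) sdrop_in_seqs[OF \<omega>] by blast
  qed
  moreover have sub: "(@-) w ` seqs n \<subseteq> seqs n" if "w \<in> W" for w
    using assms(3)[OF that] by (auto simp only: shift_in_seqs_iff)
  ultimately have "(\<Union>w\<in>W. (@-) w ` seqs n) = seqs n" by blast
  then have "1 \<le> (\<Sum>w\<in>W. stream_content x ((@-) w ` seqs n))"
    using stream_content_UN_le[of W "\<lambda>w. (@-) w ` seqs n", OF assms(2) sub] all by simp
  also have "\<dots> = (\<Sum>w\<in>W. weight x w)"
    using assms(3) all by (intro sum.cong) (simp_all add: stream_content_shift)
  finally show ?thesis .
qed

text \<open>The contrapositive of the lower distance bound at the first difference of the addresses.\<close>

lemma tree_coding_separation: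
  assumes tc: "tree_coding n r \<pi> K D \<delta>" and \<omega>: "\<omega> \<in> seqs n" "\<omega>' \<in> seqs n"
    and close: "dist (\<pi> \<omega>) (\<pi> \<omega>') < \<delta> * weight r (stake k \<omega>)"
  shows "stake (Suc k) \<omega> = stake (Suc k) \<omega>'"
proof (rule ccontr)
  note T = tree_codingD[OF tc]
  assume "stake (Suc k) \<omega> \<noteq> stake (Suc k) \<omega>'"
  from ex_first_difference[OF this] obtain j where jk: "j \<le> k"
    and eq: "stake j \<omega> = stake j \<omega>'" and ne: "\<omega> !! j \<noteq> \<omega>' !! j"
    by (auto simp: less_Suc_eq_le)
  from T(8)[OF \<omega> eq ne] have "\<delta> * weight r (stake j \<omega>) \<le> dist (\<pi> \<omega>) (\<pi> \<omega>')" .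
  moreover have "weight r (stake k \<omega>) \<le> weight r (stake j \<omega>)"
  proof -
    have "stake k \<omega> = stake j \<omega> @ stake (k - j) (sdrop j \<omega>)" using jk by simp
    then have "weight r (stake k \<omega>) = weight r (stake j \<omega>) * weight r (stake (k - j) (sdrop j \<omega>))"
      by (simp only: weight_simps)
    also have "\<dots> \<le> weight r (stake j \<omega>) * 1"
      using tree_coding_weight[OF tc set_stake[OF \<omega>(1)], of j]
        tree_coding_weight[OF tc set_stake[OF sdrop_in_seqs[OF \<omega>(1)]], of "k - j" j]
      by (intro mult_left_mono) auto
    finally show ?thesis by simp
  qed
  ultimately show False using close T(6) by (smt (verit) mult_left_mono)
qed

text \<open>The part of \<open>K\<close> in a covering set \<open>U i\<close> lies in a cylinder \<open>w i\<close>
of comparable size, so a cover with small Hausdorff sum gives a cover by cylinders with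
\<open>(\<Sum>i. weight r (w i) powr t) < 1\<close>. The cylinders are separated from the rest of
\<open>K\<close>, so compactness leaves finitely many, which contradicts the bound for finite covers by
cylinders. If \<open>U i\<close> has diameter 0, arbitrarily small cylinders will do; the choice
\<open>weight r (w i) powr t \<le> \<epsilon> * (1/2) ^ (i + 1)\<close> lets them contribute at most
\<open>\<epsilon>\<close> altogether.\<close>

lemma hausdorff_measure_neq_0:
  assumes tc: "tree_coding n r \<pi> K D \<delta>" and p: "prob_vector n (\<lambda>i. r i powr s)" and t: "0 < t" "t \<le> s"
  shows "hausdorff_measure t K \<noteq> 0"
proof
  note T = tree_codingD[OF tc]
  assume "hausdorff_measure t K = 0"
  then have pre: "hausdorff_premeasure 1 t K = 0"
    unfolding hausdorff_measure_def by (metis SUP_upper greaterThan_iff le_zero_eq zero_less_one)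
  (* chosen such that the cylinders w i have total weight at most \<epsilon> / \<delta> powr t + \<epsilon> = 1/2 *)
  define \<epsilon> where "\<epsilon> = 1 / (2 * (1 + 1 / \<delta> powr t))"
  have \<delta>t: "0 < \<delta> powr t" using T(6) by simp
  have \<epsilon>: "0 < \<epsilon>" unfolding \<epsilon>_def using \<delta>t by (intro divide_pos_pos mult_pos_pos add_pos_pos) auto
  have \<epsilon>_small: "\<epsilon> / \<delta> powr t + \<epsilon> = 1/2"
  proof -
    have "\<epsilon> / \<delta> powr t + \<epsilon> = \<epsilon> * (1 + 1 / \<delta> powr t)" by (simp add: algebra_simps)
    also have "\<dots> = 1/2" using \<delta>t by (simp add: \<epsilon>_def add_pos_pos less_imp_neq[symmetric] field_simps)
    finally show ?thesis .
  qed
  have "hausdorff_premeasure 1 t K < ennreal \<epsilon>" using pre \<epsilon> by simp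
  then obtain U :: "nat \<Rightarrow> 'a set" where U: "K \<subseteq> (\<Union>i. U i)" "\<And>i. bounded (U i)"
    and sumU: "(\<Sum>i. diam_weight t (U i)) < ennreal \<epsilon>"
    unfolding hausdorff_premeasure_def INF_less_iff by auto
  define I where "I = {i. U i \<inter> K \<noteq> {}}"
  have "\<exists>w. set w \<subseteq> {..<n} \<and> (\<forall>\<omega>\<in>seqs n. \<pi> \<omega> \<in> U i \<longrightarrow> stake (length w) \<omega> = w) \<and>
      weight r w powr t \<le> diameter (U i) powr t / \<delta> powr t + \<epsilon> * (1/2) ^ Suc i" if i: "i \<in> I" for i
  proof -
    obtain \<omega>0 where \<omega>0: "\<omega>0 \<in> seqs n" "\<pi> \<omega>0 \<in> U i"
      using i T(4) by (auto simp: I_def bij_betw_def)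
    define d where "d = diameter (U i)"
    have d: "dist (\<pi> \<omega>0) (\<pi> \<omega>) \<le> d" if "\<pi> \<omega> \<in> U i" for \<omega>
      unfolding d_def using diameter_bounded_bound[OF U(2) \<omega>0(2) that] .
    have d0: "0 \<le> d" using d[OF \<omega>0(2)] by simp
    have lim: "(\<lambda>k. weight r (stake k \<omega>0)) \<longlonglongrightarrow> 0"
      using T(1,2) \<omega>0(1) by (intro weight_stake_tendsto_0[of n]) auto
    show ?thesis
    proof (cases "d = 0")
      case True
      have e: "0 < (\<epsilon> * (1/2) ^ Suc i) powr (1 / t)" using \<epsilon> by simp
      have "eventually (\<lambda>k. weight r (stake k \<omega>0) < (\<epsilon> * (1/2) ^ Suc i) powr (1 / t)) sequentially"
        using lim e by (rule order_tendstoD(2))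
      then obtain k where k: "weight r (stake k \<omega>0) < (\<epsilon> * (1/2) ^ Suc i) powr (1 / t)"
        by (auto simp: eventually_sequentially)
      have "weight r (stake k \<omega>0) powr t \<le> ((\<epsilon> * (1/2) ^ Suc i) powr (1 / t)) powr t"
        using k t(1) less_imp_le[OF tree_coding_weight(1)[OF tc set_stake[OF \<omega>0(1)]]]
        by (intro powr_mono2) auto
      also have "\<dots> = \<epsilon> * (1/2) ^ Suc i" using t(1) \<epsilon> by (simp add: powr_powr)
      finally have "weight r (stake k \<omega>0) powr t \<le> diameter (U i) powr t / \<delta> powr t + \<epsilon> * (1/2) ^ Suc i"
        using \<delta>t by (simp add: add_increasing)
      moreover have "stake k \<omega> = stake k \<omega>0" if "\<omega> \<in> seqs n" "\<pi> \<omega> \<in> U i" for \<omega>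
      proof -
        have "\<pi> \<omega>0 = \<pi> \<omega>" using d[OF that(2)] True by simp
        then have "\<omega>0 = \<omega>" using T(4) \<omega>0(1) that(1) by (auto simp: bij_betw_def dest: inj_onD)
        then show ?thesis by simp
      qed
      ultimately show ?thesis using set_stake[OF \<omega>0(1), of k] by (intro exI[of _ "stake k \<omega>0"]) auto
    next
      case False
      then have "0 < d / \<delta>" using d0 T(6) by simp
      then have "eventually (\<lambda>k. weight r (stake k \<omega>0) < d / \<delta>) sequentially"
        by (intro order_tendstoD(2)[OF lim])
      then have ex: "\<exists>k. \<delta> * weight r (stake k \<omega>0) \<le> d"
        using T(6) by (auto simp: eventually_sequentially field_simps intro: less_imp_le)
      define k where "k = (LEAST k. \<delta> * weight r (stake k \<omega>0) \<le> d)"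
      have k: "\<delta> * weight r (stake k \<omega>0) \<le> d" unfolding k_def using ex by (rule LeastI_ex)
      have "stake k \<omega> = stake k \<omega>0" if "\<omega> \<in> seqs n" "\<pi> \<omega> \<in> U i" for \<omega>
      proof (cases k)
        case (Suc k')
        have "\<not> \<delta> * weight r (stake k' \<omega>0) \<le> d"
          using not_less_Least[of k' "\<lambda>k. \<delta> * weight r (stake k \<omega>0) \<le> d"] Suc by (simp add: k_def[symmetric])
        then have "dist (\<pi> \<omega>0) (\<pi> \<omega>) < \<delta> * weight r (stake k' \<omega>0)" using d[OF that(2)] by linarith
        from tree_coding_separation[OF tc \<omega>0(1) that(1) this] show ?thesis unfolding Suc ..
      qed simp
      moreover have "weight r (stake k \<omega>0) powr t \<le> (d / \<delta>) powr t"
        using k t(1) T(6) less_imp_le[OF tree_coding_weight(1)[OF tc set_stake[OF \<omega>0(1)]]]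
        by (intro powr_mono2) (auto simp: field_simps)
      then have "weight r (stake k \<omega>0) powr t \<le> diameter (U i) powr t / \<delta> powr t + \<epsilon> * (1/2) ^ Suc i"
        using d0 T(6) \<epsilon> by (simp add: d_def powr_divide add_increasing2)
      ultimately show ?thesis using set_stake[OF \<omega>0(1), of k] by (intro exI[of _ "stake k \<omega>0"]) auto
    qed
  qed
  then obtain w where w: "\<And>i. i \<in> I \<Longrightarrow> set (w i) \<subseteq> {..<n}"
    "\<And>i \<omega>. i \<in> I \<Longrightarrow> \<omega> \<in> seqs n \<Longrightarrow> \<pi> \<omega> \<in> U i \<Longrightarrow> stake (length (w i)) \<omega> = w i"
    "\<And>i. i \<in> I \<Longrightarrow> weight r (w i) powr t \<le> diameter (U i) powr t / \<delta> powr t + \<epsilon> * (1/2) ^ Suc i"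
    by metis
  (* by separation, nbhd i contains no point of K outside the cylinder w i *)
  define nbhd where "nbhd i = (\<Union>\<omega>\<in>{\<omega>\<in>seqs n. stake (length (w i)) \<omega> = w i}. ball (\<pi> \<omega>) (\<delta> * weight r (w i)))" for i
  have "open (nbhd i)" for i unfolding nbhd_def by blast
  moreover have "K \<subseteq> (\<Union>i\<in>I. nbhd i)"
  proof
    fix y assume y: "y \<in> K"
    then obtain i where i: "y \<in> U i" using U(1) by blast
    then have I: "i \<in> I" using y by (auto simp: I_def)
    obtain \<omega> where \<omega>: "\<omega> \<in> seqs n" "y = \<pi> \<omega>" using y T(4) by (auto simp: bij_betw_def)
    have "y \<in> ball (\<pi> \<omega>) (\<delta> * weight r (w i))"
      using \<omega> T(6) tree_coding_weight(1)[OF tc w(1)[OF I]] by simp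
    then have "y \<in> nbhd i"
      unfolding nbhd_def using w(2)[OF I \<omega>(1)] i \<omega> by (intro UN_I[of \<omega>]) auto
    then show "y \<in> (\<Union>i\<in>I. nbhd i)" using I by blast
  qed
  ultimately obtain J where J: "J \<subseteq> I" "finite J" "K \<subseteq> (\<Union>i\<in>J. nbhd i)"
    using compactE_image[OF T(3), of I nbhd] by metis
  have cover: "\<exists>v\<in>w ` J. stake (length v) \<omega> = v" if \<omega>: "\<omega> \<in> seqs n" for \<omega>
  proof -
    have "\<pi> \<omega> \<in> K" using \<omega> T(4) by (auto simp: bij_betw_def)
    then obtain i \<omega>' where i: "i \<in> J" "\<omega>' \<in> seqs n" "stake (length (w i)) \<omega>' = w i"
      "dist (\<pi> \<omega>') (\<pi> \<omega>) < \<delta> * weight r (w i)"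
      using J(3) by (auto simp: nbhd_def)
    have "stake (Suc (length (w i))) \<omega>' = stake (Suc (length (w i))) \<omega>"
      by (rule tree_coding_separation[OF tc i(2) \<omega>]) (simp only: i)
    then have "stake (length (w i)) \<omega>' = stake (length (w i)) \<omega>" by (rule stake_eq_mono) simp
    then have "stake (length (w i)) \<omega> = w i" using i(3) by (simp only:)
    then show ?thesis using i(1) by blast
  qed
  have "1 \<le> (\<Sum>v\<in>w ` J. weight (\<lambda>i. r i powr s) v)"
    using p J(2) cover w(1) J(1) by (intro finite_cylinder_cover_weight) auto
  also have "\<dots> \<le> (\<Sum>i\<in>J. weight (\<lambda>i. r i powr s) (w i))"
  proof -
    have "0 \<le> weight (\<lambda>i. r i powr s) (w i)" if "i \<in> J" for i
    proof -
      have "i \<in> I" using that J(1) by blast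
      then show ?thesis using weight_powr[of n r "w i" s] T(2) w(1) by simp
    qed
    then show ?thesis using sum_image_le[OF J(2), of "weight (\<lambda>i. r i powr s)" w] by (simp add: o_def)
  qed
  also have "\<dots> \<le> (\<Sum>i\<in>J. diameter (U i) powr t / \<delta> powr t + \<epsilon> * (1/2) ^ Suc i)"
  proof (rule sum_mono)
    fix i assume "i \<in> J"
    then have i: "i \<in> I" using J(1) by blast
    have "weight (\<lambda>i. r i powr s) (w i) = weight r (w i) powr s"
      using weight_powr[of n r "w i" s] T(2) w(1)[OF i] by auto
    also have "\<dots> \<le> weight r (w i) powr t"
      using tree_coding_weight[OF tc w(1)[OF i]] t by (intro powr_mono') auto
    also note w(3)[OF i]
    finally show "weight (\<lambda>i. r i powr s) (w i) \<le> diameter (U i) powr t / \<delta> powr t + \<epsilon> * (1/2) ^ Suc i" .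
  qed
  also have "\<dots> = (\<Sum>i\<in>J. diameter (U i) powr t) / \<delta> powr t + \<epsilon> * (\<Sum>i\<in>J. (1/2) ^ Suc i)"
    by (simp only: sum.distrib sum_divide_distrib sum_distrib_left)
  also have "\<dots> \<le> \<epsilon> / \<delta> powr t + \<epsilon> * 1"
  proof (intro add_mono divide_right_mono mult_left_mono)
    have "ennreal (\<Sum>i\<in>J. diameter (U i) powr t) = (\<Sum>i\<in>J. ennreal (diameter (U i) powr t))"
      by (simp add: sum_ennreal)
    also have "\<dots> = (\<Sum>i\<in>J. diam_weight t (U i))"
      using t(1) J(1) by (intro sum.cong) (auto simp: diam_weight_def I_def)
    also have "\<dots> \<le> (\<Sum>i. diam_weight t (U i))"
      by (intro sum_le_suminf) (use J(2) in auto)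
    also have "\<dots> < ennreal \<epsilon>" by (rule sumU)
    finally show "(\<Sum>i\<in>J. diameter (U i) powr t) \<le> \<epsilon>"
      using \<epsilon> by (simp add: ennreal_less_iff sum_nonneg)
    have "(\<lambda>i. (1/2 :: real) ^ Suc i) sums 1" by (rule power_half_series)
    then show "(\<Sum>i\<in>J. (1/2 :: real) ^ Suc i) \<le> 1"
      using sum_le_suminf[of "\<lambda>i. (1/2 :: real) ^ Suc i" J] J(2) by (auto simp: sums_iff)
  qed (use \<epsilon> \<delta>t in auto)
  finally show False using \<epsilon>_small by simp
qed

lemma hausdorff_measure_0_neq_0:
  fixes K :: "'a::metric_space set"
  assumes "K \<noteq> {}" shows "hausdorff_measure 0 K \<noteq> 0"
proof
  assume "hausdorff_measure 0 K = 0"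
  then have "hausdorff_premeasure 1 0 K = 0"
    unfolding hausdorff_measure_def by (metis SUP_upper greaterThan_iff le_zero_eq zero_less_one)
  then have "hausdorff_premeasure 1 0 K < 1" by simp
  then obtain U :: "nat \<Rightarrow> 'a set" where U: "K \<subseteq> (\<Union>i. U i)" "(\<Sum>i. diam_weight 0 (U i)) < 1"
    unfolding hausdorff_premeasure_def INF_less_iff by auto
  obtain i where "U i \<noteq> {}" using assms U(1) by blast
  then have "1 = (\<Sum>i\<in>{i}. diam_weight 0 (U i))" by (simp add: diam_weight_def)
  also have "\<dots> \<le> (\<Sum>i. diam_weight 0 (U i))" by (intro sum_le_suminf) auto
  finally show False using U(2) by simp
qed

text \<open>Above \<open>s\<close> the Hausdorff sums over the levels decay geometrically, and at or below
\<open>s\<close> the measure does not vanish.\<close>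

theorem hausdorff_dim_tree_coding:
  assumes tc: "tree_coding n r \<pi> K D \<delta>" and s: "0 < s" "(\<Sum>i<n. r i powr s) = 1"
  shows "hausdorff_dim K = ereal s"
proof -
  note T = tree_codingD[OF tc]
  have p: "prob_vector n (\<lambda>i. r i powr s)" using T(2) s(2) by unfold_locales force+
  have K: "K = \<pi> ` seqs n" using T(4) by (simp add: bij_betw_def)
  have "sconst 0 \<in> seqs n" using T(1) by (auto intro: sconst_streams)
  then have "K \<noteq> {}" using K by blast
  have zero: "hausdorff_measure t K = 0" if "s < t" for t
  proof -
    have "(\<Sum>i<n. r i powr t) < (\<Sum>i<n. r i powr s)"
      using T(1,2) that by (intro sum_strict_mono powr_less_mono') (auto simp: lessThan_empty_iff)
    then have q: "(\<Sum>i<n. r i powr t) < 1" "0 \<le> (\<Sum>i<n. r i powr t)" using s(2) by (auto intro: sum_nonneg)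
    have stake_all: "stake k ` seqs n \<subseteq> words n k" for k by (auto intro: stake_in_words)
    have "(\<lambda>k. \<Sum>w\<in>stake k ` seqs n. weight r w powr t) \<longlonglongrightarrow> 0"
    proof (rule tendsto_sandwich[of "\<lambda>_. 0" _ _ "\<lambda>k. (\<Sum>i<n. r i powr t) ^ k"])
      show "(\<lambda>k. (\<Sum>i<n. r i powr t) ^ k) \<longlonglongrightarrow> 0" using q by (intro LIMSEQ_power_zero) simp
      have "(\<Sum>w\<in>stake k ` seqs n. weight r w powr t) \<le> (\<Sum>i<n. r i powr t) ^ k" for k
      proof -
        have "(\<Sum>w\<in>stake k ` seqs n. weight r w powr t) \<le> (\<Sum>w\<in>words n k. weight r w powr t)"
          by (rule sum_mono2[OF finite_words stake_all]) simp
        also have "\<dots> = (\<Sum>w\<in>words n k. weight (\<lambda>i. r i powr t) w)"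
          using weight_powr[of n r _ t] T(2) by (intro sum.cong) (auto dest: words_set)
        finally show ?thesis by (simp add: sum_words_power)
      qed
      then show "eventually (\<lambda>k. (\<Sum>w\<in>stake k ` seqs n. weight r w powr t) \<le> (\<Sum>i<n. r i powr t) ^ k) sequentially"
        by simp
    qed (auto intro!: always_eventually sum_nonneg)
    then show ?thesis using hausdorff_measure_eq_0[OF tc order_refl] that s(1) unfolding K by simp
  qed
  have nz: "hausdorff_measure t K \<noteq> 0" if "0 \<le> t" "t \<le> s" for t
    using hausdorff_measure_neq_0[OF tc p _ that(2)] hausdorff_measure_0_neq_0[OF \<open>K \<noteq> {}\<close>] that(1)
    by (cases "t = 0") auto
  show ?thesis
    unfolding hausdorff_dim_def
  proof (rule antisym)
    show "ereal s \<le> Inf {ereal s |s. 0 \<le> s \<and> hausdorff_measure s K = 0}"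
    proof (rule Inf_greatest)
      fix z assume "z \<in> {ereal s |s. 0 \<le> s \<and> hausdorff_measure s K = 0}"
      then obtain t where t: "z = ereal t" "0 \<le> t" "hausdorff_measure t K = 0" by blast
      then have "\<not> t \<le> s" using nz by blast
      then show "ereal s \<le> z" using t(1) by simp
    qed
    show "Inf {ereal s |s. 0 \<le> s \<and> hausdorff_measure s K = 0} \<le> ereal s"
    proof (rule ereal_le_epsilon2)
      fix e :: real assume "0 < e"
      then have "Inf {ereal s |s. 0 \<le> s \<and> hausdorff_measure s K = 0} \<le> ereal (s + e)"
        using zero[of "s + e"] s(1) by (intro Inf_lower) auto
      then show "Inf {ereal s |s. 0 \<le> s \<and> hausdorff_measure s K = 0} \<le> ereal s + ereal e" by simp
    qed
  qed
qed

text \<open>The sum is at least 2 for exponent 0 and at most 1 for the exponent \<open>T\<close> with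
\<open>c powr T = 1 / n\<close>, where \<open>c < 1\<close> bounds the ratios.\<close>

lemma similarity_exponent_exists:
  fixes r :: "nat \<Rightarrow> real"
  assumes n: "2 \<le> n" and r: "\<And>i. i < n \<Longrightarrow> 0 < r i \<and> r i < 1"
  shows "\<exists>s>0. (\<Sum>i<n. r i powr s) = 1"
proof -
  obtain c where c: "0 < c" "c < 1" "\<forall>i<n. r i \<le> c" using ex_max_ratio[of n r] n r by auto
  define T where "T = ln (1 / real n) / ln c"
  have "ln (1 / real n) < 0" "ln c < 0" using n c by (simp_all add: ln_div)
  then have T: "0 < T" unfolding T_def by (rule divide_neg_neg)
  have cT: "c powr T = 1 / real n" using c n by (simp add: T_def powr_def)
  define f where "f s = (\<Sum>i<n. r i powr s)" for s
  have "f 0 = (\<Sum>i<n. 1)"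
    unfolding f_def
  proof (rule sum.cong[OF refl])
    fix i assume "i \<in> {..<n}"
    then show "r i powr 0 = 1" using r[of i] by simp
  qed
  then have f0: "f 0 = real n" by simp
  have "f T \<le> (\<Sum>i<n. c powr T)"
    unfolding f_def using r c T by (intro sum_mono powr_mono2) (auto intro: less_imp_le)
  also have "\<dots> = 1" using n by (simp add: cT)
  finally have fT: "f T \<le> 1" .
  have "continuous_on {0..T} f"
    unfolding f_def using r by (intro continuous_intros) force
  then obtain s where s: "0 \<le> s" "s \<le> T" "f s = 1"
    using IVT2'[of f T 1 0] f0 fT n T by auto
  then have "s \<noteq> 0" using f0 n by auto
  then show ?thesis using s by (intro exI[of _ s]) (auto simp: f_def)
qed

section \<open>Lipschitz images of positive measure\<close>

text \<open>Sets that are bi-Lipschitz images of the full shift over \<open>p\<close> letters with the metric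
\<open>\<sigma> ^ k\<close>, \<open>k\<close> being the length of the common prefix.\<close>

definition uniformly_coded :: "nat \<Rightarrow> real \<Rightarrow> 'a::metric_space set \<Rightarrow> bool" where
  "uniformly_coded p \<sigma> K \<longleftrightarrow> (\<exists>\<pi> C. 0 < C \<and> bij_betw \<pi> (seqs p) K \<and>
     (\<forall>\<omega>\<in>seqs p. \<forall>\<omega>'\<in>seqs p. \<forall>k. stake k \<omega> = stake k \<omega>' \<longrightarrow> dist (\<pi> \<omega>) (\<pi> \<omega>') \<le> C * \<sigma> ^ k) \<and>
     (\<forall>\<omega>\<in>seqs p. \<forall>\<omega>'\<in>seqs p. \<forall>k. stake k \<omega> \<noteq> stake k \<omega>' \<longrightarrow> \<sigma> ^ k \<le> C * dist (\<pi> \<omega>) (\<pi> \<omega>')))"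

lemma uniformly_coded_lipschitz_equivalent:
  assumes \<sigma>: "0 < \<sigma>" and K: "uniformly_coded p \<sigma> K" and F: "uniformly_coded p \<sigma> F"
  shows "lipschitz_equivalent K F"
proof -
  from K obtain \<pi> C where C: "0 < C" and b: "bij_betw \<pi> (seqs p) K"
    and up: "\<And>\<omega> \<omega>' k. \<omega> \<in> seqs p \<Longrightarrow> \<omega>' \<in> seqs p \<Longrightarrow> stake k \<omega> = stake k \<omega>' \<Longrightarrow> dist (\<pi> \<omega>) (\<pi> \<omega>') \<le> C * \<sigma> ^ k"
    and lo: "\<And>\<omega> \<omega>' k. \<omega> \<in> seqs p \<Longrightarrow> \<omega>' \<in> seqs p \<Longrightarrow> stake k \<omega> \<noteq> stake k \<omega>' \<Longrightarrow> \<sigma> ^ k \<le> C * dist (\<pi> \<omega>) (\<pi> \<omega>')"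
    unfolding uniformly_coded_def by (elim exE conjE) (rule that, assumption+, blast+)
  from F obtain \<pi>' C' where C': "0 < C'" and b': "bij_betw \<pi>' (seqs p) F"
    and up': "\<And>\<omega> \<omega>' k. \<omega> \<in> seqs p \<Longrightarrow> \<omega>' \<in> seqs p \<Longrightarrow> stake k \<omega> = stake k \<omega>' \<Longrightarrow> dist (\<pi>' \<omega>) (\<pi>' \<omega>') \<le> C' * \<sigma> ^ k"
    and lo': "\<And>\<omega> \<omega>' k. \<omega> \<in> seqs p \<Longrightarrow> \<omega>' \<in> seqs p \<Longrightarrow> stake k \<omega> \<noteq> stake k \<omega>' \<Longrightarrow> \<sigma> ^ k \<le> C' * dist (\<pi>' \<omega>) (\<pi>' \<omega>')"
    unfolding uniformly_coded_def by (elim exE conjE) (rule that, assumption+, blast+)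
  define h where "h = inv_into (seqs p) \<pi>"
  define c where "c = C * C' / \<sigma>"
  have c: "0 < c" using C C' \<sigma> by (simp add: c_def)
  have bh: "bij_betw h K (seqs p)" unfolding h_def by (rule bij_betw_inv_into[OF b])
  have hK: "h x \<in> seqs p" "\<pi> (h x) = x" if "x \<in> K" for x
    using bij_betwE[OF bh] that bij_betw_inv_into_right[OF b that] by (auto simp: h_def)
  have "dist x y \<le> c * dist (\<pi>' (h x)) (\<pi>' (h y)) \<and> dist (\<pi>' (h x)) (\<pi>' (h y)) \<le> c * dist x y"
    if x: "x \<in> K" and y: "y \<in> K" for x y
  proof (cases "h x = h y")
    case True
    then have "x = y" using hK x y by metis
    then show ?thesis by simp
  next
    case False
    then obtain j where "stake j (h x) \<noteq> stake j (h y)" using stream_eq_iff_stake[of "h x" "h y"] by blast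
    from ex_first_difference[OF this] obtain k where k: "stake k (h x) = stake k (h y)" "h x !! k \<noteq> h y !! k"
      by blast
    have k': "stake (Suc k) (h x) \<noteq> stake (Suc k) (h y)" using k by (simp add: stake_Suc del: stake.simps)
    have 1: "dist x y \<le> C * \<sigma> ^ k" "\<sigma> ^ Suc k \<le> C * dist x y"
      using up[OF hK(1)[OF x] hK(1)[OF y] k(1)] lo[OF hK(1)[OF x] hK(1)[OF y] k'] hK(2) x y by simp_all
    have 2: "dist (\<pi>' (h x)) (\<pi>' (h y)) \<le> C' * \<sigma> ^ k" "\<sigma> ^ Suc k \<le> C' * dist (\<pi>' (h x)) (\<pi>' (h y))"
      using up'[OF hK(1)[OF x] hK(1)[OF y] k(1)] lo'[OF hK(1)[OF x] hK(1)[OF y] k'] by simp_all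
    have "C * \<sigma> ^ k \<le> C * (C' * dist (\<pi>' (h x)) (\<pi>' (h y)) / \<sigma>)"
      using 2(2) C \<sigma> by (intro mult_left_mono) (simp_all add: field_simps)
    moreover have "C' * \<sigma> ^ k \<le> C' * (C * dist x y / \<sigma>)"
      using 1(2) C' \<sigma> by (intro mult_left_mono) (simp_all add: field_simps)
    ultimately show ?thesis using 1(1) 2(1) by (simp add: c_def mult_ac)
  qed
  then have "\<forall>x\<in>K. \<forall>y\<in>K. inverse c * dist x y \<le> dist ((\<pi>' \<circ> h) x) ((\<pi>' \<circ> h) y) \<and>
      dist ((\<pi>' \<circ> h) x) ((\<pi>' \<circ> h) y) \<le> c * dist x y"
    using c by (simp add: inverse_eq_divide pos_divide_le_eq mult.commute)
  moreover have "bij_betw (\<pi>' \<circ> h) K F" by (rule bij_betw_trans[OF bh b'])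
  ultimately show ?thesis unfolding lipschitz_equivalent_def using c by blast
qed

lemma weight_power:
  fixes \<sigma> :: real
  assumes "\<And>i. i < n \<Longrightarrow> r i = \<sigma> ^ l i" "set u \<subseteq> {..<n}"
  shows "weight r u = \<sigma> ^ sum_list (map l u)"
  using assms(2) by (induction u) (auto simp: assms(1) power_add)

text \<open>If all ratios are powers of \<open>\<sigma>\<close>, then encoding each letter by a word whose length
is the exponent makes the length of a common prefix, up to a bounded error, the exponent of the distance.\<close>

lemma tree_coding_uniformly_coded:
  assumes tc: "tree_coding n r \<pi> K D \<delta>" and pc: "prefix_code n p l c"
    and \<sigma>: "0 < \<sigma>" "\<sigma> < 1" and r: "\<And>i. i < n \<Longrightarrow> r i = \<sigma> ^ l i"
  shows "uniformly_coded p \<sigma> K"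
proof -
  interpret prefix_code n p l c by fact
  note T = tree_codingD[OF tc]
  define h where "h = inv_into (seqs n) encode"
  have bh: "bij_betw h (seqs p) (seqs n)" unfolding h_def by (rule bij_betw_inv_into[OF bij_betw_encode])
  have h: "h y \<in> seqs n" "encode (h y) = y" if "y \<in> seqs p" for y
    using bij_betwE[OF bh] that bij_betw_inv_into_right[OF bij_betw_encode that] by (auto simp: h_def)
  define M where "M = (\<Sum>i<n. l i)"
  have M: "l i \<le> M" if "i < n" for i unfolding M_def using that by (intro member_le_sum) auto
  define C where "C = D / \<sigma> ^ M + 1 / \<delta>"
  have C: "0 < C" "D / \<sigma> ^ M \<le> C" "1 / \<delta> \<le> C" using T(5,6) \<sigma> by (simp_all add: C_def add_pos_pos)
  have main: "(stake k y = stake k y' \<longrightarrow> dist (\<pi> (h y)) (\<pi> (h y')) \<le> C * \<sigma> ^ k) \<and>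
      (stake k y \<noteq> stake k y' \<longrightarrow> \<sigma> ^ k \<le> C * dist (\<pi> (h y)) (\<pi> (h y')))"
    if y: "y \<in> seqs p" "y' \<in> seqs p" for y y' k
  proof (cases "h y = h y'")
    case True
    then have "y = y'" using h y by metis
    then show ?thesis using C \<sigma> by simp
  next
    case False
    from first_difference[OF this h(1)[OF y(1)] h(1)[OF y(2)]]
    obtain u i j \<eta> \<eta>' where u: "set u \<subseteq> {..<n}" "i < n" "j < n" "i \<noteq> j"
      "h y = u @- i ## \<eta>" "h y' = u @- j ## \<eta>'"
      by (elim exE conjE)
    define S where "S = sum_list (map l u)"
    have w: "weight r u = \<sigma> ^ S" unfolding S_def using r u(1) by (rule weight_power)
    have st: "stake (length u) (h y) = u" "stake (length u) (h y') = u"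
      "h y !! length u = i" "h y' !! length u = j"
      by (simp_all add: u(5,6))
    have up: "dist (\<pi> (h y)) (\<pi> (h y')) \<le> D * \<sigma> ^ S"
      using T(7)[OF h(1)[OF y(1)] h(1)[OF y(2)], of "length u", unfolded st w, OF refl] .
    have lo: "\<delta> * \<sigma> ^ S \<le> dist (\<pi> (h y)) (\<pi> (h y'))"
      using T(8)[OF h(1)[OF y(1)] h(1)[OF y(2)], of "length u", unfolded st w, OF refl u(4)] .
    show ?thesis
    proof (intro conjI impI)
      assume eq: "stake k y = stake k y'"
      have "stake (S + M) y \<noteq> stake (S + M) y'"
        using encode_separates[OF u(1-4) M[OF u(2)] M[OF u(3)], of \<eta> \<eta>'] h(2) y u(5,6)
        unfolding S_def by metis
      then have "k \<le> S + M" using eq stake_eq_mono[of k y y' "S + M"] by (cases "k \<le> S + M") auto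
      then have "\<sigma> ^ (S + M) \<le> \<sigma> ^ k" using \<sigma> by (intro power_decreasing) auto
      then have "\<sigma> ^ S \<le> \<sigma> ^ k / \<sigma> ^ M" using \<sigma> by (simp add: power_add field_simps)
      then have "D * \<sigma> ^ S \<le> D * (\<sigma> ^ k / \<sigma> ^ M)" using T(5) by (intro mult_left_mono) auto
      also have "\<dots> = D / \<sigma> ^ M * \<sigma> ^ k" by simp
      also have "\<dots> \<le> C * \<sigma> ^ k" using C(2) \<sigma> by (intro mult_right_mono) auto
      finally show "dist (\<pi> (h y)) (\<pi> (h y')) \<le> C * \<sigma> ^ k" using up by linarith
    next
      assume ne: "stake k y \<noteq> stake k y'"
      have "stake S y = stake S y'"
      proof -
        have "stake S (encode (u @- i ## \<eta>)) = stake S (encode (u @- j ## \<eta>'))"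
          using u(1) length_concat_code[OF u(1)] by (simp add: encode_shift stake_shift S_def)
        then show ?thesis using h(2) y u(5,6) by metis
      qed
      then have "S \<le> k" using ne stake_eq_mono[of S y y' k] by (cases "S \<le> k") auto
      then have "\<sigma> ^ k \<le> \<sigma> ^ S" using \<sigma> by (intro power_decreasing) auto
      also have "\<dots> \<le> 1 / \<delta> * dist (\<pi> (h y)) (\<pi> (h y'))" using lo T(6) by (simp add: field_simps)
      also have "\<dots> \<le> C * dist (\<pi> (h y)) (\<pi> (h y'))" using C(3) by (intro mult_right_mono) auto
      finally show "\<sigma> ^ k \<le> C * dist (\<pi> (h y)) (\<pi> (h y'))" .
    qed
  qed
  show ?thesis
    unfolding uniformly_coded_def
  proof (intro exI[of _ "\<pi> \<circ> h"] exI[of _ C] conjI ballI allI impI)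
    show "bij_betw (\<pi> \<circ> h) (seqs p) K" by (rule bij_betw_trans[OF bh T(4)])
  qed (use C main in auto)
qed

text \<open>On addresses the map satisfies the weighted Lipschitz condition, and its image has positive content
because a set of content 0 is coded to a set of measure 0. Hence the weights of \<open>K\<close> and
\<open>F\<close> are powers of a common \<open>1 / p\<close>, and both sets are uniformly coded over
\<open>p\<close> letters with the same ratio.\<close>

theorem lipschitz_image_of_positive_measure:
  fixes K :: "'a::heine_borel set" and F :: "'b::heine_borel set"
  assumes K: "dust_like K" and F: "homogeneous_dust_like F"
    and dim: "hausdorff_dim K = ereal s" "hausdorff_dim F = ereal s"
    and f: "lipschitz_map K F f" and pos_measure: "hausdorff_measure s (f ` K) > 0"
  shows "lipschitz_equivalent K F"
proof -
  obtain n r \<phi> where dK: "dust_like_ifs n r \<phi> K" using K by (auto simp: dust_like_def)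
  obtain m q \<psi> \<rho> where dF: "dust_like_ifs m q \<psi> F" and q: "\<And>j. j < m \<Longrightarrow> q j = \<rho>"
    using F unfolding homogeneous_dust_like_def by blast
  obtain \<pi> D \<delta> where tK: "tree_coding n r \<pi> K D \<delta>" using dust_like_tree_coding[OF dK] by blast
  obtain \<pi>' E \<epsilon> where tF: "tree_coding m q \<pi>' F E \<epsilon>" using dust_like_tree_coding[OF dF] by blast
  note TK = tree_codingD[OF tK] and TF = tree_codingD[OF tF]
  have "\<exists>s'>0. (\<Sum>i<n. r i powr s') = 1" using TK(1,2) by (rule similarity_exponent_exists)
  then have s: "0 < s" and sumK: "(\<Sum>i<n. r i powr s) = 1"
    using hausdorff_dim_tree_coding[OF tK] dim(1) by auto
  have "\<exists>s'>0. (\<Sum>i<m. q i powr s') = 1" using TF(1,2) by (rule similarity_exponent_exists)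
  then have "(\<Sum>i<m. q i powr s) = 1"
    using hausdorff_dim_tree_coding[OF tF] dim(2) by auto
  then have m\<rho>: "real m * \<rho> powr s = 1" using q by simp
  have \<rho>: "0 < \<rho>" "\<rho> < 1" using TF(1) TF(2)[of 0] q[of 0] by auto
  have \<rho>s: "\<rho> powr s = 1 / real m" using m\<rho> TF(1) by (simp add: field_simps)
  define x where "x i = r i powr s" for i
  interpret tree_maps n x m
    using TK(1,2) TF(1) sumK by unfold_locales (force simp: x_def)+
  have wq: "weight q w = \<rho> ^ length w" if "set w \<subseteq> {..<m}" for w
    using that by (induction w) (auto simp: q)
  have \<rho>pow: "(\<rho> ^ l) powr s = (1 / real m) ^ l" for l
  proof (induction l)
    case (Suc l)
    then show ?case using \<rho>(1) \<rho>s by (simp add: powr_mult)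
  qed simp
  obtain L0 where "L0-lipschitz_on K f" and fK: "f ` K \<subseteq> F"
    using f by (auto simp: lipschitz_map_def)
  then have Lip0: "dist (f a) (f b) \<le> L0 * dist a b" if "a \<in> K" "b \<in> K" for a b
    using that by (auto dest: lipschitz_onD)
  (* a strictly positive constant, as L0 may vanish for a constant map *)
  define L where "L = max L0 1"
  have L: "0 < L" by (simp add: L_def)
  have Lip: "dist (f a) (f b) \<le> L * dist a b" if "a \<in> K" "b \<in> K" for a b
    using Lip0[OF that] mult_right_mono[of L0 L "dist a b"] by (simp add: L_def)
  define h where "h = inv_into (seqs m) \<pi>'"
  have h: "h y \<in> seqs m" "\<pi>' (h y) = y" if "y \<in> F" for y
    using that bij_betw_inv_into_right[OF TF(4) that] bij_betwE[OF bij_betw_inv_into[OF TF(4)]]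
    by (auto simp: h_def)
  define g where "g \<omega> = h (f (\<pi> \<omega>))" for \<omega>
  have \<pi>K: "\<pi> \<omega> \<in> K" if "\<omega> \<in> seqs n" for \<omega> using bij_betwE[OF TK(4)] that by blast
  have g: "g \<omega> \<in> seqs m" "\<pi>' (g \<omega>) = f (\<pi> \<omega>)" if "\<omega> \<in> seqs n" for \<omega>
    using h[of "f (\<pi> \<omega>)"] fK \<pi>K[OF that] by (auto simp: g_def)
  define \<kappa> where "\<kappa> = L * D / \<epsilon>"
  have \<kappa>: "0 < \<kappa>" using L TK(5) TF(6) by (simp add: \<kappa>_def)
  have wl: "wlip (\<kappa> powr s) g"
    unfolding wlip_def
  proof (intro conjI ballI allI impI)
    show "g \<in> seqs n \<rightarrow> seqs m" using g(1) by blast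
    fix \<omega> \<omega>' k l
    assume \<omega>: "\<omega> \<in> seqs n" "\<omega>' \<in> seqs n" "stake k \<omega> = stake k \<omega>'"
      and less: "\<kappa> powr s * weight x (stake k \<omega>) * real m ^ l < 1"
    define w where "w = weight r (stake k \<omega>)"
    have w: "0 < w" unfolding w_def by (rule tree_coding_weight(1)[OF tK set_stake[OF \<omega>(1)]])
    have "weight x (stake k \<omega>) = w powr s"
      unfolding x_def w_def using TK(2) by (intro weight_powr[of n] set_stake[OF \<omega>(1)]) auto
    moreover have "real m ^ l = 1 / (\<rho> ^ l) powr s" using TF(1) by (simp add: \<rho>pow power_one_over)
    ultimately have "(\<kappa> * w / \<rho> ^ l) powr s < 1 powr s"
      using less \<kappa> w \<rho> by (simp add: powr_mult powr_divide)
    then have "\<kappa> * w / \<rho> ^ l < 1"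
      using s \<kappa> w \<rho> powr_mono2[of s 1 "\<kappa> * w / \<rho> ^ l"] by (meson not_le less_imp_le zero_le_one)
    then have "L * D * w < \<epsilon> * \<rho> ^ l" using \<rho> TF(6) by (simp add: \<kappa>_def field_simps)
    moreover have "dist (\<pi>' (g \<omega>)) (\<pi>' (g \<omega>')) \<le> L * (D * w)"
    proof -
      have "dist (f (\<pi> \<omega>)) (f (\<pi> \<omega>')) \<le> L * dist (\<pi> \<omega>) (\<pi> \<omega>')" using \<omega> \<pi>K Lip by blast
      also have "\<dots> \<le> L * (D * w)" unfolding w_def using TK(7)[OF \<omega>] L by (intro mult_left_mono) auto
      finally show ?thesis using g(2) \<omega> by simp
    qed
    ultimately have "dist (\<pi>' (g \<omega>)) (\<pi>' (g \<omega>')) < \<epsilon> * weight q (stake l (g \<omega>))"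
      using wq[OF set_stake[OF g(1)[OF \<omega>(1)]], of l] by simp
    then show "stake (Suc l) (g \<omega>) = stake (Suc l) (g \<omega>')"
      by (rule tree_coding_separation[OF tF g(1)[OF \<omega>(1)] g(1)[OF \<omega>(2)]])
  qed
  define B where "B = g ` seqs n"
  have B: "B \<subseteq> seqs m" using g(1) by (auto simp: B_def)
  have image: "\<pi>' ` B = f ` K"
  proof -
    have "\<pi>' ` B = (\<lambda>\<omega>. f (\<pi> \<omega>)) ` seqs n" unfolding B_def image_image using g(2) by (intro image_cong) auto
    also have "\<dots> = f ` \<pi> ` seqs n" by (simp add: image_image)
    finally show ?thesis using TK(4) by (simp add: bij_betw_def)
  qed
  have nu: "0 < nu B"
  proof (rule ccontr)
    assume "\<not> 0 < nu B"
    then have "nu B = 0" using unif.stream_content_nonneg[OF B] by simp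
    then have lim: "level_sum (\<lambda>_. 1 / real m) B \<longlonglongrightarrow> 0" using unif.level_sum_tendsto[OF B] by simp
    have "level_sum (\<lambda>_. 1 / real m) B k = (\<Sum>w\<in>stake k ` B. weight q w powr s)" for k
      unfolding level_sum_def
    proof (rule sum.cong[OF refl])
      fix w assume "w \<in> stake k ` B"
      then obtain y where "y \<in> B" "w = stake k y" by blast
      then show "weight (\<lambda>_. 1 / real m) w = weight q w powr s"
        using wq[OF set_stake[of y m k]] B by (auto simp: \<rho>pow)
    qed
    then have "level_sum (\<lambda>_. 1 / real m) B = (\<lambda>k. \<Sum>w\<in>stake k ` B. weight q w powr s)" by (rule ext)
    with lim have "(\<lambda>k. \<Sum>w\<in>stake k ` B. weight q w powr s) \<longlonglongrightarrow> 0" by (simp only:)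
    from hausdorff_measure_eq_0[OF tF B s this] show False using pos_measure by (simp add: image)
  qed
  have comm: "\<exists>d>0. \<exists>e. x i ^ d * real m ^ e = 1" if "i < n" for i
    using letter_weight_commensurable[OF wl _ _ that] \<kappa> nu by (simp add: B_def)
  obtain p l a where p: "2 \<le> p" and l: "\<And>i. i < n \<Longrightarrow> 0 < l i \<and> x i = (1 / real p) ^ l i"
    and a: "0 < a" "m = p ^ a"
    using common_integer_base[OF x_less_1 m2 comm] by blast
  define \<sigma> where "\<sigma> = (1 / real p) powr (1 / s)"
  have \<sigma>: "0 < \<sigma>" "\<sigma> < 1" using p s powr_less_mono2[of "1 / s" "1 / real p" 1] by (simp_all add: \<sigma>_def)
  have pow\<sigma>: "((1 / real p) ^ j) powr (1 / s) = \<sigma> ^ j" for j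
  proof (induction j)
    case (Suc j)
    have "((1 / real p) ^ Suc j) powr (1 / s) = \<sigma> * ((1 / real p) ^ j) powr (1 / s)"
      unfolding power_Suc \<sigma>_def by (rule powr_mult)
    then show ?case using Suc by simp
  qed simp
  have r\<sigma>: "r i = \<sigma> ^ l i" if "i < n" for i
  proof -
    have "r i = (r i powr s) powr (1 / s)" using TK(2)[OF that] s by (simp add: powr_powr)
    also have "\<dots> = \<sigma> ^ l i" using l[OF that] pow\<sigma>[of "l i"] by (simp add: x_def)
    finally show ?thesis .
  qed
  have q\<sigma>: "q j = \<sigma> ^ a" if "j < m" for j
  proof -
    have "\<rho> = (\<rho> powr s) powr (1 / s)" using \<rho> s by (simp add: powr_powr)
    also have "\<dots> = \<sigma> ^ a" using pow\<sigma>[of a] a(2) by (simp add: \<rho>s power_one_over)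
    finally show ?thesis using q[OF that] by simp
  qed
  have "(\<Sum>i<n. (1 / real p) ^ l i) = 1" using sum_1 l by simp
  then obtain c where "prefix_code n p l c" using prefix_code_of_weights[of p n l] p l by auto
  then have "uniformly_coded p \<sigma> K" using tree_coding_uniformly_coded[OF tK _ \<sigma> r\<sigma>] by blast
  moreover have "(\<Sum>i<m. (1 / real p) ^ a) = 1" using a p by (simp add: power_one_over)
  then obtain c' where "prefix_code m p (\<lambda>_. a) c'" using prefix_code_of_weights[of p m "\<lambda>_. a"] p a(1) by auto
  then have "uniformly_coded p \<sigma> F" using tree_coding_uniformly_coded[OF tF _ \<sigma> q\<sigma>] by blast
  ultimately show ?thesis by (rule uniformly_coded_lipschitz_equivalent[OF \<sigma>(1)])
qed

section \<open>Golden weights\<close>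

definition gold :: real where "gold = (sqrt 5 - 1) / 2"

lemma gold_bounds: "0 < gold" "gold < 1"
proof -
  have "1 < sqrt 5" "sqrt 5 < 3" by (auto intro: real_less_rsqrt real_less_lsqrt)
  then show "0 < gold" "gold < 1" by (simp_all add: gold_def)
qed

lemma gold_sq: "gold ^ 2 = 1 - gold"
  by (simp add: gold_def power2_eq_square field_simps)

lemma gold_cube: "gold ^ 3 = sqrt 5 - 2"
proof -
  have "gold ^ 3 = gold * gold ^ 2" by (simp add: power3_eq_cube power2_eq_square)
  also have "\<dots> = gold - gold ^ 2" by (simp add: gold_sq right_diff_distrib power2_eq_square[symmetric])
  also have "\<dots> = sqrt 5 - 2" by (simp only: gold_sq) (simp add: gold_def)
  finally show ?thesis .
qed

text \<open>Letter \<open>i\<close> of \<open>K\<close> has weight \<open>gold ^ expK i\<close>, and letter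
\<open>j\<close> of \<open>F\<close> has weight \<open>gold ^ expF j\<close>. The size of a word is the
exponent of its weight.\<close>

definition expK :: "nat \<Rightarrow> nat" where "expK i = (if i = 0 then 1 else 2)"
definition expF :: "nat \<Rightarrow> nat" where "expF j = (if j < 4 then 3 else 6)"

abbreviation "sizeK w \<equiv> sum_list (map expK w)"
abbreviation "sizeF w \<equiv> sum_list (map expF w)"

lemma lessThan_2_5: "{..<2} = {0, 1 :: nat}" "{..<5} = {0, 1, 2, 3, 4 :: nat}"
  by auto

lemma prob_vector_K: "prob_vector 2 (\<lambda>i. gold ^ expK i)"
  by unfold_locales (auto simp: gold_bounds lessThan_2_5 expK_def gold_sq)

lemma prob_vector_F: "prob_vector 5 (\<lambda>j. gold ^ expF j)"
proof
  have "gold ^ 6 = (gold ^ 3) ^ 2" by (simp flip: power_mult)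
  also have "\<dots> = (sqrt 5 - 2) ^ 2" by (simp add: gold_cube)
  also have "\<dots> = 9 - 4 * sqrt 5" by (simp add: power2_eq_square algebra_simps)
  finally show "(\<Sum>j<5. gold ^ expF j) = 1"
    by (simp add: lessThan_2_5 expF_def gold_cube)
qed (simp add: gold_bounds)

lemma weight_powers: "weight (\<lambda>i. a ^ e i) w = a ^ sum_list (map e w)" for a :: real
  by (induction w) (auto simp: power_add)

lemma sizeK_le: "sizeK w \<le> 2 * length w" and sizeK_ge: "length w \<le> sizeK w"
  by (induction w) (auto simp: expK_def)

lemma sizeF_ge: "3 * length w \<le> sizeF w"
  by (induction w) (auto simp: expF_def)

lemma sizeF_dvd: "3 dvd sizeF w"
  by (induction w) (auto simp: expF_def)

section \<open>A Lipschitz surjection that regroups letters\<close>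

text \<open>Splitting off the next \<open>F\<close>-letter of a \<open>K\<close>-stream, possibly at the cost of
putting back a letter. The table \<open>rules\<close> below lists the same steps as triples (block, emitted
letter, letters put back).\<close>

definition step :: "nat stream \<Rightarrow> nat \<times> nat stream" where
  "step \<omega> =
    (if \<omega> !! 0 = 1 then if \<omega> !! 1 = 0 then (1, sdrop 2 \<omega>) else (3, 0 ## sdrop 2 \<omega>)
     else if \<omega> !! 1 = 1 then (0, sdrop 2 \<omega>)
     else if \<omega> !! 2 = 0 then (2, sdrop 3 \<omega>)
     else if \<omega> !! 3 = 0 then (3, 1 ## sdrop 4 \<omega>) else (4, sdrop 4 \<omega>))"

text \<open>The blocks are a complete prefix code over two letters. Since a block has the same size as the emitted
letter and the letters put back, regrouping does not change sizes. The letter 3 is emitted by two rules with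
different remainders: together they provide every continuation.\<close>

definition rules :: "(nat list \<times> nat \<times> nat list) set" where
  "rules = {([0,1], 0, []), ([1,0], 1, []), ([0,0,0], 2, []), ([1,1], 3, [0]), ([0,0,1,0], 3, [1]), ([0,0,1,1], 4, [])}"

lemma step_rule: "(v, j, t) \<in> rules \<Longrightarrow> step (v @- \<eta>) = (j, t @- \<eta>)"
  unfolding rules_def
  by (elim insertE emptyE; simp add: step_def sdrop_shift del: shift.simps; simp)

lemma rules_size: "(v, j, t) \<in> rules \<Longrightarrow> sizeK v = expF j + sizeK t \<and> length v \<le> 4 \<and> j < 5 \<and>
    set v \<subseteq> {..<2} \<and> set t \<subseteq> {..<2}"
  by (auto simp: rules_def expK_def expF_def)

lemma rule_exists:
  assumes "\<omega> \<in> seqs 2"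
  shows "\<exists>v j t. (v, j, t) \<in> rules \<and> \<omega> = v @- sdrop (length v) \<omega>"
proof -
  have bin: "\<omega> !! k = 0 \<or> \<omega> !! k = 1" for k
  proof -
    have "\<omega> !! k < 2" using assms by (auto simp: streams_iff_snth)
    then show ?thesis by auto
  qed
  have prefix: "\<exists>v j t. (v, j, t) \<in> rules \<and> \<omega> = v @- sdrop (length v) \<omega>"
    if "(v, j, t) \<in> rules" "stake (length v) \<omega> = v" for v j t
    using that by (metis stake_sdrop)
  have st: "stake 2 \<omega> = [\<omega> !! 0, \<omega> !! 1]" "stake 3 \<omega> = [\<omega> !! 0, \<omega> !! 1, \<omega> !! 2]"
    "stake 4 \<omega> = [\<omega> !! 0, \<omega> !! 1, \<omega> !! 2, \<omega> !! 3]"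
    by (simp_all add: numeral_eq_Suc)
  consider "stake 2 \<omega> = [0, 1]" | "stake 2 \<omega> = [1, 0]" | "stake 2 \<omega> = [1, 1]" | "stake 3 \<omega> = [0, 0, 0]"
    | "stake 4 \<omega> = [0, 0, 1, 0]" | "stake 4 \<omega> = [0, 0, 1, 1]"
    unfolding st using bin[of 0] bin[of 1] bin[of 2] bin[of 3] by auto
  then show ?thesis
  proof cases
    case 1 show ?thesis by (rule prefix[of "[0,1]" 0 "[]"]) (use 1 in \<open>simp_all add: rules_def numeral_2_eq_2\<close>)
  next
    case 2 show ?thesis by (rule prefix[of "[1,0]" 1 "[]"]) (use 2 in \<open>simp_all add: rules_def numeral_2_eq_2\<close>)
  next
    case 3 show ?thesis by (rule prefix[of "[1,1]" 3 "[0]"]) (use 3 in \<open>simp_all add: rules_def numeral_2_eq_2\<close>)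
  next
    case 4 show ?thesis by (rule prefix[of "[0,0,0]" 2 "[]"]) (use 4 in \<open>simp_all add: rules_def numeral_3_eq_3\<close>)
  next
    case 5 show ?thesis by (rule prefix[of "[0,0,1,0]" 3 "[1]"]) (use 5 in \<open>simp_all add: rules_def numeral_eq_Suc\<close>)
  next
    case 6 show ?thesis by (rule prefix[of "[0,0,1,1]" 4 "[]"]) (use 6 in \<open>simp_all add: rules_def numeral_eq_Suc\<close>)
  qed
qed

definition regroup :: "nat stream \<Rightarrow> nat stream" where
  "regroup \<omega> = smap (fst \<circ> step) (siterate (snd \<circ> step) \<omega>)"

lemma regroup_unfold: "regroup \<omega> = fst (step \<omega>) ## regroup (snd (step \<omega>))"
  unfolding regroup_def by (subst siterate.code) simp

lemma regroup_rule: "(v, j, t) \<in> rules \<Longrightarrow> regroup (v @- \<eta>) = j ## regroup (t @- \<eta>)"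
  by (subst regroup_unfold) (simp add: step_rule)

lemma regroup_in_seqs: assumes "\<omega> \<in> seqs 2" shows "regroup \<omega> \<in> seqs 5"
proof -
  have step: "fst (step \<omega>) < 5 \<and> snd (step \<omega>) \<in> seqs 2" if "\<omega> \<in> seqs 2" for \<omega>
  proof -
    from rule_exists[OF that] obtain v j t where r: "(v, j, t) \<in> rules" and \<omega>: "\<omega> = v @- sdrop (length v) \<omega>"
      by blast
    have "step \<omega> = (j, t @- sdrop (length v) \<omega>)" by (subst \<omega>) (rule step_rule[OF r])
    then show ?thesis using rules_size[OF r] sdrop_in_seqs[OF that, of "length v"] by (simp add: shift_in_seqs_iff)
  qed
  have "((snd \<circ> step) ^^ k) \<omega> \<in> seqs 2" for k
    using assms step by (induction k) auto
  then show ?thesis using step by (simp add: regroup_def streams_iff_snth)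
qed

text \<open>Letters have size at most 2, so a prefix of size 8 has at least four letters, which is the maximal
length of a block.\<close>

lemma common_rule:
  assumes \<omega>: "\<omega> \<in> seqs 2" and eq: "stake k \<omega> = stake k \<omega>'" and large: "8 \<le> sizeK (stake k \<omega>)"
  obtains v j t \<eta> \<eta>' where "(v, j, t) \<in> rules" "\<omega> = v @- \<eta>" "\<omega>' = v @- \<eta>'"
    "stake (k - length v) \<eta> = stake (k - length v) \<eta>'"
    "sizeK (stake k \<omega>) = sizeK v + sizeK (stake (k - length v) \<eta>)"
proof -
  from rule_exists[OF \<omega>] obtain v j t where r: "(v, j, t) \<in> rules" and v: "\<omega> = v @- sdrop (length v) \<omega>"
    by blast
  have "4 \<le> k" using large sizeK_le[of "stake k \<omega>"] by simp
  then have k: "length v \<le> k" using rules_size[OF r] by simp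
  have st: "stake k \<omega> = v @ stake (k - length v) (sdrop (length v) \<omega>)"
    using k by (subst v) (simp add: stake_shift)
  have "take (length v) (stake k \<omega>) = v" unfolding st by simp
  then have "stake (length v) \<omega>' = v" using eq k by (simp add: take_stake min_absorb1)
  then have v': "\<omega>' = v @- sdrop (length v) \<omega>'" using stake_sdrop[of "length v" \<omega>'] by simp
  have st': "stake k \<omega>' = v @ stake (k - length v) (sdrop (length v) \<omega>')"
    using k by (subst v') (simp add: stake_shift)
  show ?thesis
    by (rule that[OF r v v']) (use st st' eq in simp_all)
qed

text \<open>Sizes are preserved, so after \<open>c\<close> emitted letters the known part of the stream still has
size 8, which determines the next letter.\<close>

lemma regroup_agree:
  assumes "\<omega> \<in> seqs 2" "stake k \<omega> = stake k \<omega>'"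
    and "sizeF (stake c (regroup \<omega>)) + 8 \<le> sizeK (stake k \<omega>)"
  shows "stake (Suc c) (regroup \<omega>) = stake (Suc c) (regroup \<omega>')"
  using assms
proof (induction c arbitrary: \<omega> \<omega>' k)
  case (0 \<omega> \<omega>' k)
  then have "8 \<le> sizeK (stake k \<omega>)" by simp
  from common_rule[OF 0(1,2) this] obtain v j t \<eta> \<eta>' where
    "(v, j, t) \<in> rules" "\<omega> = v @- \<eta>" "\<omega>' = v @- \<eta>'" by metis
  then show ?case by (simp add: regroup_rule)
next
  case (Suc c \<omega> \<omega>' k)
  then have "8 \<le> sizeK (stake k \<omega>)" by simp
  from common_rule[OF Suc.prems(1,2) this] obtain v j t \<eta> \<eta>' where
    r: "(v, j, t) \<in> rules" and \<omega>: "\<omega> = v @- \<eta>" "\<omega>' = v @- \<eta>'"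
    and eq: "stake (k - length v) \<eta> = stake (k - length v) \<eta>'"
    and size: "sizeK (stake k \<omega>) = sizeK v + sizeK (stake (k - length v) \<eta>)"
    by metis
  note rs = rules_size[OF r]
  have "stake (Suc c) (regroup (t @- \<eta>)) = stake (Suc c) (regroup (t @- \<eta>'))"
  proof (rule Suc.IH)
    show "t @- \<eta> \<in> seqs 2" using rs Suc.prems(1) by (simp add: \<omega>(1) shift_in_seqs_iff)
    show "stake (length t + (k - length v)) (t @- \<eta>) = stake (length t + (k - length v)) (t @- \<eta>')"
      using eq by (simp add: stake_shift)
    have "sizeF (stake (Suc c) (regroup \<omega>)) = expF j + sizeF (stake c (regroup (t @- \<eta>)))"
      unfolding \<omega>(1) regroup_rule[OF r] by simp
    then show "sizeF (stake c (regroup (t @- \<eta>))) + 8 \<le> sizeK (stake (length t + (k - length v)) (t @- \<eta>))"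
      using Suc.prems(3) size rs by (simp add: stake_shift)
  qed
  then show ?case unfolding \<omega> regroup_rule[OF r] by (simp only: stake.simps stream.sel)
qed

text \<open>For \<open>j = 3\<close> the rule is chosen whose remainder is the first letter of
\<open>\<omega>\<close>; the other letters leave no remainder.\<close>

lemma regroup_Cons: assumes "\<omega> \<in> seqs 2" "j < 5" shows "\<exists>\<omega>'\<in>seqs 2. regroup \<omega>' = j ## regroup \<omega>"
proof -
  have use: "\<exists>\<omega>'\<in>seqs 2. regroup \<omega>' = j ## regroup \<omega>" if r: "(v, j, t) \<in> rules" "\<omega> = t @- \<eta>" for v t \<eta>
  proof (rule bexI)
    show "regroup (v @- \<eta>) = j ## regroup \<omega>" unfolding r(2) by (rule regroup_rule[OF r(1)])
    show "v @- \<eta> \<in> seqs 2" using rules_size[OF r(1)] assms(1) by (simp add: r(2) shift_in_seqs_iff)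
  qed
  consider "j = 0" | "j = 1" | "j = 2" | "j = 3" | "j = 4" using assms(2) by linarith
  then show ?thesis
  proof cases
    case 1 show ?thesis by (rule use[of "[0,1]" "[]" \<omega>]) (simp_all add: 1 rules_def)
  next
    case 2 show ?thesis by (rule use[of "[1,0]" "[]" \<omega>]) (simp_all add: 2 rules_def)
  next
    case 3 show ?thesis by (rule use[of "[0,0,0]" "[]" \<omega>]) (simp_all add: 3 rules_def)
  next
    case 5 show ?thesis by (rule use[of "[0,0,1,1]" "[]" \<omega>]) (simp_all add: 5 rules_def)
  next
    case 4
    have "shd \<omega> < 2" using assms(1) by (auto dest: streams_shd)
    then consider "shd \<omega> = 0" | "shd \<omega> = 1" by linarith
    then show ?thesis
    proof cases
      case 1 show ?thesis
        by (rule use[of "[1,1]" "[0]" "stl \<omega>"]) (use 1 stream.collapse[of \<omega>] in \<open>simp_all add: 4 rules_def\<close>)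
    next
      case 2 show ?thesis
        by (rule use[of "[0,0,1,0]" "[1]" "stl \<omega>"]) (use 2 stream.collapse[of \<omega>] in \<open>simp_all add: 4 rules_def\<close>)
    qed
  qed
qed

lemma regroup_dense: "set w \<subseteq> {..<5} \<Longrightarrow> \<exists>\<omega>\<in>seqs 2. stake (length w) (regroup \<omega>) = w"
proof (induction w)
  case Nil
  have "sconst 0 \<in> seqs 2" by (auto intro: sconst_streams)
  then show ?case by auto
next
  case (Cons j w)
  then obtain \<omega> where \<omega>: "\<omega> \<in> seqs 2" "stake (length w) (regroup \<omega>) = w" by auto
  have "j < 5" using Cons.prems by simp
  from regroup_Cons[OF \<omega>(1) this] obtain \<omega>' where "\<omega>' \<in> seqs 2" "regroup \<omega>' = j ## regroup \<omega>" by blast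
  then show ?case using \<omega>(2) by (intro bexI[of _ \<omega>']) simp_all
qed

text \<open>By \<open>regroup_agree\<close> the first differences of two streams and of their images have sizes
that satisfy \<open>d \<le> d' + 8\<close>, which is the Lipschitz bound. The image is dense and compact.\<close>

theorem lipschitz_surjection_regroup:
  fixes K :: "'a::heine_borel set" and F :: "'b::heine_borel set"
  assumes \<sigma>: "0 < \<sigma>" "\<sigma> < 1"
    and tK: "tree_coding 2 (\<lambda>i. \<sigma> ^ expK i) \<pi> K D \<delta>" and tF: "tree_coding 5 (\<lambda>j. \<sigma> ^ expF j) \<pi>' F E \<epsilon>"
  shows "\<exists>f. lipschitz_map K F f \<and> f ` K = F"
proof -
  note TK = tree_codingD[OF tK] and TF = tree_codingD[OF tF]
  define h where "h = inv_into (seqs 2) \<pi>"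
  have h: "h x \<in> seqs 2" "\<pi> (h x) = x" if "x \<in> K" for x
    using bij_betwE[OF bij_betw_inv_into[OF TK(4)]] that bij_betw_inv_into_right[OF TK(4) that] by (auto simp: h_def)
  have h\<pi>: "h (\<pi> \<omega>) = \<omega>" if "\<omega> \<in> seqs 2" for \<omega>
    unfolding h_def using bij_betw_inv_into_left[OF TK(4) that] .
  have \<pi>K: "\<pi> \<omega> \<in> K" if "\<omega> \<in> seqs 2" for \<omega> using bij_betwE[OF TK(4)] that by blast
  have \<pi>F: "\<pi>' y \<in> F" if "y \<in> seqs 5" for y using bij_betwE[OF TF(4)] that by blast
  define f where "f x = \<pi>' (regroup (h x))" for x
  define L where "L = E / (\<sigma> ^ 8 * \<delta>)"
  have L: "0 \<le> L" using TF(5) TK(6) \<sigma> by (simp add: L_def)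
  have fF: "f x \<in> F" if "x \<in> K" for x unfolding f_def using h[OF that] by (intro \<pi>F regroup_in_seqs)
  have lip: "dist (f x) (f y) \<le> L * dist x y" if xy: "x \<in> K" "y \<in> K" for x y
  proof (cases "regroup (h x) = regroup (h y)")
    case True
    then show ?thesis using L by (simp add: f_def)
  next
    case False
    then have "h x \<noteq> h y" by auto
    then obtain a b where "stake a (h x) \<noteq> stake a (h y)" "stake b (regroup (h x)) \<noteq> stake b (regroup (h y))"
      using False stream_eq_iff_stake[of "h x" "h y"] stream_eq_iff_stake[of "regroup (h x)" "regroup (h y)"] by blast
    from this[THEN ex_first_difference] obtain k c
      where k: "stake k (h x) = stake k (h y)" "h x !! k \<noteq> h y !! k"
        and c: "stake c (regroup (h x)) = stake c (regroup (h y))" "regroup (h x) !! c \<noteq> regroup (h y) !! c"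
      by blast
    define d where "d = sizeK (stake k (h x))"
    define d' where "d' = sizeF (stake c (regroup (h x)))"
    have "stake (Suc c) (regroup (h x)) \<noteq> stake (Suc c) (regroup (h y))"
      using c by (simp add: stake_Suc del: stake.simps)
    then have "\<not> d' + 8 \<le> d"
      unfolding d_def d'_def using regroup_agree[OF h(1)[OF xy(1)] k(1), of c] by blast
    then have "d \<le> d' + 8" by simp
    then have "\<sigma> ^ (d' + 8) \<le> \<sigma> ^ d" using \<sigma> by (intro power_decreasing) auto
    have "dist (f x) (f y) \<le> E * \<sigma> ^ d'"
      using TF(7)[OF regroup_in_seqs[OF h(1)[OF xy(1)]] regroup_in_seqs[OF h(1)[OF xy(2)]] c(1)]
      by (simp add: f_def d'_def weight_powers)
    also have "\<sigma> ^ d' \<le> \<sigma> ^ d / \<sigma> ^ 8"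
      using \<open>\<sigma> ^ (d' + 8) \<le> \<sigma> ^ d\<close> \<sigma> by (simp add: power_add field_simps)
    also have "\<delta> * \<sigma> ^ d \<le> dist x y"
      using TK(8)[OF h(1)[OF xy(1)] h(1)[OF xy(2)] k] h(2) xy by (simp add: d_def weight_powers)
    then have "\<sigma> ^ d \<le> dist x y / \<delta>" using TK(6) by (simp add: field_simps)
    finally have "dist (f x) (f y) \<le> E * (dist x y / \<delta> / \<sigma> ^ 8)"
      using TF(5) \<sigma> by (simp add: divide_right_mono)
    then show ?thesis by (simp add: L_def mult.commute)
  qed
  have LK: "L-lipschitz_on K f" using lip L by (intro lipschitz_onI) auto
  have "compact (f ` K)"
    using lipschitz_on_continuous_on[OF LK] TK(3) by (rule compact_continuous_image)
  then have cl: "closed (f ` K)" by (rule compact_imp_closed)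
  have "F \<subseteq> f ` K"
  proof
    fix z assume "z \<in> F"
    then obtain y where y: "y \<in> seqs 5" "z = \<pi>' y" using TF(4) by (auto simp: bij_betw_def)
    have "\<exists>\<omega>\<in>seqs 2. stake k (regroup \<omega>) = stake k y" for k
      using regroup_dense[OF set_stake[OF y(1)], of k] by simp
    then obtain a where a: "\<And>k. a k \<in> seqs 2" "\<And>k. stake k (regroup (a k)) = stake k y" by metis
    have "(\<lambda>k. E * weight (\<lambda>j. \<sigma> ^ expF j) (stake k y)) \<longlonglongrightarrow> E * 0"
      using TF(2) y(1) by (intro tendsto_mult_left weight_stake_tendsto_0[of 5]) auto
    moreover have "dist (\<pi>' (regroup (a k))) z \<le> E * weight (\<lambda>j. \<sigma> ^ expF j) (stake k y)" for k
      using TF(7)[OF regroup_in_seqs[OF a(1)] y(1) a(2)] by (simp only: a(2) y(2))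
    ultimately have "(\<lambda>k. dist (\<pi>' (regroup (a k))) z) \<longlonglongrightarrow> 0"
      using tendsto_sandwich[of "\<lambda>_. 0" "\<lambda>k. dist (\<pi>' (regroup (a k))) z" sequentially
          "\<lambda>k. E * weight (\<lambda>j. \<sigma> ^ expF j) (stake k y)" 0]
      by simp
    then have lim: "(\<lambda>k. \<pi>' (regroup (a k))) \<longlonglongrightarrow> z" by (rule tendsto_dist_iff[THEN iffD2])
    have mem: "\<pi>' (regroup (a k)) \<in> f ` K" for k
      using \<pi>K[OF a(1)] h\<pi>[OF a(1)] by (intro image_eqI[of _ _ "\<pi> (a k)"]) (simp_all add: f_def)
    show "z \<in> f ` K" by (rule closed_sequentially[OF cl mem lim])
  qed
  then have "f ` K = F" using fF by blast
  moreover have "lipschitz_map K F f" unfolding lipschitz_map_def using LK fF by blast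
  ultimately show ?thesis by blast
qed

section \<open>Clopen sets and additivity of the content\<close>

text \<open>The unions of cylinders of level \<open>k\<close>.\<close>

definition open_at :: "nat \<Rightarrow> nat \<Rightarrow> nat stream set \<Rightarrow> bool" where
  "open_at m k A \<longleftrightarrow> A \<subseteq> seqs m \<and> (\<forall>y\<in>A. \<forall>y'\<in>seqs m. stake k y = stake k y' \<longrightarrow> y' \<in> A)"

lemma open_at_mono: "open_at m k A \<Longrightarrow> k \<le> l \<Longrightarrow> open_at m l A"
  unfolding open_at_def using stake_eq_mono by blast

text \<open>Below level \<open>k\<close> the set \<open>A\<close> contains all extensions of its words, so the
level sums are stationary.\<close>

lemma (in prob_vector) level_sum_open_at:
  assumes op: "open_at n k A"
  shows "stream_content x A = level_sum x A k"
proof -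
  have A: "A \<subseteq> seqs n" using op by (simp add: open_at_def)
  have step: "level_sum x A (Suc l) = level_sum x A l" if "k \<le> l" for l
  proof -
    have op': "open_at n l A" using op that by (rule open_at_mono)
    have "stake (Suc l) ` A = (\<lambda>(w, i). w @ [i]) ` (stake l ` A \<times> {..<n})"
    proof (intro equalityI subsetI)
      fix v assume "v \<in> stake (Suc l) ` A"
      then obtain y where y: "y \<in> A" "v = stake l y @ [y !! l]" by (auto simp only: stake_Suc)
      then have "y !! l < n" using A by (auto simp: streams_iff_snth)
      then show "v \<in> (\<lambda>(w, i). w @ [i]) ` (stake l ` A \<times> {..<n})" using y by force
    next
      fix v assume "v \<in> (\<lambda>(w, i). w @ [i]) ` (stake l ` A \<times> {..<n})"
      then obtain y i where y: "y \<in> A" "i < n" "v = stake l y @ [i]" by auto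
      define y' where "y' = v @- sconst 0"
      have "y' \<in> seqs n"
        using y A set_stake[of y n l] zeros_in_seqs by (auto simp: y'_def shift_in_seqs_iff)
      moreover have "stake l y = stake l y'" by (simp add: y'_def y(3) stake_shift)
      ultimately have "y' \<in> A" using op' y(1) by (simp add: open_at_def)
      moreover have "length v = Suc l" using y(3) by simp
      then have "v = stake (Suc l) y'" using stake_shift_length[of v "sconst 0"] by (simp only: y'_def)
      ultimately show "v \<in> stake (Suc l) ` A" by blast
    qed
    then have "level_sum x A (Suc l) = (\<Sum>(w, i)\<in>stake l ` A \<times> {..<n}. weight x (w @ [i]))"
      unfolding level_sum_def by (simp only:) (subst sum.reindex, auto simp: inj_on_def case_prod_unfold)
    also have "\<dots> = (\<Sum>w\<in>stake l ` A. weight x w)"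
      unfolding sum.cartesian_product[symmetric] sum_weight_snoc ..
    finally show ?thesis by (simp add: level_sum_def)
  qed
  have const: "level_sum x A (l + k) = level_sum x A k" for l
    by (induction l) (simp_all add: step)
  have "(\<lambda>l. level_sum x A (l + k)) \<longlonglongrightarrow> stream_content x A"
    using level_sum_tendsto[OF A] by (rule LIMSEQ_ignore_initial_segment)
  then have "(\<lambda>l. level_sum x A k) \<longlonglongrightarrow> stream_content x A" by (simp only: const)
  then show ?thesis using LIMSEQ_unique tendsto_const by blast
qed

lemma (in prob_vector) stream_content_disjoint_UN:
  assumes I: "finite I" and op: "\<And>i. i \<in> I \<Longrightarrow> open_at n k (A i)"
    and disj: "\<And>i j. i \<in> I \<Longrightarrow> j \<in> I \<Longrightarrow> i \<noteq> j \<Longrightarrow> A i \<inter> A j = {}"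
  shows "stream_content x (\<Union>i\<in>I. A i) = (\<Sum>i\<in>I. stream_content x (A i))"
proof -
  have sub: "A i \<subseteq> seqs n" if "i \<in> I" for i using op[OF that] by (simp add: open_at_def)
  have "open_at n k (\<Union>i\<in>I. A i)"
    unfolding open_at_def
  proof (intro conjI ballI impI)
    show "(\<Union>i\<in>I. A i) \<subseteq> seqs n" using sub by blast
    fix y y' assume "y \<in> (\<Union>i\<in>I. A i)" "y' \<in> seqs n" "stake k y = stake k y'"
    then obtain i where i: "i \<in> I" "y \<in> A i" by blast
    have "y' \<in> A i" using op[OF i(1)] i(2) \<open>y' \<in> seqs n\<close> \<open>stake k y = stake k y'\<close> by (simp add: open_at_def)
    then show "y' \<in> (\<Union>i\<in>I. A i)" using i(1) by blast
  qed
  then have "stream_content x (\<Union>i\<in>I. A i) = level_sum x (\<Union>i\<in>I. A i) k" by (rule level_sum_open_at)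
  also have "\<dots> = (\<Sum>w\<in>(\<Union>i\<in>I. stake k ` A i). weight x w)" by (simp add: level_sum_def image_UN)
  also have "\<dots> = (\<Sum>i\<in>I. \<Sum>w\<in>stake k ` A i. weight x w)"
  proof (rule sum.UNION_disjoint[OF I])
    show "\<forall>i\<in>I. finite (stake k ` A i)" using finite_prefixes[OF sub] by blast
    show "\<forall>i\<in>I. \<forall>j\<in>I. i \<noteq> j \<longrightarrow> stake k ` A i \<inter> stake k ` A j = {}"
    proof (intro ballI impI)
      fix i j assume ij: "i \<in> I" "j \<in> I" "i \<noteq> j"
      show "stake k ` A i \<inter> stake k ` A j = {}"
      proof (rule ccontr)
        assume "stake k ` A i \<inter> stake k ` A j \<noteq> {}"
        then obtain w where "w \<in> stake k ` A i" "w \<in> stake k ` A j" by blast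
        then obtain y y' where "y \<in> A i" "y' \<in> A j" "stake k y' = stake k y" by (elim imageE) simp
        then have "y \<in> A j" using op[OF ij(2)] sub[OF ij(1)] by (auto simp: open_at_def)
        then show False using disj[OF ij] \<open>y \<in> A i\<close> by blast
      qed
    qed
  qed
  also have "\<dots> = (\<Sum>i\<in>I. stream_content x (A i))"
    using level_sum_open_at[OF op] by (intro sum.cong refl) (simp add: level_sum_def)
  finally show ?thesis .
qed

section \<open>The ring generated by the square root of five\<close>

definition sqrt5_ring :: "real set" where
  "sqrt5_ring = {of_int a + of_int b * sqrt 5 | a b. True}"

lemma sqrt5_ring_closed:
  shows sqrt5_ring_int: "of_int a \<in> sqrt5_ring"
    and sqrt5_ring_sqrt: "sqrt 5 \<in> sqrt5_ring"
    and sqrt5_ring_add: "s \<in> sqrt5_ring \<Longrightarrow> t \<in> sqrt5_ring \<Longrightarrow> s + t \<in> sqrt5_ring"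
    and sqrt5_ring_diff: "s \<in> sqrt5_ring \<Longrightarrow> t \<in> sqrt5_ring \<Longrightarrow> s - t \<in> sqrt5_ring"
    and sqrt5_ring_mult: "s \<in> sqrt5_ring \<Longrightarrow> t \<in> sqrt5_ring \<Longrightarrow> s * t \<in> sqrt5_ring"
proof -
  show "of_int a \<in> sqrt5_ring" unfolding sqrt5_ring_def
    by (rule CollectI, rule exI[of _ a], rule exI[of _ 0]) simp
  show "sqrt 5 \<in> sqrt5_ring" unfolding sqrt5_ring_def
    by (rule CollectI, rule exI[of _ 0], rule exI[of _ 1]) simp
  assume "s \<in> sqrt5_ring" "t \<in> sqrt5_ring"
  then obtain a b c d where st: "s = of_int a + of_int b * sqrt 5" "t = of_int c + of_int d * sqrt 5"
    by (auto simp: sqrt5_ring_def)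
  show "s + t \<in> sqrt5_ring" unfolding sqrt5_ring_def
    by (rule CollectI, rule exI[of _ "a + c"], rule exI[of _ "b + d"]) (simp add: st algebra_simps)
  show "s - t \<in> sqrt5_ring" unfolding sqrt5_ring_def
    by (rule CollectI, rule exI[of _ "a - c"], rule exI[of _ "b - d"]) (simp add: st algebra_simps)
  show "s * t \<in> sqrt5_ring" unfolding sqrt5_ring_def
    by (rule CollectI, rule exI[of _ "a * c + 5 * b * d"], rule exI[of _ "a * d + b * c"])
      (simp add: st algebra_simps)
qed

lemma sqrt5_ring_power: "s \<in> sqrt5_ring \<Longrightarrow> s ^ k \<in> sqrt5_ring"
  using sqrt5_ring_int[of 1] by (induction k) (auto intro: sqrt5_ring_mult)

lemma sqrt5_ring_sum: "(\<And>i. i \<in> I \<Longrightarrow> f i \<in> sqrt5_ring) \<Longrightarrow> sum f I \<in> sqrt5_ring"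
  using sqrt5_ring_int[of 0] by (induction I rule: infinite_finite_induct) (auto intro: sqrt5_ring_add)

lemma gold_cube_ring: "gold ^ 3 \<in> sqrt5_ring"
  unfolding gold_cube using sqrt5_ring_diff[OF sqrt5_ring_sqrt sqrt5_ring_int[of 2]] by simp

lemma gold_sizeF_ring: "gold ^ sizeF w \<in> sqrt5_ring"
proof -
  obtain t where "sizeF w = 3 * t" using sizeF_dvd[of w] by blast
  then show ?thesis using sqrt5_ring_power[OF gold_cube_ring, of t] by (simp add: power_mult)
qed

lemma odd_square_mod_8: "odd a \<Longrightarrow> a * a mod 8 = (1 :: int)"
proof -
  assume "odd a"
  then obtain k where a: "a = 2 * k + 1" by (rule oddE)
  have "even (k * (k + 1))" by simp
  then obtain j where j: "k * (k + 1) = 2 * j" by blast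
  have "a * a = 4 * (k * (k + 1)) + 1" by (simp add: a algebra_simps)
  also have "\<dots> = 8 * j + 1" by (simp add: j)
  finally show ?thesis by simp
qed

text \<open>Otherwise \<open>5 * c ^ 2 = d ^ 2\<close> with odd integers \<open>c\<close> and \<open>d\<close>. But
odd squares are 1 modulo 8.\<close>

lemma gold_not_in_ring: "gold \<notin> sqrt5_ring"
proof
  assume "gold \<in> sqrt5_ring"
  then obtain a b where "gold = of_int a + of_int b * sqrt 5" by (auto simp: sqrt5_ring_def)
  then have "sqrt 5 * of_int (1 - 2 * b) = of_int (2 * a + 1)" by (simp add: gold_def algebra_simps)
  then have "(sqrt 5 * of_int (1 - 2 * b)) ^ 2 = of_int (2 * a + 1) ^ 2" by simp
  then have "5 * of_int (1 - 2 * b) ^ 2 = (of_int (2 * a + 1) ^ 2 :: real)"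
    by (simp only: power_mult_distrib) simp
  then have "of_int (5 * ((1 - 2 * b) * (1 - 2 * b))) = (of_int ((2 * a + 1) * (2 * a + 1)) :: real)"
    by (simp only: of_int_mult power2_eq_square of_int_numeral)
  then have eq: "5 * ((1 - 2 * b) * (1 - 2 * b)) = (2 * a + 1) * (2 * a + 1)" by (simp only: of_int_eq_iff)
  have "(1 - 2 * b) * (1 - 2 * b) mod 8 = 1" "(2 * a + 1) * (2 * a + 1) mod 8 = 1"
    by (rule odd_square_mod_8, simp)+
  then show False using arg_cong[OF eq, of "\<lambda>x. x mod 8"] by presburger
qed

lemma gold_power_lin: "\<exists>a b :: int. gold ^ k = of_int a + of_int b * gold"
proof (induction k)
  case 0
  show ?case by (rule exI[of _ 1], rule exI[of _ 0]) simp
next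
  case (Suc k)
  then obtain a b :: int where "gold ^ k = of_int a + of_int b * gold" by blast
  then have "gold ^ Suc k = of_int a * gold + of_int b * gold ^ 2" by (simp add: algebra_simps power2_eq_square)
  also have "\<dots> = of_int b + of_int (a - b) * gold" by (simp add: gold_sq algebra_simps)
  finally show ?case by blast
qed

section \<open>The golden sets are not Lipschitz equivalent\<close>

text \<open>A Lipschitz equivalence between the golden sets, on addresses: up to an error \<open>C\<close> in the
sizes, which stands for the multiplicative constants, a common prefix of two streams and a common prefix of
their images determine each other.\<close>

locale gold_bilipschitz =
  fixes h :: "nat stream \<Rightarrow> nat stream" and C :: nat
  assumes bij: "bij_betw h (seqs 2) (seqs 5)"
    and forward: "\<omega> \<in> seqs 2 \<Longrightarrow> \<omega>' \<in> seqs 2 \<Longrightarrow> stake k \<omega> = stake k \<omega>' \<Longrightarrow>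
      sizeF (stake l (h \<omega>)) + C \<le> sizeK (stake k \<omega>) \<Longrightarrow> stake l (h \<omega>) = stake l (h \<omega>')"
    and backward: "\<omega> \<in> seqs 2 \<Longrightarrow> \<omega>' \<in> seqs 2 \<Longrightarrow> stake l (h \<omega>) = stake l (h \<omega>') \<Longrightarrow>
      sizeK (stake k \<omega>) + C \<le> sizeF (stake l (h \<omega>)) \<Longrightarrow> stake k \<omega> = stake k \<omega>'"
begin

sublocale F: prob_vector 5 "\<lambda>j. gold ^ expF j" by (rule prob_vector_F)

definition cyl_image :: "nat list \<Rightarrow> nat stream set" where
  "cyl_image v = h ` (@-) v ` seqs 2"

definition mass :: "nat list \<Rightarrow> real" where
  "mass v = stream_content (\<lambda>j. gold ^ expF j) (cyl_image v)"

lemma h_in: "\<omega> \<in> seqs 2 \<Longrightarrow> h \<omega> \<in> seqs 5"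
  using bij_betwE[OF bij] by blast

lemma cyl_sub: assumes "set v \<subseteq> {..<2}" shows "cyl_image v \<subseteq> seqs 5"
  using assms by (auto simp: cyl_image_def shift_in_seqs_iff intro!: h_in)

lemma cyl_open:
  assumes v: "set v \<subseteq> {..<2}" and k: "sizeK v + C \<le> 3 * k"
  shows "open_at 5 k (cyl_image v)"
  unfolding open_at_def
proof (intro conjI ballI impI)
  show "cyl_image v \<subseteq> seqs 5" using v by (rule cyl_sub)
  fix y y' assume y: "y \<in> cyl_image v" "y' \<in> seqs 5" "stake k y = stake k y'"
  obtain \<eta> where \<eta>: "\<eta> \<in> seqs 2" "y = h (v @- \<eta>)" using y(1) by (auto simp: cyl_image_def)
  obtain \<omega>' where \<omega>': "\<omega>' \<in> seqs 2" "y' = h \<omega>'" using y(2) bij by (auto simp: bij_betw_def)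
  have \<omega>: "v @- \<eta> \<in> seqs 2" using v \<eta>(1) by (simp add: shift_in_seqs_iff)
  have "sizeK (stake (length v) (v @- \<eta>)) + C \<le> sizeF (stake k (h (v @- \<eta>)))"
    using k sizeF_ge[of "stake k (h (v @- \<eta>))"] by simp
  from backward[OF \<omega> \<omega>'(1) y(3)[unfolded \<eta>(2) \<omega>'(2)] this]
  have "stake (length v) \<omega>' = v" by simp
  then have "\<omega>' = v @- sdrop (length v) \<omega>'" using stake_sdrop[of "length v" \<omega>'] by simp
  then show "y' \<in> cyl_image v" unfolding cyl_image_def \<omega>'(2) using sdrop_in_seqs[OF \<omega>'(1), of "length v"] by blast
qed

lemma cyl_disjoint:
  assumes "set v \<subseteq> {..<2}" "set w \<subseteq> {..<2}" "length v = length w" "v \<noteq> w"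
  shows "cyl_image v \<inter> cyl_image w = {}"
proof (rule ccontr)
  assume "cyl_image v \<inter> cyl_image w \<noteq> {}"
  then obtain \<eta> \<eta>' where *: "\<eta> \<in> seqs 2" "\<eta>' \<in> seqs 2" "h (v @- \<eta>) = h (w @- \<eta>')"
    by (auto simp: cyl_image_def)
  have "v @- \<eta> = w @- \<eta>'"
    using bij_betw_imp_inj_on[OF bij] *(3) by (rule inj_onD) (use * assms in \<open>simp_all add: shift_in_seqs_iff\<close>)
  then have "stake (length v) (v @- \<eta>) = stake (length w) (w @- \<eta>')" using assms(3) by simp
  then show False using assms(4) by simp
qed

lemma cyl_split: assumes "set v \<subseteq> {..<2}" shows "cyl_image v = (\<Union>w\<in>words 2 q. cyl_image (v @ w))"
proof (intro equalityI subsetI)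
  fix y assume "y \<in> cyl_image v"
  then obtain \<eta> where \<eta>: "\<eta> \<in> seqs 2" "y = h (v @- \<eta>)" by (auto simp: cyl_image_def)
  have "v @- \<eta> = (v @ stake q \<eta>) @- sdrop q \<eta>" by (simp add: stake_sdrop)
  then have "y \<in> cyl_image (v @ stake q \<eta>)" unfolding cyl_image_def \<eta>(2) using sdrop_in_seqs[OF \<eta>(1), of q] by blast
  then show "y \<in> (\<Union>w\<in>words 2 q. cyl_image (v @ w))" using stake_in_words[OF \<eta>(1), of q] by blast
next
  fix y assume "y \<in> (\<Union>w\<in>words 2 q. cyl_image (v @ w))"
  then obtain w \<eta> where w: "w \<in> words 2 q" "\<eta> \<in> seqs 2" "y = h (v @- (w @- \<eta>))" by (auto simp: cyl_image_def)
  then have "w @- \<eta> \<in> seqs 2" using words_set[OF w(1)] by (simp add: shift_in_seqs_iff)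
  then show "y \<in> cyl_image v" unfolding cyl_image_def w(3) by blast
qed

text \<open>The longest prefix of the image whose size is at most that of \<open>v\<close>, minus \<open>C\<close>,
is common to the image of the whole cylinder. A letter has size at most 6, so at most 5 is lost by rounding.\<close>

lemma cyl_prefix:
  assumes v: "set v \<subseteq> {..<2}" and large: "C \<le> sizeK v"
  shows "\<exists>w d. set w \<subseteq> {..<5} \<and> d < 6 \<and> sizeF w + C + d = sizeK v \<and> (\<forall>y\<in>cyl_image v. stake (length w) y = w)"
proof -
  have z: "v @- sconst 0 \<in> seqs 2" using v by (auto simp: shift_in_seqs_iff intro: sconst_streams)
  define y0 where "y0 = h (v @- sconst 0)"
  define P where "P l \<longleftrightarrow> sizeF (stake l y0) + C \<le> sizeK v" for l
  have P0: "P 0" using large by (simp add: P_def)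
  have bound: "l \<le> sizeK v" if "P l" for l
    using that sizeF_ge[of "stake l y0"] by (simp add: P_def)
  define l where "l = (GREATEST l. P l)"
  have l: "P l" unfolding l_def using P0 bound by (rule GreatestI_nat)
  have "\<not> P (Suc l)"
  proof
    assume "P (Suc l)"
    then have "Suc l \<le> l" unfolding l_def using bound by (intro Greatest_le_nat) auto
    then show False by simp
  qed
  moreover have "sizeF (stake (Suc l) y0) \<le> sizeF (stake l y0) + 6"
    by (simp add: stake_Suc expF_def del: stake.simps)
  ultimately have small: "sizeK v < sizeF (stake l y0) + C + 6" by (simp add: P_def)
  have "stake l y = stake l y0" if "y \<in> cyl_image v" for y
  proof -
    from that obtain \<eta> where \<eta>: "\<eta> \<in> seqs 2" "y = h (v @- \<eta>)" by (auto simp: cyl_image_def)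
    have "v @- \<eta> \<in> seqs 2" using v \<eta>(1) by (simp add: shift_in_seqs_iff)
    from forward[OF z this, of "length v" l] l show ?thesis by (simp add: y0_def \<eta>(2) P_def)
  qed
  moreover have "set (stake l y0) \<subseteq> {..<5}" unfolding y0_def by (intro set_stake h_in z)
  ultimately show ?thesis using l small
    by (intro exI[of _ "stake l y0"] exI[of _ "sizeK v - (sizeF (stake l y0) + C)"]) (auto simp: P_def)
qed

text \<open>The image of a cylinder is a finite union of cylinders of \<open>F\<close>, whose masses are powers of
\<open>gold ^ 3 = sqrt 5 - 2\<close>.\<close>

lemma mass_ring: assumes "set v \<subseteq> {..<2}" shows "mass v \<in> sqrt5_ring"
proof -
  have "mass v = level_sum (\<lambda>j. gold ^ expF j) (cyl_image v) (sizeK v + C)"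
    unfolding mass_def using assms by (intro F.level_sum_open_at cyl_open) auto
  then show ?thesis
    unfolding level_sum_def weight_powers by (auto intro: sqrt5_ring_sum gold_sizeF_ring)
qed

lemma mass_split: assumes "set v \<subseteq> {..<2}" shows "mass v = (\<Sum>w\<in>words 2 q. mass (v @ w))"
  unfolding mass_def
proof (subst cyl_split[OF assms, of q], rule F.stream_content_disjoint_UN[OF finite_words])
  fix w assume w: "w \<in> words 2 q"
  show "open_at 5 (sizeK v + 2 * q + C) (cyl_image (v @ w))"
    using assms words_set[OF w] sizeK_le[of w] words_length[OF w] by (intro cyl_open) auto
  fix w' assume w': "w' \<in> words 2 q" "w \<noteq> w'"
  then show "cyl_image (v @ w) \<inter> cyl_image (v @ w') = {}"
    using assms words_set[OF w] words_set[OF w'(1)] words_length[OF w] words_length[OF w'(1)]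
    by (intro cyl_disjoint) auto
qed

definition ratio :: "nat list \<Rightarrow> real" where "ratio v = mass v / gold ^ sizeK v"

definition large_words :: "nat list set" where
  "large_words = {v. set v \<subseteq> {..<2} \<and> C \<le> sizeK v}"

text \<open>After removing the common prefix \<open>w\<close> of \<open>cyl_prefix\<close>, the image is determined
by a set of words of bounded length, for which there are only finitely many choices.\<close>

lemma finite_ratios: "finite (ratio ` large_words)"
proof (rule finite_subset)
  (* q letters have size at least 3 * q, which exceeds the missing size C + d (d < 6) by more than C;
     this is what the backward condition needs *)
  let ?q = "2 * C + 6"
  let ?S = "(\<lambda>(W, d). (\<Sum>w\<in>W. gold ^ sizeF w) / gold ^ (C + d)) ` (Pow (words 5 ?q) \<times> {..<6})"
  show "ratio ` large_words \<subseteq> ?S"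
  proof
    fix t assume "t \<in> ratio ` large_words"
    then obtain v where v: "set v \<subseteq> {..<2}" "C \<le> sizeK v" "t = ratio v" by (auto simp: large_words_def)
    obtain w d where w: "set w \<subseteq> {..<5}" "d < 6" "sizeF w + C + d = sizeK v"
      "\<forall>y\<in>cyl_image v. stake (length w) y = w" using cyl_prefix[OF v(1,2)] by blast
    define B where "B = sdrop (length w) ` cyl_image v"
    define W where "W = stake ?q ` B"
    have B: "B \<subseteq> seqs 5" using cyl_sub[OF v(1)] by (auto simp: B_def intro: sdrop_in_seqs)
    have cB: "cyl_image v = (@-) w ` B"
    proof -
      have "y = w @- sdrop (length w) y" if "y \<in> cyl_image v" for y
        using stake_sdrop[of "length w" y] w(4) that by simp
      then show ?thesis unfolding B_def image_image by force
    qed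
    have opB: "open_at 5 ?q B"
      unfolding open_at_def
    proof (intro conjI ballI impI)
      fix b b' assume b: "b \<in> B" "b' \<in> seqs 5" "stake ?q b = stake ?q b'"
      have "w @- b \<in> cyl_image v" using b(1) cB by blast
      then obtain \<eta> where \<eta>: "\<eta> \<in> seqs 2" "w @- b = h (v @- \<eta>)" by (auto simp: cyl_image_def)
      have \<omega>: "v @- \<eta> \<in> seqs 2" using v \<eta>(1) by (simp add: shift_in_seqs_iff)
      have "w @- b' \<in> seqs 5" using w(1) b(2) by (simp add: shift_in_seqs_iff)
      then obtain \<omega>' where \<omega>': "\<omega>' \<in> seqs 2" "w @- b' = h \<omega>'" using bij by (auto simp: bij_betw_def)
      have eq: "stake (length w + ?q) (h (v @- \<eta>)) = stake (length w + ?q) (h \<omega>')"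
        unfolding \<eta>(2)[symmetric] \<omega>'(2)[symmetric] using b(3) by (simp add: stake_shift del: stake.simps)
      have "stake (length w + ?q) (h (v @- \<eta>)) = w @ stake ?q b"
        unfolding \<eta>(2)[symmetric] by (simp add: stake_shift del: stake.simps)
      then have "sizeK (stake (length v) (v @- \<eta>)) + C \<le> sizeF (stake (length w + ?q) (h (v @- \<eta>)))"
        using w(2,3) sizeF_ge[of "stake ?q b"] by simp
      from backward[OF \<omega> \<omega>'(1) eq this] have "stake (length v) \<omega>' = v" by simp
      then have "\<omega>' = v @- sdrop (length v) \<omega>'" using stake_sdrop[of "length v" \<omega>'] by simp
      then have "w @- b' \<in> cyl_image v" unfolding \<omega>'(2) cyl_image_def using sdrop_in_seqs[OF \<omega>'(1), of "length v"] by blast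
      then show "b' \<in> B" unfolding cB by auto
    qed (rule B)
    have "mass v = gold ^ sizeF w * stream_content (\<lambda>j. gold ^ expF j) B"
      unfolding mass_def cB using F.stream_content_shift[OF B w(1)] by (simp add: weight_powers)
    also have "stream_content (\<lambda>j. gold ^ expF j) B = (\<Sum>w\<in>W. gold ^ sizeF w)"
      using F.level_sum_open_at[OF opB] by (simp add: level_sum_def W_def weight_powers)
    finally have "t = gold ^ sizeF w * (\<Sum>w\<in>W. gold ^ sizeF w) / gold ^ (sizeF w + (C + d))"
      unfolding v(3) ratio_def w(3)[symmetric] by (simp add: add.assoc)
    then have "t = (\<Sum>w\<in>W. gold ^ sizeF w) / gold ^ (C + d)"
      using gold_bounds by (simp add: power_add)
    moreover have "W \<subseteq> words 5 ?q" unfolding W_def using B by (auto intro: stake_in_words)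
    ultimately show "t \<in> ?S" using w(2) by (intro image_eqI[of _ _ "(W, d)"]) auto
  qed
qed simp

text \<open>Let \<open>v\<close> have maximal ratio. This ratio is a weighted average of the ratios of the
subcylinders, so all of them are equal to it. Thus \<open>\<alpha> = mass v\<close> and
\<open>\<alpha> * gold = mass (v @ [0])\<close> lie in \<open>\<int>[\<surd>5]\<close>. On the other hand
the image of \<open>v\<close> contains a whole cylinder \<open>J\<close> of \<open>F\<close>, which is a
union of images of subcylinders of \<open>v\<close>, so \<open>gold ^ sizeF J = \<alpha> * \<beta>\<close>
with \<open>\<beta>\<close> in \<open>\<int>[gold]\<close>. Multiplying by \<open>gold\<close> gives
\<open>gold * gold ^ sizeF J \<in> \<int>[\<surd>5]\<close>, and \<open>gold ^ sizeF J\<close> is a unit of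
this ring.\<close>

theorem no_bilipschitz_coding: False
proof -
  have gp: "0 < gold ^ k" for k using gold_bounds by simp
  have "replicate C 0 \<in> large_words" using sizeK_ge[of "replicate C 0"] by (auto simp: large_words_def)
  then have ne: "ratio ` large_words \<noteq> {}" by blast
  define \<mu> where "\<mu> = Max (ratio ` large_words)"
  have "\<mu> \<in> ratio ` large_words" unfolding \<mu>_def using finite_ratios ne by (rule Max_in)
  then obtain v where v: "v \<in> large_words" "ratio v = \<mu>" by blast
  have vs: "set v \<subseteq> {..<2}" "C \<le> sizeK v" using v(1) by (auto simp: large_words_def)
  have le: "mass w \<le> \<mu> * gold ^ sizeK w" if "w \<in> large_words" for w
  proof -
    have "ratio w \<le> \<mu>" unfolding \<mu>_def using finite_ratios that by (intro Max_ge) auto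
    then show ?thesis unfolding ratio_def using gp by (simp add: divide_le_eq)
  qed
  have mv: "mass v = \<mu> * gold ^ sizeK v"
    using v(2) less_imp_neq[OF gp[of "sizeK v"]] by (simp add: ratio_def divide_eq_eq split: if_splits)
  interpret K: prob_vector 2 "\<lambda>i. gold ^ expK i" by (rule prob_vector_K)
  have eq: "mass (v @ w) = \<mu> * gold ^ sizeK (v @ w)" if w: "w \<in> words 2 q" for w q
  proof -
    have large: "v @ u \<in> large_words" if "u \<in> words 2 q" for u
      using vs words_set[OF that] by (auto simp: large_words_def)
    have "(\<Sum>u\<in>words 2 q. \<mu> * gold ^ sizeK (v @ u)) = \<mu> * gold ^ sizeK v * (\<Sum>u\<in>words 2 q. gold ^ sizeK u)"
      by (simp add: power_add sum_distrib_left mult.assoc)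
    also have "(\<Sum>u\<in>words 2 q. gold ^ sizeK u) = 1" using K.sum_words[of q] by (simp only: weight_powers)
    finally have "(\<Sum>u\<in>words 2 q. \<mu> * gold ^ sizeK (v @ u) - mass (v @ u)) = 0"
      using mass_split[OF vs(1), of q] mv by (simp add: sum_subtractf)
    then have "\<forall>u\<in>words 2 q. \<mu> * gold ^ sizeK (v @ u) - mass (v @ u) = 0"
      using le[OF large] by (subst (asm) sum_nonneg_eq_0_iff) auto
    then show ?thesis using w by simp
  qed
  define \<alpha> where "\<alpha> = mass v"
  have ratio: "mass (v @ w) = \<alpha> * gold ^ sizeK w" if "w \<in> words 2 q" for w q
    using eq[OF that] mv by (simp add: \<alpha>_def power_add)
  have \<alpha>: "\<alpha> \<in> sqrt5_ring" unfolding \<alpha>_def using vs(1) by (rule mass_ring)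
  have "[0] \<in> words 2 1" by (simp add: words_def)
  from ratio[OF this] have "\<alpha> * gold = mass (v @ [0])" by (simp add: expK_def)
  also have "\<dots> \<in> sqrt5_ring" using vs(1) by (intro mass_ring) auto
  finally have \<alpha>g: "\<alpha> * gold \<in> sqrt5_ring" .
  (* deep enough for the cylinder of J = stake l y0 to lie inside the image of the cylinder of v *)
  define l where "l = sizeK v + C"
  define y0 where "y0 = h (v @- sconst 0)"
  have z: "v @- sconst 0 \<in> seqs 2" using vs by (auto simp: shift_in_seqs_iff intro: sconst_streams)
  define J where "J = stake l y0"
  have y0: "y0 \<in> seqs 5" "y0 \<in> cyl_image v"
    unfolding y0_def cyl_image_def using h_in[OF z] by (simp_all add: sconst_streams)
  have Js: "set J \<subseteq> {..<5}" "length J = l" unfolding J_def using set_stake[OF y0(1)] by auto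
  have opv: "open_at 5 l (cyl_image v)" unfolding l_def using vs by (intro cyl_open) auto
  have Jsub: "(@-) J ` seqs 5 \<subseteq> cyl_image v"
  proof
    fix y assume "y \<in> (@-) J ` seqs 5"
    then obtain \<zeta> where "\<zeta> \<in> seqs 5" "y = J @- \<zeta>" by blast
    then have "y \<in> seqs 5" "stake l y0 = stake l y" using Js by (auto simp: shift_in_seqs_iff J_def stake_shift)
    then show "y \<in> cyl_image v" using opv y0(2) by (simp add: open_at_def)
  qed
  (* deep enough for the image of each subcylinder of v to lie in a single cylinder of level l *)
  define q where "q = 6 * l + C"
  have same: "stake l y = stake l y'" if w: "w \<in> words 2 q" and y: "y \<in> cyl_image (v @ w)" "y' \<in> cyl_image (v @ w)" for w y y'
  proof -
    obtain \<eta> \<eta>' where e: "\<eta> \<in> seqs 2" "\<eta>' \<in> seqs 2" "y = h ((v @ w) @- \<eta>)" "y' = h ((v @ w) @- \<eta>')"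
      using y by (auto simp: cyl_image_def)
    have in2: "(v @ w) @- \<eta> \<in> seqs 2" "(v @ w) @- \<eta>' \<in> seqs 2"
      using vs words_set[OF w] e by (auto simp: shift_in_seqs_iff)
    have "sizeF u \<le> 6 * length u" for u by (induction u) (auto simp: expF_def)
    from this[of "stake l y"] have "sizeF (stake l y) + C \<le> sizeK w"
      using sizeK_ge[of w] words_length[OF w] by (simp add: q_def)
    then have "sizeF (stake l (h ((v @ w) @- \<eta>))) + C \<le> sizeK (stake (length (v @ w)) ((v @ w) @- \<eta>))"
      unfolding stake_shift_length e(3)[symmetric] by simp
    from forward[OF in2 _ this] show ?thesis
      unfolding e(3,4) stake_shift_length by simp
  qed
  define G where "G = {w \<in> words 2 q. cyl_image (v @ w) \<subseteq> (@-) J ` seqs 5}"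
  have G: "(@-) J ` seqs 5 = (\<Union>w\<in>G. cyl_image (v @ w))"
  proof (intro equalityI subsetI)
    fix y assume y: "y \<in> (@-) J ` seqs 5"
    then have "y \<in> cyl_image v" using Jsub by blast
    then obtain w where w: "w \<in> words 2 q" "y \<in> cyl_image (v @ w)" using cyl_split[OF vs(1), of q] by blast
    have "stake l y = J" using y Js by (auto simp: stake_shift)
    have "y' \<in> (@-) J ` seqs 5" if y': "y' \<in> cyl_image (v @ w)" for y'
    proof -
      have "stake l y' = J" using same[OF w(1) y' w(2)] \<open>stake l y = J\<close> by simp
      then have "y' = J @- sdrop l y'" using stake_sdrop[of l y'] by simp
      moreover have "y' \<in> seqs 5" using y' cyl_sub[of "v @ w"] vs words_set[OF w(1)] by auto
      ultimately show ?thesis using sdrop_in_seqs[of y' 5 l] by blast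
    qed
    then show "y \<in> (\<Union>w\<in>G. cyl_image (v @ w))" using w by (auto simp: G_def)
  qed (auto simp: G_def)
  have Gw: "G \<subseteq> words 2 q" "finite G" by (auto simp: G_def intro: finite_subset[OF _ finite_words])
  have "stream_content (\<lambda>j. gold ^ expF j) ((@-) J ` seqs 5) = (\<Sum>w\<in>G. mass (v @ w))"
    unfolding G mass_def
  proof (rule F.stream_content_disjoint_UN[OF Gw(2)])
    fix w assume w: "w \<in> G"
    then have w2: "w \<in> words 2 q" using Gw by blast
    show "open_at 5 (sizeK v + 2 * q + C) (cyl_image (v @ w))"
      using vs words_set[OF w2] sizeK_le[of w] words_length[OF w2] by (intro cyl_open) auto
    fix w' assume w': "w' \<in> G" "w \<noteq> w'"
    then have w2': "w' \<in> words 2 q" using Gw by blast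
    show "cyl_image (v @ w) \<inter> cyl_image (v @ w') = {}"
      using vs words_set[OF w2] words_set[OF w2'] words_length[OF w2] words_length[OF w2'] w'(2)
      by (intro cyl_disjoint) auto
  qed
  also have "\<dots> = \<alpha> * (\<Sum>w\<in>G. gold ^ sizeK w)"
    unfolding sum_distrib_left using Gw(1) by (intro sum.cong refl ratio) blast
  finally have "stream_content (\<lambda>j. gold ^ expF j) ((@-) J ` seqs 5) = \<alpha> * (\<Sum>w\<in>G. gold ^ sizeK w)" .
  moreover have "stream_content (\<lambda>j. gold ^ expF j) ((@-) J ` seqs 5) = gold ^ sizeF J"
  proof -
    have "open_at 5 0 (seqs 5)" by (simp add: open_at_def)
    then have "stream_content (\<lambda>j. gold ^ expF j) (seqs 5) = level_sum (\<lambda>j. gold ^ expF j) (seqs 5) 0"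
      by (rule F.level_sum_open_at)
    moreover have "stake 0 ` seqs 5 = {[]}" using y0(1) by (auto simp: image_constant_conv)
    ultimately have "stream_content (\<lambda>j. gold ^ expF j) (seqs 5) = 1"
      by (simp only: level_sum_def) (simp add: weight_powers)
    then show ?thesis using F.stream_content_shift[OF order_refl Js(1)] by (simp add: weight_powers)
  qed
  ultimately have unit: "\<alpha> * (\<Sum>w\<in>G. gold ^ sizeK w) = gold ^ sizeF J" by simp
  have "\<exists>a b :: int. (\<Sum>w\<in>G. gold ^ sizeK w) = of_int a + of_int b * gold"
    using Gw(2)
  proof (induction G)
    case empty
    show ?case by (rule exI[of _ 0], rule exI[of _ 0]) simp
  next
    case (insert w G)
    obtain a b a' b' :: int where "(\<Sum>w\<in>G. gold ^ sizeK w) = of_int a + of_int b * gold"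
      "gold ^ sizeK w = of_int a' + of_int b' * gold"
      using insert.IH gold_power_lin[of "sizeK w"] by blast
    then show ?case
      using insert.hyps by (intro exI[of _ "a + a'"] exI[of _ "b + b'"]) (simp add: algebra_simps)
  qed
  then obtain a b :: int where ab: "(\<Sum>w\<in>G. gold ^ sizeK w) = of_int a + of_int b * gold" by blast
  have "gold * gold ^ sizeF J = of_int a * (\<alpha> * gold) + of_int b * (\<alpha> * gold ^ 2)"
    unfolding unit[symmetric] ab by (simp add: algebra_simps power2_eq_square)
  also have "\<dots> = of_int a * (\<alpha> * gold) + of_int b * (\<alpha> - \<alpha> * gold)" by (simp add: gold_sq algebra_simps)
  also have "\<dots> \<in> sqrt5_ring"
    by (rule sqrt5_ring_add[OF sqrt5_ring_mult[OF sqrt5_ring_int \<alpha>g]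
      sqrt5_ring_mult[OF sqrt5_ring_int sqrt5_ring_diff[OF \<alpha> \<alpha>g]]])
  finally have prod: "gold * gold ^ sizeF J \<in> sqrt5_ring" .
  obtain t where t: "sizeF J = 3 * t" using sizeF_dvd[of J] by blast
  have inv: "gold ^ 3 * (sqrt 5 + 2) = 1" by (simp add: gold_cube algebra_simps)
  have "(sqrt 5 + 2) ^ t \<in> sqrt5_ring"
    using sqrt5_ring_add[OF sqrt5_ring_sqrt sqrt5_ring_int[of 2]] by (intro sqrt5_ring_power) simp
  with prod have "gold * gold ^ sizeF J * (sqrt 5 + 2) ^ t \<in> sqrt5_ring" by (rule sqrt5_ring_mult)
  moreover have "gold * gold ^ sizeF J * (sqrt 5 + 2) ^ t = gold * (gold ^ 3 * (sqrt 5 + 2)) ^ t"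
    by (simp add: t power_mult power_mult_distrib mult.assoc)
  ultimately have "gold \<in> sqrt5_ring" by (simp add: inv)
  then show False using gold_not_in_ring by blast
qed

end

text \<open>Transported to addresses, the multiplicative constants of a Lipschitz equivalence are absorbed by an
additive constant \<open>C\<close> in the exponents of \<open>\<sigma>\<close>.\<close>

theorem gold_sets_not_equivalent:
  assumes \<sigma>: "0 < \<sigma>" "\<sigma> < 1"
    and tK: "tree_coding 2 (\<lambda>i. \<sigma> ^ expK i) \<pi> K D \<delta>" and tF: "tree_coding 5 (\<lambda>j. \<sigma> ^ expF j) \<pi>' F E \<epsilon>"
  shows "\<not> lipschitz_equivalent K F"
proof
  note TK = tree_codingD[OF tK] and TF = tree_codingD[OF tF]
  assume "lipschitz_equivalent K F"
  then obtain f c where f: "bij_betw f K F" and c: "0 < c"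
    and lo: "\<And>x y. x \<in> K \<Longrightarrow> y \<in> K \<Longrightarrow> inverse c * dist x y \<le> dist (f x) (f y)"
    and up: "\<And>x y. x \<in> K \<Longrightarrow> y \<in> K \<Longrightarrow> dist (f x) (f y) \<le> c * dist x y"
    unfolding lipschitz_equivalent_def by blast
  define h where "h \<omega> = inv_into (seqs 5) \<pi>' (f (\<pi> \<omega>))" for \<omega>
  have "bij_betw (inv_into (seqs 5) \<pi>' \<circ> (f \<circ> \<pi>)) (seqs 2) (seqs 5)"
    by (intro bij_betw_trans[OF _ bij_betw_inv_into[OF TF(4)]] bij_betw_trans[OF TK(4) f])
  then have bij: "bij_betw h (seqs 2) (seqs 5)" unfolding h_def o_def .
  have h_in: "h \<omega> \<in> seqs 5" if "\<omega> \<in> seqs 2" for \<omega> using bij_betwE[OF bij] that by blast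
  have \<pi>K: "\<pi> \<omega> \<in> K" if "\<omega> \<in> seqs 2" for \<omega> using bij_betwE[OF TK(4)] that by blast
  have \<pi>h: "\<pi>' (h \<omega>) = f (\<pi> \<omega>)" if "\<omega> \<in> seqs 2" for \<omega>
  proof -
    have "f (\<pi> \<omega>) \<in> F" using bij_betwE[OF f] \<pi>K[OF that] by blast
    then show ?thesis unfolding h_def by (rule bij_betw_inv_into_right[OF TF(4)])
  qed
  have "(\<lambda>k. c * (D + E) * \<sigma> ^ k) \<longlonglongrightarrow> c * (D + E) * 0"
    using \<sigma> by (intro tendsto_mult_left LIMSEQ_power_zero) auto
  then have "eventually (\<lambda>k. c * (D + E) * \<sigma> ^ k < min \<delta> \<epsilon>) sequentially"
    using TK(6) TF(6) by (intro order_tendstoD(2)) auto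
  then obtain C where C: "c * (D + E) * \<sigma> ^ C < min \<delta> \<epsilon>" by (auto simp: eventually_sequentially)
  have pos: "0 < \<sigma> ^ k" for k using \<sigma> by simp
  have shrink: "B * \<sigma> ^ a < m * \<sigma> ^ b" if "b + C \<le> a" "0 \<le> B" "B \<le> c * (D + E)" "min \<delta> \<epsilon> \<le> m" for a b B m
  proof -
    have "\<sigma> ^ a \<le> \<sigma> ^ (b + C)" using \<sigma> that(1) by (intro power_decreasing) auto
    then have "B * \<sigma> ^ a \<le> B * \<sigma> ^ (b + C)" using that(2) by (rule mult_left_mono)
    also have "\<dots> = (B * \<sigma> ^ C) * \<sigma> ^ b" by (simp add: power_add)
    also have "\<dots> \<le> (c * (D + E) * \<sigma> ^ C) * \<sigma> ^ b"
      using that(3) pos[of C] pos[of b] by (intro mult_right_mono) auto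
    also have "\<dots> < m * \<sigma> ^ b" using C that(4) pos[of b] by (intro mult_strict_right_mono) auto
    finally show ?thesis .
  qed
  have "gold_bilipschitz h C"
  proof (intro gold_bilipschitz.intro bij)
    fix \<omega> \<omega>' :: "nat stream" and k l
    assume \<omega>: "\<omega> \<in> seqs 2" "\<omega>' \<in> seqs 2" "stake k \<omega> = stake k \<omega>'"
      and size: "sizeF (stake l (h \<omega>)) + C \<le> sizeK (stake k \<omega>)"
    have "dist (\<pi>' (h \<omega>)) (\<pi>' (h \<omega>')) \<le> c * dist (\<pi> \<omega>) (\<pi> \<omega>')"
      using up[OF \<pi>K[OF \<omega>(1)] \<pi>K[OF \<omega>(2)]] by (simp only: \<pi>h[OF \<omega>(1)] \<pi>h[OF \<omega>(2)])
    also have "\<dots> \<le> c * (D * \<sigma> ^ sizeK (stake k \<omega>))"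
      using TK(7)[OF \<omega>] c by (intro mult_left_mono) (simp_all add: weight_powers)
    also have "\<dots> = (c * D) * \<sigma> ^ sizeK (stake k \<omega>)" by simp
    also have "\<dots> < \<epsilon> * \<sigma> ^ sizeF (stake l (h \<omega>))"
      using c TK(5) TF(5) by (intro shrink[OF size]) auto
    finally have "dist (\<pi>' (h \<omega>)) (\<pi>' (h \<omega>')) < \<epsilon> * weight (\<lambda>j. \<sigma> ^ expF j) (stake l (h \<omega>))"
      by (simp add: weight_powers)
    from tree_coding_separation[OF tF h_in[OF \<omega>(1)] h_in[OF \<omega>(2)] this]
    show "stake l (h \<omega>) = stake l (h \<omega>')" by (rule stake_eq_mono) simp
  next
    fix \<omega> \<omega>' :: "nat stream" and k l
    assume \<omega>: "\<omega> \<in> seqs 2" "\<omega>' \<in> seqs 2" "stake l (h \<omega>) = stake l (h \<omega>')"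
      and size: "sizeK (stake k \<omega>) + C \<le> sizeF (stake l (h \<omega>))"
    have "inverse c * dist (\<pi> \<omega>) (\<pi> \<omega>') \<le> dist (\<pi>' (h \<omega>)) (\<pi>' (h \<omega>'))"
      using lo[OF \<pi>K[OF \<omega>(1)] \<pi>K[OF \<omega>(2)]] by (simp only: \<pi>h[OF \<omega>(1)] \<pi>h[OF \<omega>(2)])
    then have "dist (\<pi> \<omega>) (\<pi> \<omega>') \<le> c * dist (\<pi>' (h \<omega>)) (\<pi>' (h \<omega>'))"
      using c by (simp add: inverse_eq_divide pos_divide_le_eq mult.commute)
    also have "\<dots> \<le> c * (E * \<sigma> ^ sizeF (stake l (h \<omega>)))"
      using TF(7)[OF h_in[OF \<omega>(1)] h_in[OF \<omega>(2)] \<omega>(3)] c by (intro mult_left_mono) (simp_all add: weight_powers)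
    also have "\<dots> = (c * E) * \<sigma> ^ sizeF (stake l (h \<omega>))" by simp
    also have "\<dots> < \<delta> * \<sigma> ^ sizeK (stake k \<omega>)"
      using c TK(5) TF(5) by (intro shrink[OF size]) auto
    finally have "dist (\<pi> \<omega>) (\<pi> \<omega>') < \<delta> * weight (\<lambda>i. \<sigma> ^ expK i) (stake k \<omega>)"
      by (simp add: weight_powers)
    from tree_coding_separation[OF tK \<omega>(1,2) this]
    show "stake k \<omega> = stake k \<omega>'" by (rule stake_eq_mono) simp
  qed
  then show False by (rule gold_bilipschitz.no_bilipschitz_coding)
qed

section \<open>Realisation in Euclidean space\<close>

text \<open>Disjoint subintervals of the unit interval, scaled copies of it, define a Cantor set as the
intersection of the iterates; it is then placed on a line. The space may have any dimension since the
similitudes extend to the whole space.\<close>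

lemma interval_attractor_exists:
  fixes e :: "'a::euclidean_space"
  assumes e: "norm e = 1" and n: "2 \<le> n"
    and r: "\<And>i. i < n \<Longrightarrow> 0 < r i \<and> r i < 1 \<and> 0 \<le> c i \<and> c i + r i \<le> 1"
    and disj: "\<And>i j. i < n \<Longrightarrow> j < n \<Longrightarrow> i < j \<Longrightarrow> c i + r i < c j"
  shows "\<exists>K. dust_like_ifs n r (\<lambda>i v. r i *\<^sub>R v + c i *\<^sub>R e) K"
proof -
  define f where "f i t = r i * t + c i" for i and t :: real
  define T where "T k = ((\<lambda>A. \<Union>i<n. f i ` A) ^^ k) {0..1}" for k
  have T0: "T 0 = {0..1}" and TS: "T (Suc k) = (\<Union>i<n. f i ` T k)" for k by (simp_all add: T_def)
  have f01: "f i t \<in> {0..1}" if "i < n" "t \<in> {0..1}" for i t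
  proof -
    have "0 \<le> r i * t" "r i * t \<le> r i * 1" using r[OF that(1)] that(2) by (auto intro!: mult_left_mono simp del: mult_1_right)
    then have "0 \<le> r i * t + c i" "r i * t + c i \<le> 1" using r[OF that(1)] by linarith+
    then show ?thesis by (simp add: f_def)
  qed
  have sub01: "T k \<subseteq> {0..1}" for k
  proof (induction k)
    case (Suc k)
    then show ?case unfolding TS using f01 by blast
  qed (simp add: T0)
  have comp: "compact (T k)" for k
  proof (induction k)
    case (Suc k)
    have "continuous_on (T k) (f i)" for i unfolding f_def by (intro continuous_intros)
    then show ?case unfolding TS using Suc by (intro compact_UN compact_continuous_image) auto
  qed (simp add: T0)
  have ne: "T k \<noteq> {}" for k
  proof (induction k)
    case (Suc k)
    then show ?case unfolding TS using n by (auto intro!: exI[of _ "0::nat"])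
  qed (simp add: T0)
  have dec1: "T (Suc k) \<subseteq> T k" for k
  proof (induction k)
    case 0
    show ?case using sub01[of 1] by (simp add: T0)
  next
    case (Suc k)
    then show ?case unfolding TS[of "Suc k"] TS[of k] by blast
  qed
  have dec: "T l \<subseteq> T k" if "k \<le> l" for k l using lift_Suc_antimono_le[of T, OF dec1 that] .
  define S where "S = (\<Inter>k. T k)"
  have S_ne: "S \<noteq> {}" unfolding S_def using compact_nest[of T, OF comp ne dec] by simp
  have S_comp: "compact S" unfolding S_def using comp by (intro compact_Inter) auto
  have inj: "i = j" if "i < n" "j < n" "t \<in> {0..1}" "u \<in> {0..1}" "f i t = f j u" for i j t u
  proof (rule ccontr)
    assume "i \<noteq> j"
    have b: "c i \<le> f i t" "f i t \<le> c i + r i" if "i < n" "t \<in> {0..1}" for i t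
      using r[OF that(1)] that(2) mult_left_mono[of t 1 "r i"] by (auto simp: f_def)
    show False
      using \<open>i \<noteq> j\<close> disj[of i j] disj[of j i] b[OF that(1,3)] b[OF that(2,4)] that by (cases "i < j") auto
  qed
  have S_eq: "S = (\<Union>i<n. f i ` S)"
  proof (intro equalityI subsetI)
    fix t assume t: "t \<in> S"
    then have "t \<in> T (Suc 0)" unfolding S_def by blast
    then obtain i u where i: "i < n" "u \<in> {0..1}" "t = f i u" unfolding TS T0 by blast
    have "u \<in> T k" for k
    proof -
      have "t \<in> T (Suc k)" using t unfolding S_def by blast
      then obtain j v where j: "j < n" "v \<in> T k" "t = f j v" unfolding TS by blast
      have "i = j" using inj[OF i(1) j(1) i(2) _, of v] sub01[of k] j i by auto
      then have "u = v" using i j r[OF i(1)] by (simp add: f_def)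
      then show ?thesis using j by simp
    qed
    then show "t \<in> (\<Union>i<n. f i ` S)" using i unfolding S_def by blast
  next
    fix t assume "t \<in> (\<Union>i<n. f i ` S)"
    then obtain i u where i: "i < n" "u \<in> S" "t = f i u" by blast
    have "t \<in> T k" for k
    proof -
      have "u \<in> T k" using i(2) unfolding S_def by blast
      then have "t \<in> T (Suc k)" unfolding TS using i by blast
      then show ?thesis using dec1 by blast
    qed
    then show "t \<in> S" unfolding S_def by blast
  qed
  define K where "K = (\<lambda>t. t *\<^sub>R e) ` S"
  define \<phi> where "\<phi> i v = r i *\<^sub>R v + c i *\<^sub>R e" for i v
  have \<phi>f: "\<phi> i (t *\<^sub>R e) = f i t *\<^sub>R e" for i t by (simp add: \<phi>_def f_def scaleR_left_distrib)
  have \<phi>K: "\<phi> i ` K = (\<lambda>t. t *\<^sub>R e) ` f i ` S" for i by (simp add: K_def image_image \<phi>f)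
  have "contractive_similitude (r i) (\<phi> i)" if "i < n" for i
    unfolding contractive_similitude_def
  proof (intro conjI allI)
    fix x y
    have "\<phi> i x - \<phi> i y = r i *\<^sub>R (x - y)" by (simp add: \<phi>_def scaleR_diff_right)
    then show "dist (\<phi> i x) (\<phi> i y) = r i * dist x y" using r[OF that] by (simp add: dist_norm)
  qed (use r[OF that] in auto)
  moreover have "K \<noteq> {}" using S_ne by (simp add: K_def)
  moreover have "compact K"
    unfolding K_def using S_comp by (intro compact_continuous_image continuous_intros)
  moreover have "K = (\<Union>i<n. \<phi> i ` K)"
    unfolding \<phi>K by (subst (1) K_def, subst S_eq) blast
  moreover have "disjoint_family_on (\<lambda>i. \<phi> i ` K) {..<n}"
    unfolding disjoint_family_on_def
  proof (intro ballI impI)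
    fix i j assume ij: "i \<in> {..<n}" "j \<in> {..<n}" "i \<noteq> j"
    show "\<phi> i ` K \<inter> \<phi> j ` K = {}"
    proof (rule ccontr)
      assume "\<phi> i ` K \<inter> \<phi> j ` K \<noteq> {}"
      then obtain t u where tu: "t \<in> S" "u \<in> S" "f i t *\<^sub>R e = f j u *\<^sub>R e" unfolding \<phi>K by blast
      have "e \<noteq> 0" using e by auto
      then have "f i t = f j u" using tu(3) by simp
      moreover have "t \<in> {0..1}" "u \<in> {0..1}" using tu(1,2) sub01[of 0] unfolding S_def by blast+
      ultimately show False using inj ij by blast
    qed
  qed
  ultimately have "dust_like_ifs n r \<phi> K"
    unfolding dust_like_ifs_def self_similar_ifs_def using n by blast
  then show ?thesis unfolding \<phi>_def by blast
qed

lemma gold_sq_powers: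
  defines "\<sigma> \<equiv> gold ^ 2"
  shows "0 < \<sigma>" "\<sigma> < 2/5" "(\<sigma> ^ k) powr (1/2) = gold ^ k"
proof -
  have "sqrt 5 < 11/5 + 4/100" by (rule real_less_lsqrt) (simp_all add: power2_eq_square)
  moreover have "11/5 < sqrt 5" by (rule real_less_rsqrt) (simp add: power2_eq_square)
  ultimately show "\<sigma> < 2/5" by (simp add: \<sigma>_def gold_sq) (simp add: gold_def)
  show "0 < \<sigma>" using gold_bounds by (simp add: \<sigma>_def)
  have "\<sigma> ^ k = (gold ^ k) ^ 2" by (simp add: \<sigma>_def power_mult[symmetric] mult.commute)
  then show "(\<sigma> ^ k) powr (1/2) = gold ^ k" using gold_bounds by (simp add: powr_half_sqrt)
qed

text \<open>With the ratios \<open>\<sigma> ^ expK i\<close> and \<open>\<sigma> ^ expF j\<close>,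
\<open>\<sigma> = gold ^ 2\<close>, the weights belong to dimension \<open>1/2\<close>. The ratios are then
small enough for the intervals to start at the multiples of \<open>1/2\<close> and of \<open>1/5\<close>.\<close>

theorem lipschitz_surjection_without_equivalence:
  shows "\<exists>(K :: 'a::euclidean_space set) (F :: 'a set). dust_like K \<and> dust_like F \<and> hausdorff_dim K = hausdorff_dim F \<and>
    (\<exists>f. lipschitz_map K F f \<and> f ` K = F) \<and> \<not> lipschitz_equivalent K F"
proof -
  obtain e :: 'a where e: "norm e = 1" using norm_Basis nonempty_Basis by blast
  define \<sigma> where "\<sigma> = gold ^ 2"
  note \<sigma> = gold_sq_powers[folded \<sigma>_def]
  have \<sigma>1: "\<sigma> < 1" using \<sigma>(2) by simp
  have \<sigma>2: "\<sigma> ^ 2 < 1/5"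
  proof -
    have "\<sigma> ^ 2 \<le> (2/5) ^ 2" using \<sigma>(1,2) by (intro power_mono) auto
    then show ?thesis by (simp add: power2_eq_square)
  qed
  have small: "\<sigma> ^ k < 1/5" if "2 \<le> k" for k
  proof -
    have "\<sigma> ^ k \<le> \<sigma> ^ 2" using \<sigma>(1) \<sigma>1 that by (intro power_decreasing) auto
    then show ?thesis using \<sigma>2 by simp
  qed
  have rK: "0 < \<sigma> ^ expK i \<and> \<sigma> ^ expK i < 1 \<and> 0 \<le> real i / 2 \<and> real i / 2 + \<sigma> ^ expK i \<le> 1" if "i < 2" for i
  proof -
    from that consider "i = 0" | "i = 1" by linarith
    then show ?thesis using \<sigma>(1,2) \<sigma>1 \<sigma>2 by cases (simp_all add: expK_def)
  qed
  have dK: "real i / 2 + \<sigma> ^ expK i < real j / 2" if "i < 2" "j < 2" "i < j" for i j :: nat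
  proof -
    from that have "i = 0" "j = 1" by auto
    then show ?thesis using \<sigma>(2) by (simp add: expK_def)
  qed
  obtain K where K: "dust_like_ifs 2 (\<lambda>i. \<sigma> ^ expK i) (\<lambda>i v. \<sigma> ^ expK i *\<^sub>R v + (real i / 2) *\<^sub>R e) K"
    using interval_attractor_exists[OF e order_refl, of "\<lambda>i. \<sigma> ^ expK i" "\<lambda>i. real i / 2", OF rK dK] by blast
  have fs: "\<sigma> ^ expF j < 1/5" for j by (rule small) (simp add: expF_def)
  have rF: "0 < \<sigma> ^ expF j \<and> \<sigma> ^ expF j < 1 \<and> 0 \<le> real j / 5 \<and> real j / 5 + \<sigma> ^ expF j \<le> 1" if "j < 5" for j
  proof -
    have "real j \<le> 4" using that by simp
    then have "real j / 5 \<le> 4 / 5" by simp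
    then show ?thesis using fs[of j] \<sigma>(1) by simp
  qed
  have dF: "real i / 5 + \<sigma> ^ expF i < real j / 5" if "i < 5" "j < 5" "i < j" for i j :: nat
  proof -
    have "real i + 1 \<le> real j" using that by simp
    then show ?thesis using fs[of i] by (simp add: field_simps)
  qed
  obtain F where F: "dust_like_ifs 5 (\<lambda>j. \<sigma> ^ expF j) (\<lambda>j v. \<sigma> ^ expF j *\<^sub>R v + (real j / 5) *\<^sub>R e) F"
    using interval_attractor_exists[OF e _, of 5 "\<lambda>j. \<sigma> ^ expF j" "\<lambda>j. real j / 5", OF _ rF dF] by auto
  obtain \<pi> D \<delta> where tK: "tree_coding 2 (\<lambda>i. \<sigma> ^ expK i) \<pi> K D \<delta>"
    using dust_like_tree_coding[OF K] by blast
  obtain \<pi>' E \<epsilon> where tF: "tree_coding 5 (\<lambda>j. \<sigma> ^ expF j) \<pi>' F E \<epsilon>"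
    using dust_like_tree_coding[OF F] by blast
  have "hausdorff_dim K = ereal (1/2)"
    using prob_vector.sum_1[OF prob_vector_K] by (intro hausdorff_dim_tree_coding[OF tK]) (simp_all add: \<sigma>(3))
  moreover have "hausdorff_dim F = ereal (1/2)"
    using prob_vector.sum_1[OF prob_vector_F] by (intro hausdorff_dim_tree_coding[OF tF]) (simp_all add: \<sigma>(3))
  moreover have "dust_like K" unfolding dust_like_def using K by blast
  moreover have "dust_like F" unfolding dust_like_def using F by blast
  moreover have "\<exists>f. lipschitz_map K F f \<and> f ` K = F"
    by (rule lipschitz_surjection_regroup[OF \<sigma>(1) \<sigma>1 tK tF])
  moreover have "\<not> lipschitz_equivalent K F"
    by (rule gold_sets_not_equivalent[OF \<sigma>(1) \<sigma>1 tK tF])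
  ultimately show ?thesis by (intro exI[of _ K] exI[of _ F]) simp
qed

theorem theorem1p5:
  shows "(\<forall>(K :: (real ^ 'n) set) (F :: (real ^ 'n) set) (s :: real).
            dust_like K \<longrightarrow> homogeneous_dust_like F \<longrightarrow>
            hausdorff_dim K = ereal s \<longrightarrow> hausdorff_dim F = ereal s \<longrightarrow>
            (\<exists>f. lipschitz_map K F f \<and> hausdorff_measure s (f ` K) > 0) \<longrightarrow>
            lipschitz_equivalent K F)
       \<and> (\<exists>(K :: (real ^ 'n) set) (F :: (real ^ 'n) set).
            dust_like K \<and> dust_like F \<and> hausdorff_dim K = hausdorff_dim F \<and>
            (\<exists>f. lipschitz_map K F f \<and> f ` K = F) \<and>
            \<not> lipschitz_equivalent K F)"
proof
  show "\<forall>(K :: (real ^ 'n) set) (F :: (real ^ 'n) set) (s :: real).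
            dust_like K \<longrightarrow> homogeneous_dust_like F \<longrightarrow>
            hausdorff_dim K = ereal s \<longrightarrow> hausdorff_dim F = ereal s \<longrightarrow>
            (\<exists>f. lipschitz_map K F f \<and> hausdorff_measure s (f ` K) > 0) \<longrightarrow>
            lipschitz_equivalent K F"
    using lipschitz_image_of_positive_measure by blast
qed (rule lipschitz_surjection_without_equivalence)

end
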